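(* Let $\alpha\in\mathbb{R}$, $q\in(0,\infty]$, $p\in[1,\infty)$ and $\mathbf{W}\in A_p$ (with respect to the expansive dilation $A$). Let $(\varphi,\psi)$ be an admissible pair. Then there exists a constant $C>0$ such that, for every $\vec f\in\dot{B}^{\alpha,q}_{p,A}(\mathbb{R}^d,\mathbf{W})$, $$\left\|\{\vec s_Q\}_{Q\in\mathcal{Q}}\right\|_{\dot{b}^{\alpha,q}_{p,A}(\mathbf{W})}\le C\left\|\vec f\,\right\|_{\dot{B}^{\alpha,q}_{p,A}(\mathbb{R}^d,\mathbf{W})},$$ where $\vec s_Q=\langle\vec f,\varphi_Q\rangle=(\langle f_1,\varphi_Q\rangle,\dots,\langle f_m,\varphi_Q\rangle)^T$ are the $\varphi$-transform coefficients of $\vec f$.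
   Context: Dilations. $A$ is a fixed expansive dilation: a real $d\times d$ matrix all of whose (complex) eigenvalues $\lambda$ satisfy $|\lambda|>1$. Fix an ellipsoid $\Delta=\{x\in\mathbb{R}^d:|Px|<1\}$ ($P$ a nondegenerate $d\times d$ matrix) with $|\Delta|=1$ and $\Delta\subset r\Delta\subset A\Delta$ for some $r>1$ (such a $\Delta$ exists). Put $B_k=A^k\Delta$ for $k\in\mathbb{Z}$ and $\mathfrak{B}=\{x+B_k:x\in\mathbb{R}^d,\ k\in\mathbb{Z}\}$ (dilated balls). $A^*$ denotes the transpose of $A$. Matrix weights. Let $\mathcal{H}=\mathbb{C}^m$ with its Euclidean norm $\|\cdot\|$. A matrix weight is a measurable map $\mathbf{W}$ from $\mathbb{R}^d$ to the nonnegative definite $m\times m$ matrices that is invertible almost everywhere. For $p\in[1,\infty)$ and measurable $\vec f:\mathbb{R}^d\to\mathcal{H}$, $\|\vec f\|_{L^p(\mathbf{W})}=\left(\int_{\mathbb{R}^d}\|\mathbf{W}^{1/p}(x)\vec f(x)\|^p\,dx\right)^{1/p}$. The class $A_p$. Let $1/p+1/p'=1$, and for $t\in\mathbb{R}^d$, $y\in\mathcal{H}$ let $\omega_t(y)=\|\mathbf{W}^{1/p}(t)y\|$ and $\omega_t^*(y)=\|\mathbf{W}^{-1/p}(t)y\|$ (the dual norm). For $B\in\mathfrak{B}$ let $\omega_{p,B}(y)=\left(\frac1{|B|}\int_B\omega_t(y)^p\,dt\right)^{1/p}$, let $(\omega_{p,B})^*$ be the dual norm of $\omega_{p,B}$,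 i.e. $(\omega_{p,B})^*(y)=\sup_{z\ne0}|\langle y,z\rangle|/\omega_{p,B}(z)$, and let $\omega^*_{p',B}(y)=\left(\frac1{|B|}\int_B\omega_t^*(y)^{p'}\,dt\right)^{1/p'}$. For $p\in(1,\infty)$, $\mathbf{W}\in A_p$ means that $\mathbf{W}$ and $\mathbf{W}^{-p'/p}$ are locally integrable and there is $C>0$ with $\omega^*_{p',B}(y)\le C(\omega_{p,B})^*(y)$ for all $y\in\mathcal{H}$ and $B\in\mathfrak{B}$. For $p=1$, $\mathbf{W}\in A_1$ means that $\mathbf{W}$ is locally integrable and the same inequality holds with $\omega^*_{\infty,B}(y)=\operatorname{ess\,sup}_{t\in B}\omega_t^*(y)$. Admissible pairs. The Fourier transform is $\hat f(\xi)=\int f(x)e^{-ix\cdot\xi}\,dx$. An admissible pair $(\varphi,\psi)$ consists of Schwartz functions on $\mathbb{R}^d$ with $\operatorname{supp}\hat\varphi,\operatorname{supp}\hat\psi\subset[-\pi,\pi]^d\setminus\{\mathbf 0\}$ and $\sum_{k\in\mathbb{Z}}\overline{\hat\varphi((A^* )^{-k}\xi)}\,\hat\psi((A^* )^{-k}\xi)=1$ for all $\xi\in\mathbb{R}^d\setminus\{\mathbf 0\}$. Put $\varphi_k(x)=|\det A|^{k}\varphi(A^{k}x)$. Function space. $\dot{B}^{\alpha,q}_{p,A}(\mathbb{R}^d,\mathbf{W})$ is the set of $\vec f=(f_1,\dots,f_m)^T$ with $f_i\in\mathcal{S}'/\mathcal{P}(\mathbb{R}^d)$ (tempered distributions modulo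 polynomials) such that $\|\vec f\|_{\dot{B}^{\alpha,q}_{p,A}(\mathbb{R}^d,\mathbf{W})}=\left(\sum_{k\in\mathbb{Z}}|\det A|^{k\alpha q}\|\vec f*\varphi_k\|_{L^p(\mathbf{W})}^q\right)^{1/q}<\infty$ (supremum over $k$ if $q=\infty$), where the convolution is componentwise and $\varphi$ is the first member of the fixed admissible pair. Sequence space. For $\mathbf{j}\in\mathbb{Z}^d$, $k\in\mathbb{Z}$ let $Q_{\mathbf{j},k}=A^{-k}([0,1]^d+\mathbf{j})$, $x_{Q_{\mathbf{j},k}}=A^{-k}\mathbf{j}$, and $\mathcal{Q}=\{Q_{\mathbf{j},k}:k\in\mathbb{Z},\ \mathbf{j}\in\mathbb{Z}^d\}$, so that $|Q_{\mathbf{j},k}|=|\det A|^{-k}$. $\dot{b}^{\alpha,q}_{p,A}(\mathbf{W})$ is the set of sequences $\vec s=\{\vec s_Q\}_{Q\in\mathcal{Q}}$, $\vec s_Q\in\mathcal{H}$, such that $$\|\vec s\|_{\dot{b}^{\alpha,q}_{p,A}(\mathbf{W})}=\left(\sum_{k\in\mathbb{Z}}|\det A|^{k\alpha q}\left\|\sum_{|Q|=|\det A|^{-k}}|Q|^{-1/2}\,\|\mathbf{W}^{1/p}(x)\vec s_Q\|\,\mathbf{1}_Q(x)\right\|_{L^p(dx)}^q\right)^{1/q}<\infty$$ (supremum over $k$ if $q=\infty$). $\varphi$-transform. For $Q=Q_{\mathbf{j},k}$, $\varphi_Q(x)=|\det A|^{k/2}\varphi(A^kx-\mathbf{j})$.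 The pairing $\langle f,g\rangle$ is linear in $f$ and conjugate-linear in $g$ (it is $\int f\overline{g}$ when $f$ is a function), so that $\langle\vec f,\varphi_Q\rangle=|Q|^{1/2}(\vec f*\widetilde\varphi_k)(A^{-k}\mathbf{j})$ with $\widetilde\varphi(x)=\overline{\varphi(-x)}$. *)

theory Defs
  imports "HOL-Analysis.Analysis" "HOL-Probability.Essential_Supremum"
begin

text \<open>
  The type class operations \<open>*\<close> and \<open>^\<close> act componentwise on \<open>'a ^ 'n ^ 'n\<close>, so integer powers
  with respect to the matrix product \<open>**\<close> are introduced here.
\<close>

definition mat_powi :: "real^'d^'d \<Rightarrow> int \<Rightarrow> real^'d^'d" where
  "mat_powi A k =
     (if 0 \<le> k then (((**) A) ^^ nat k) (mat 1)
      else (((**) (matrix_inv A)) ^^ nat (- k)) (mat 1))"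

definition expansive :: "real^'d^'d \<Rightarrow> bool" where
  "expansive A \<longleftrightarrow>
     (\<forall>(l::complex) (v::complex^'d).
        v \<noteq> 0 \<and> map_matrix complex_of_real A *v v = l *s v \<longrightarrow> 1 < cmod l)"

definition ellipsoid :: "real^'d^'d \<Rightarrow> (real^'d) set" where
  "ellipsoid P = {x. norm (P *v x) < 1}"

definition adapted_ellipsoid :: "real^'d^'d \<Rightarrow> real^'d^'d \<Rightarrow> bool" where
  "adapted_ellipsoid A P \<longleftrightarrow>
     invertible P \<and> emeasure lebesgue (ellipsoid P) = 1 \<and>
     (\<exists>r>1. ellipsoid P \<subseteq> (*\<^sub>R) r ` ellipsoid P \<and>
            (*\<^sub>R) r ` ellipsoid P \<subseteq> (*v) A ` ellipsoid P)"

definition dilated_balls :: "real^'d^'d \<Rightarrow> real^'d^'d \<Rightarrow> (real^'d) set set" where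
  "dilated_balls A P = {(\<lambda>y. x + y) ` ((*v) (mat_powi A k) ` ellipsoid P) | x k. True}"

definition cinner :: "complex^'m \<Rightarrow> complex^'m \<Rightarrow> complex" where
  "cinner x y = (\<Sum>i\<in>UNIV. x $ i * cnj (y $ i))"

definition ctranspose :: "complex^'m^'m \<Rightarrow> complex^'m^'m" where
  "ctranspose M = transpose (map_matrix cnj M)"

definition nonneg_definite :: "complex^'m^'m \<Rightarrow> bool" where
  "nonneg_definite M \<longleftrightarrow> ctranspose M = M \<and> (\<forall>v. 0 \<le> Re (cinner (M *v v) v))"

definition diag_mat :: "('m \<Rightarrow> complex) \<Rightarrow> complex^'m^'m" where
  "diag_mat d = (\<chi> i j. if i = j then d i else 0)"

text \<open>
  Real powers of a nonnegative definite matrix by the spectral functional calculus (the value does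
  not depend on the diagonalisation). Since \<open>0 powr s = 0\<close>, kernels are sent to \<open>0\<close>; negative
  powers are only relevant at the (almost all) points where a weight is invertible.
\<close>

definition mat_powr :: "complex^'m^'m \<Rightarrow> real \<Rightarrow> complex^'m^'m" where
  "mat_powr M s =
     (THE N. \<exists>U (d :: 'm \<Rightarrow> real).
        ctranspose U ** U = mat 1 \<and> (\<forall>i. 0 \<le> d i) \<and>
        M = U ** diag_mat (\<lambda>i. complex_of_real (d i)) ** ctranspose U \<and>
        N = U ** diag_mat (\<lambda>i. complex_of_real (d i powr s)) ** ctranspose U)"

text \<open>\<open>ennpowr\<close> is only used with positive exponents.\<close>

definition ennpowr :: "ennreal \<Rightarrow> real \<Rightarrow> ennreal" where
  "ennpowr x a = (if x = \<infinity> then \<infinity> else ennreal (enn2real x powr a))"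

definition Lp_norm :: "real \<Rightarrow> (real^'d \<Rightarrow> ennreal) \<Rightarrow> ennreal" where
  "Lp_norm p g = ennpowr (\<integral>\<^sup>+x. ennpowr (g x) p \<partial>lebesgue) (1 / p)"

definition weighted_Lp_norm ::
  "real \<Rightarrow> (real^'d \<Rightarrow> complex^'m^'m) \<Rightarrow> (real^'d \<Rightarrow> complex^'m) \<Rightarrow> ennreal" where
  "weighted_Lp_norm p W F = Lp_norm p (\<lambda>x. ennreal (norm (mat_powr (W x) (1 / p) *v F x)))"

definition weighted_lq_norm :: "real \<Rightarrow> real \<Rightarrow> ennreal \<Rightarrow> (int \<Rightarrow> ennreal) \<Rightarrow> ennreal" where
  "weighted_lq_norm b \<alpha> q a =
     (if q = \<infinity> then (SUP k. ennreal (b powr (of_int k * \<alpha>)) * a k)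
      else ennpowr (\<Sum>\<^sub>\<infinity>k. ennreal (b powr (of_int k * \<alpha> * enn2real q)) * ennpowr (a k) (enn2real q))
             (1 / enn2real q))"

definition matrix_weight :: "(real^'d \<Rightarrow> complex^'m^'m) \<Rightarrow> bool" where
  "matrix_weight W \<longleftrightarrow>
     W \<in> borel_measurable lebesgue \<and> (\<forall>x. nonneg_definite (W x)) \<and>
     (AE x in lebesgue. invertible (W x))"

definition locally_integrable :: "(real^'d \<Rightarrow> complex^'m^'m) \<Rightarrow> bool" where
  "locally_integrable W \<longleftrightarrow> (\<forall>K. compact K \<longrightarrow> W absolutely_integrable_on K)"

definition weight_norm ::
  "real \<Rightarrow> (real^'d \<Rightarrow> complex^'m^'m) \<Rightarrow> real^'d \<Rightarrow> complex^'m \<Rightarrow> real" where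
  "weight_norm p W t y = norm (mat_powr (W t) (1 / p) *v y)"

definition weight_norm_dual ::
  "real \<Rightarrow> (real^'d \<Rightarrow> complex^'m^'m) \<Rightarrow> real^'d \<Rightarrow> complex^'m \<Rightarrow> real" where
  "weight_norm_dual p W t y = norm (mat_powr (W t) (- (1 / p)) *v y)"

definition avg_norm ::
  "real \<Rightarrow> (real^'d \<Rightarrow> complex^'m \<Rightarrow> real) \<Rightarrow> (real^'d) set \<Rightarrow> complex^'m \<Rightarrow> ennreal" where
  "avg_norm r N B y =
     ennpowr ((\<integral>\<^sup>+t\<in>B. ennreal (N t y powr r) \<partial>lebesgue) / emeasure lebesgue B) (1 / r)"

definition sup_norm ::
  "(real^'d \<Rightarrow> complex^'m \<Rightarrow> real) \<Rightarrow> (real^'d) set \<Rightarrow> complex^'m \<Rightarrow> ennreal" where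
  "sup_norm N B y = esssup (lebesgue_on B) (\<lambda>t. ennreal (N t y))"

definition dual_norm :: "(complex^'m \<Rightarrow> ennreal) \<Rightarrow> complex^'m \<Rightarrow> ennreal" where
  "dual_norm N y = (SUP z\<in>- {0}. ennreal (cmod (cinner y z)) / N z)"

definition conj_exp :: "real \<Rightarrow> real" where
  "conj_exp p = p / (p - 1)"

definition Ap_class ::
  "real^'d^'d \<Rightarrow> real^'d^'d \<Rightarrow> real \<Rightarrow> (real^'d \<Rightarrow> complex^'m^'m) set" where
  "Ap_class A P p =
     {W. matrix_weight W \<and> locally_integrable W \<and>
         (if p = 1 then
            \<exists>C>0. \<forall>y. \<forall>B\<in>dilated_balls A P.
              sup_norm (weight_norm_dual p W) B y
                \<le> ennreal C * dual_norm (avg_norm p (weight_norm p W) B) y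
          else
            locally_integrable (\<lambda>x. mat_powr (W x) (- (conj_exp p / p))) \<and>
            (\<exists>C>0. \<forall>y. \<forall>B\<in>dilated_balls A P.
              avg_norm (conj_exp p) (weight_norm_dual p W) B y
                \<le> ennreal C * dual_norm (avg_norm p (weight_norm p W) B) y))}"

fun iter_partial :: "'d list \<Rightarrow> (real^'d \<Rightarrow> complex) \<Rightarrow> real^'d \<Rightarrow> complex" where
  "iter_partial [] g = g"
| "iter_partial (i # is) g =
     (\<lambda>x. frechet_derivative (iter_partial is g) (at x) (axis i 1))"

definition schwartz :: "(real^'d \<Rightarrow> complex) set" where
  "schwartz =
     {g. \<forall>is. (\<forall>x. iter_partial is g differentiable at x) \<and>
              (\<forall>n::nat. \<exists>C. \<forall>x. (1 + norm x) ^ n * cmod (iter_partial is g x) \<le> C)}"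

definition schwartz_seminorm :: "nat \<Rightarrow> (real^'d \<Rightarrow> complex) \<Rightarrow> real" where
  "schwartz_seminorm n g =
     (SUP (is, x) \<in> {is. length is \<le> n} \<times> UNIV. (1 + norm x) ^ n * cmod (iter_partial is g x))"

text \<open>
  Functionals are HOL functions on all of \<open>real^'d \<Rightarrow> complex\<close>; their values outside
  \<^const>\<open>schwartz\<close> are irrelevant and are identified by \<open>mod_poly\<close> below. The continuity clause is
  continuity for the topology generated by the increasing family \<^const>\<open>schwartz_seminorm\<close>.
\<close>

definition tempered :: "((real^'d \<Rightarrow> complex) \<Rightarrow> complex) set" where
  "tempered =
     {u. (\<forall>g\<in>schwartz. \<forall>h\<in>schwartz. u (\<lambda>x. g x + h x) = u g + u h) \<and>
         (\<forall>c. \<forall>g\<in>schwartz. u (\<lambda>x. c * g x) = c * u g) \<and>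
         (\<forall>g\<in>schwartz. \<forall>e>0. \<exists>n. \<exists>\<delta>>0. \<forall>h\<in>schwartz.
            schwartz_seminorm n (\<lambda>x. h x - g x) < \<delta> \<longrightarrow> cmod (u h - u g) < e)}"

definition mod_poly ::
  "(((real^'d \<Rightarrow> complex) \<Rightarrow> complex) \<times> ((real^'d \<Rightarrow> complex) \<Rightarrow> complex)) set" where
  "mod_poly =
     {(u, v). u \<in> tempered \<and> v \<in> tempered \<and>
        (\<exists>p. polynomial_function p \<and>
             (\<forall>g\<in>schwartz. u g - v g = (LINT x|lebesgue. p x * g x)))}"

type_synonym 'd distr_class = "((real^'d \<Rightarrow> complex) \<Rightarrow> complex) set"

definition tempered_mod_poly :: "('d::finite) distr_class set" where
  "tempered_mod_poly = tempered // mod_poly"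

text \<open>
  The action of a class on a test function is that of a representative; it does not depend on the
  choice for test functions with vanishing moments, in particular for those built below from
  admissible functions.
\<close>

definition class_act :: "'d distr_class \<Rightarrow> (real^'d \<Rightarrow> complex) \<Rightarrow> complex" where
  "class_act F g = (SOME u. u \<in> F) g"

definition pairing :: "'d distr_class \<Rightarrow> (real^'d \<Rightarrow> complex) \<Rightarrow> complex" where
  "pairing F g = class_act F (\<lambda>x. cnj (g x))"

definition convol :: "'d distr_class \<Rightarrow> (real^'d \<Rightarrow> complex) \<Rightarrow> real^'d \<Rightarrow> complex" where
  "convol F g x = class_act F (\<lambda>y. g (x - y))"

definition fourier :: "(real^'d \<Rightarrow> complex) \<Rightarrow> real^'d \<Rightarrow> complex" where
  "fourier g \<xi> = (LINT x|lebesgue. g x * exp (- (\<i> * complex_of_real (x \<bullet> \<xi>))))"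

definition admissible_pair ::
  "real^'d^'d \<Rightarrow> (real^'d \<Rightarrow> complex) \<Rightarrow> (real^'d \<Rightarrow> complex) \<Rightarrow> bool" where
  "admissible_pair A \<phi> \<psi> \<longleftrightarrow>
     \<phi> \<in> schwartz \<and> \<psi> \<in> schwartz \<and>
     closure {\<xi>. fourier \<phi> \<xi> \<noteq> 0} \<subseteq> cbox (\<chi> i. - pi) (\<chi> i. pi) - {0} \<and>
     closure {\<xi>. fourier \<psi> \<xi> \<noteq> 0} \<subseteq> cbox (\<chi> i. - pi) (\<chi> i. pi) - {0} \<and>
     (\<forall>\<xi>. \<xi> \<noteq> 0 \<longrightarrow>
        ((\<lambda>k::int. cnj (fourier \<phi> (mat_powi (transpose A) (- k) *v \<xi>)) *
                   fourier \<psi> (mat_powi (transpose A) (- k) *v \<xi>)) has_sum 1) UNIV)"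

definition dilate ::
  "real^'d^'d \<Rightarrow> (real^'d \<Rightarrow> complex) \<Rightarrow> int \<Rightarrow> real^'d \<Rightarrow> complex" where
  "dilate A \<phi> k x = complex_of_real (\<bar>det A\<bar> powi k) * \<phi> (mat_powi A k *v x)"

definition besov_norm ::
  "real^'d^'d \<Rightarrow> (real^'d \<Rightarrow> complex) \<Rightarrow> (real^'d \<Rightarrow> complex^'m^'m) \<Rightarrow>
   real \<Rightarrow> real \<Rightarrow> ennreal \<Rightarrow> 'd distr_class^'m \<Rightarrow> ennreal" where
  "besov_norm A \<phi> W \<alpha> p q f =
     weighted_lq_norm \<bar>det A\<bar> \<alpha> q
       (\<lambda>k. weighted_Lp_norm p W (\<lambda>x. \<chi> i. convol (f $ i) (dilate A \<phi> k) x))"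

definition besov_space ::
  "real^'d^'d \<Rightarrow> (real^'d \<Rightarrow> complex) \<Rightarrow> (real^'d \<Rightarrow> complex^'m^'m) \<Rightarrow>
   real \<Rightarrow> real \<Rightarrow> ennreal \<Rightarrow> ('d distr_class^'m) set" where
  "besov_space A \<phi> W \<alpha> p q =
     {f. (\<forall>i. f $ i \<in> tempered_mod_poly) \<and> besov_norm A \<phi> W \<alpha> p q f < \<infinity>}"

definition int_vec :: "int^'d \<Rightarrow> real^'d" where
  "int_vec j = (\<chi> i. real_of_int (j $ i))"

definition dcube :: "real^'d^'d \<Rightarrow> int^'d \<Rightarrow> int \<Rightarrow> (real^'d) set" where
  "dcube A j k = (\<lambda>x. mat_powi A (- k) *v (x + int_vec j)) ` cbox 0 1"

definition dcubes :: "real^'d^'d \<Rightarrow> (real^'d) set set" where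
  "dcubes A = {dcube A j k | j k. True}"

definition seq_besov_norm ::
  "real^'d^'d \<Rightarrow> (real^'d \<Rightarrow> complex^'m^'m) \<Rightarrow> real \<Rightarrow> real \<Rightarrow> ennreal \<Rightarrow>
   ((real^'d) set \<Rightarrow> complex^'m) \<Rightarrow> ennreal" where
  "seq_besov_norm A W \<alpha> p q s =
     weighted_lq_norm \<bar>det A\<bar> \<alpha> q
       (\<lambda>k. Lp_norm p (\<lambda>x.
          \<Sum>\<^sub>\<infinity>Q\<in>{Q \<in> dcubes A. measure lebesgue Q = \<bar>det A\<bar> powi (- k)}.
            ennreal (measure lebesgue Q powr (- (1 / 2)) * norm (mat_powr (W x) (1 / p) *v s Q))
              * indicator Q x))"

text \<open>
  For an expansive \<open>A\<close> one has \<open>\<bar>det A\<bar> > 1\<close>, so every cube in \<^term>\<open>dcubes A\<close> is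
  \<^term>\<open>dcube A j k\<close> for exactly one pair \<open>(j, k)\<close>.
\<close>

definition dcube_index :: "real^'d^'d \<Rightarrow> (real^'d) set \<Rightarrow> (int^'d) \<times> int" where
  "dcube_index A Q = (THE jk. Q = dcube A (fst jk) (snd jk))"

definition wavelet ::
  "real^'d^'d \<Rightarrow> (real^'d \<Rightarrow> complex) \<Rightarrow> (real^'d) set \<Rightarrow> real^'d \<Rightarrow> complex" where
  "wavelet A \<phi> Q x =
     (case dcube_index A Q of (j, k) \<Rightarrow>
        complex_of_real (\<bar>det A\<bar> powr (of_int k / 2)) * \<phi> (mat_powi A k *v x - int_vec j))"

definition phi_transform ::
  "real^'d^'d \<Rightarrow> (real^'d \<Rightarrow> complex) \<Rightarrow> 'd distr_class^'m \<Rightarrow> (real^'d) set \<Rightarrow> complex^'m" where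
  "phi_transform A \<phi> f Q = (\<chi> i. pairing (f $ i) (wavelet A \<phi> Q))"

end

theory Submission
  imports Defs "HOL-Probability.Characteristic_Functions" "HOL-Probability.Distributions"
begin

text \<open>
  The coefficient of a distribution at a cube of level \<open>k\<close> is a value of a convolution at a lattice
  point, whereas the norm of the function space controls integrals of the convolutions
  \<open>F l\<close> of the distribution with the dilates \<open>dilate A \<phi> l\<close>. Point values are recovered from integrals by a
  reproducing formula. The supports of the Fourier transforms of an admissible pair are compact and do
  not contain the origin, and the transposed dilation contracts a norm, the one whose unit ball is the
  polar of the ellipsoid; hence all but finitely many terms of the identity that defines an admissible
  pair vanish on the support of the Fourier transform of \<open>\<phi>\<close>. Inverting the Fourier transform, the
  conjugate of \<open>\<phi>\<close> is a finite sum of convolutions of reflected dilates of \<open>\<phi>\<close> with Schwartz functions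
  \<open>\<theta> i\<close>, \<open>\<bar>i\<bar> \<le> N\<close> (\<open>reproducing_formula\<close>). A tempered distribution may be moved inside a convolution
  integral (\<open>tempered_convolve\<close>), so the coefficient is a finite sum of integrals of \<open>F (k + i)\<close> against \<open>\<theta> i\<close>
  rescaled to the cube (\<open>tempered_reproducing\<close>, \<open>sampled_at\<close>).

  The weight enters on a single cube \<open>Q\<close>. A Muckenhoupt matrix weight does not allow moving norms
  from one point to another, but it allows pairings: for a dilated ball \<open>B\<close> and a vector \<open>z\<close>, the
  integral over \<open>B\<close> of \<open>\<bar>\<langle>F x, z\<rangle>\<bar>\<close> is at most the integral of the weighted norm of \<open>F x\<close> times the dual
  weighted norm of \<open>z\<close>, and Hoelder's inequality and the \<open>A\<^sub>p\<close> condition bound it by the weighted \<open>L\<^sup>p\<close>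
  norm of \<open>F\<close> on \<open>B\<close> times the dual, at \<open>z\<close>, of the weight averaged over \<open>B\<close> (\<open>Ap_pairing\<close>). Let \<open>B\<close> run
  through the dilated balls around \<open>Q\<close>. Volumes and constants grow geometrically, but \<open>\<theta> i\<close> decreases
  rapidly and absorbs them at any prescribed geometric rate
  (\<open>rapidly_decreasing_dilated_ellipsoid\<close>). Thus the pairing of the coefficient with \<open>z\<close> is bounded by
  the dual, at \<open>z\<close>, of the weight averaged over \<open>Q\<close>. The averaged norm of the coefficient follows
  because a norm is determined by its dual, which is a separation argument (\<open>bidual_le\<close>,
  \<open>avg_norm_bidual_le\<close>). The outcome, \<open>cube_estimate\<close>, bounds the \<open>p\<close>-th power of the norm of the
  coefficient over \<open>Q\<close> by integrals of the \<open>p\<close>-th powers of the weighted norms of \<open>F (k + i)\<close> against a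
  polynomially decreasing kernel centred at \<open>Q\<close>.

  The rest is summation. The cubes of a level overlap in null sets only, and the kernels of the cubes
  of a level add up to a bounded function (\<open>lattice_sum_bounded\<close>); this gives \<open>level_estimate\<close>, a bound of
  the norm on level \<open>k\<close> by the weighted \<open>L\<^sup>p\<close> norms of \<open>F (k + i)\<close>, \<open>\<bar>i\<bar> \<le> N\<close>. Finitely many shifts of the
  index cost a constant in the weighted \<open>l\<^sup>q\<close> norms (\<open>weighted_lq_norm_shift\<close>).

  Real powers of matrices have to be well defined and measurable in the matrix. The spectral
  theorem (\<open>nonneg_definite_spectral\<close>) provides diagonalisations, and approximation of powers by
  polynomials makes the result independent of their choice and a Borel function of the matrix
  (\<open>mat_powr_eq\<close>, \<open>borel_measurable_mat_powr\<close>).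
\<close>

section \<open>Matrices\<close>

lemma cinner_add_left: "cinner (x + y) z = cinner x z + cinner y z"
  by (simp add: cinner_def algebra_simps sum.distrib)

lemma cinner_scale_left: "cinner (c *s x) z = c * cinner x z"
  by (simp add: cinner_def algebra_simps sum_distrib_left)

lemma cinner_scale_right: "cinner x (c *s z) = cnj c * cinner x z"
  by (simp add: cinner_def algebra_simps sum_distrib_left)

lemma cinner_commute: "cinner x y = cnj (cinner y x)"
  by (simp add: cinner_def algebra_simps)

lemma Re_cinner: "Re (cinner x y) = x \<bullet> y"
  by (simp add: cinner_def inner_vec_def inner_complex_def)

lemma cinner_self: "cinner x x = complex_of_real ((norm x)\<^sup>2)"
proof (rule complex_eqI)
  show "Re (cinner x x) = Re (complex_of_real ((norm x)\<^sup>2))"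
    by (simp add: Re_cinner power2_norm_eq_inner)
  show "Im (cinner x x) = Im (complex_of_real ((norm x)\<^sup>2))"
    by (simp add: cinner_def)
qed

lemma cinner_zero [simp]: "cinner 0 y = 0" "cinner x 0 = 0"
  by (simp_all add: cinner_def)

lemma cinner_ctranspose: "cinner (M *v x) y = cinner x (ctranspose M *v y)"
proof -
  have "cinner (M *v x) y = (\<Sum>i\<in>UNIV. \<Sum>j\<in>UNIV. M$i$j * x$j * cnj (y$i))"
    by (simp add: cinner_def matrix_vector_mult_def sum_distrib_right)
  also have "\<dots> = (\<Sum>j\<in>UNIV. \<Sum>i\<in>UNIV. M$i$j * x$j * cnj (y$i))"
    by (rule sum.swap)
  also have "\<dots> = cinner x (ctranspose M *v y)"
    by (simp add: cinner_def matrix_vector_mult_def sum_distrib_left ctranspose_def transpose_def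
        map_matrix_def algebra_simps)
  finally show ?thesis .
qed

text \<open>Rotating \<open>y\<close> so that \<open>cinner x y\<close> becomes real reduces the complex pairing to the real
  inner product.\<close>

lemma cinner_rotate:
  obtains c where "cmod c = 1" "cmod (cinner x y) = x \<bullet> (c *s y)" 
proof (cases "cinner x y = 0")
  case True
  have "x \<bullet> (1 *s y) = cmod (cinner x y)"
    using True Re_cinner[of x y] by simp
  then show thesis using that[of 1] by simp
next
  case False
  define c where "c = cinner x y / complex_of_real (cmod (cinner x y))"
  have "cinner x (c *s y) = complex_of_real (cmod (cinner x y))"
    using False complex_norm_square[of "cinner x y"]
    by (simp add: cinner_scale_right c_def field_simps power2_eq_square)
  then have "x \<bullet> (c *s y) = cmod (cinner x y)"
    by (metis Re_cinner Re_complex_of_real)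
  moreover have "cmod c = 1" using False by (simp add: c_def norm_divide)
  ultimately show thesis using that by metis
qed

lemma norm_cscale: "norm (c *s (x::complex^'m)) = cmod c * norm x"
  by (simp add: norm_vec_def L2_set_def norm_mult power_mult_distrib real_sqrt_mult
      flip: sum_distrib_left)

lemma cinner_Cauchy_Schwarz: "cmod (cinner x y) \<le> norm x * norm y"
proof -
  obtain c where "cmod c = 1" "cmod (cinner x y) = x \<bullet> (c *s y)" by (rule cinner_rotate)
  with norm_cauchy_schwarz[of x "c *s y"] show ?thesis by (simp add: norm_cscale)
qed

lemma linear_term_zero_if_quadratic_nonneg:
  fixes a b :: real
  assumes "\<And>t. 0 \<le> 2 * t * a + t\<^sup>2 * b"
  shows "a = 0"
proof (rule ccontr)
  assume "a \<noteq> 0"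
  define c where "c = \<bar>b\<bar> + 1"
  define t where "t = - a / c"
  have c: "c > 0" "b \<le> c" by (auto simp: c_def)
  then have tc: "t * c = - a" by (simp add: t_def)
  have "2 * t * a + t\<^sup>2 * b \<le> 2 * t * a + t\<^sup>2 * c"
    by (intro add_left_mono mult_left_mono c) auto
  also have "\<dots> = t * (2 * a + t * c)"
    by (simp add: power2_eq_square algebra_simps)
  also have "\<dots> = - (a * a / c)"
    by (simp add: tc t_def)
  also have "\<dots> < 0" using \<open>a \<noteq> 0\<close> c by (simp add: divide_pos_pos flip: power2_eq_square)
  finally show False using assms[of t] by simp
qed

lemma csmult_of_real: "complex_of_real r *s (v::complex^'m) = r *\<^sub>R v"
  by (simp add: vec_eq_iff) (simp add: scaleR_conv_of_real)

lemma matrix_scaleR_left: "(M::complex^'m^'m) *v (r *\<^sub>R x) = r *\<^sub>R (M *v x)"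
  by (simp add: vec_eq_iff matrix_vector_mult_def scaleR_sum_right)

text \<open>The maximum \<open>r\<close> of the quadratic form on the unit sphere of the orthogonal complement of given
  eigenvectors is attained at a further eigenvector \<open>v\<close>: the form \<open>r * (x \<bullet> x) - (M *v x) \<bullet> x\<close> is
  nonnegative on the complement and vanishes at \<open>v\<close>, so its first variation there is zero.\<close>

lemma hermitian_extend_eigenvectors:
  fixes M :: "complex^'m^'m"
  assumes herm: "ctranspose M = M" and I: "finite I" "card I < CARD('m)"
    and eig: "\<And>i. i \<in> I \<Longrightarrow> M *v e i = complex_of_real (l i) *s e i"
  obtains v r where "norm v = 1" "M *v v = complex_of_real r *s v"
    "\<And>i. i \<in> I \<Longrightarrow> cinner v (e i) = 0"
proof -
  define V where "V = {x. \<forall>i\<in>I. cinner x (e i) = 0}"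
  have inv: "M *v x \<in> V" if "x \<in> V" for x
    using that eig by (auto simp: V_def cinner_ctranspose herm cinner_scale_right)
  have V_lin: "x + t *\<^sub>R y \<in> V" if "x \<in> V" "y \<in> V" for x y t
    using that by (auto simp: V_def cinner_add_left cinner_scale_left simp flip: csmult_of_real)
  have "\<exists>x. x \<noteq> 0 \<and> x \<in> V"
  proof -
    \<comment> \<open>real orthogonality to \<open>e i\<close> and to \<open>\<i> *s e i\<close> is complex orthogonality to \<open>e i\<close>\<close>
    define T where "T = e ` I \<union> (\<lambda>i. \<i> *s e i) ` I"
    have "card T \<le> card (e ` I) + card ((\<lambda>i. \<i> *s e i) ` I)"
      unfolding T_def by (rule card_Un_le)
    also have "\<dots> \<le> card I + card I" by (intro add_mono card_image_le I)
    also have "\<dots> < DIM(complex^'m)" using I by simp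
    finally have "dim T < DIM(complex^'m)"
      using dim_le_card'[of T] I by (auto simp: T_def)
    then obtain x where x: "x \<noteq> 0" "\<And>y. y \<in> span T \<Longrightarrow> orthogonal x y"
      using orthogonal_to_subspace_exists by metis
    have "cinner x (e i) = 0" if "i \<in> I" for i
    proof (rule complex_eqI)
      have "x \<bullet> e i = 0" "x \<bullet> (\<i> *s e i) = 0"
        using x(2)[OF span_base, of "e i"] x(2)[OF span_base, of "\<i> *s e i"] that
        by (auto simp: T_def orthogonal_def)
      then have "Re (cinner x (e i)) = 0" "Re (cinner x (\<i> *s e i)) = 0"
        unfolding Re_cinner by auto
      then show "Re (cinner x (e i)) = Re 0" "Im (cinner x (e i)) = Im 0"
        by (simp_all add: cinner_scale_right)
    qed
    then show ?thesis using x(1) by (auto simp: V_def)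
  qed
  then obtain x0 where x0: "x0 \<noteq> 0" "x0 \<in> V" by blast
  have cont: "continuous_on UNIV (\<lambda>x. cinner x y)" for y :: "complex^'m"
    unfolding cinner_def by (intro continuous_intros)
  have "closed V"
  proof -
    have "closed (\<Inter>i\<in>I. {x. cinner x (e i) = 0})"
      by (intro closed_INT ballI closed_Collect_eq cont continuous_on_const)
    moreover have "V = (\<Inter>i\<in>I. {x. cinner x (e i) = 0})" by (auto simp: V_def)
    ultimately show ?thesis by simp
  qed
  define S where "S = V \<inter> sphere 0 1"
  have "compact S" unfolding S_def by (intro closed_Int_compact \<open>closed V\<close> compact_sphere)
  moreover have "(1 / norm x0) *\<^sub>R x0 \<in> S"
    using x0 V_lin[of 0 x0 "1 / norm x0"] by (simp add: S_def) (simp add: V_def)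
  moreover have "continuous_on S (\<lambda>x. (M *v x) \<bullet> x)"
    by (intro continuous_intros matrix_vector_mult_linear_continuous_on
        continuous_on_subset[OF linear_continuous_on[OF matrix_vector_mul_bounded_linear[of M]]])
      auto
  ultimately obtain v where v: "v \<in> S" "\<And>x. x \<in> S \<Longrightarrow> (M *v x) \<bullet> x \<le> (M *v v) \<bullet> v"
    using continuous_attains_sup[of S "\<lambda>x. (M *v x) \<bullet> x"] by blast
  define r where "r = (M *v v) \<bullet> v"
  have symm: "(M *v x) \<bullet> y = x \<bullet> (M *v y)" for x y
    using arg_cong[OF cinner_ctranspose[of M x y], of Re] by (simp add: herm Re_cinner)
  \<comment> \<open>the direction of steepest change of the form at \<open>v\<close>, which stays in the invariant subspace \<open>V\<close>\<close>
  define w where "w = r *\<^sub>R v - M *v v"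
  have "w \<in> V"
    using V_lin[of "0" v r] V_lin[of "r *\<^sub>R v" "M *v v" "-1"] inv[of v] v(1)
    by (auto simp: S_def w_def) (simp add: V_def)
  have max: "(M *v x) \<bullet> x \<le> r * (x \<bullet> x)" if "x \<in> V" for x
  proof (cases "x = 0")
    case False
    have "(1 / norm x) *\<^sub>R x \<in> S"
      using that False V_lin[of 0 x "1 / norm x"] by (simp add: S_def) (simp add: V_def)
    from v(2)[OF this] have "(1 / norm x) * ((1 / norm x) * ((M *v x) \<bullet> x)) \<le> r"
      unfolding r_def matrix_scaleR_left by simp
    then have "(norm x)\<^sup>2 * ((1 / norm x) * ((1 / norm x) * ((M *v x) \<bullet> x))) \<le> (norm x)\<^sup>2 * r"
      by (rule mult_left_mono) simp
    moreover have "(norm x)\<^sup>2 * ((1 / norm x) * ((1 / norm x) * ((M *v x) \<bullet> x))) = (M *v x) \<bullet> x"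
      using False by (simp add: power2_eq_square)
    ultimately show ?thesis
      by (simp add: power2_norm_eq_inner mult.commute)
  qed simp
  have "norm v = 1" "v \<in> V" using v(1) by (auto simp: S_def)
  have "w \<bullet> w = 0"
  proof (rule linear_term_zero_if_quadratic_nonneg)
    fix t
    have "(M *v (v + t *\<^sub>R w)) \<bullet> (v + t *\<^sub>R w) \<le> r * ((v + t *\<^sub>R w) \<bullet> (v + t *\<^sub>R w))"
      by (intro max V_lin \<open>v \<in> V\<close> \<open>w \<in> V\<close>)
    moreover have "(M *v (v + t *\<^sub>R w)) \<bullet> (v + t *\<^sub>R w) =
        r + 2 * t * ((M *v v) \<bullet> w) + t\<^sup>2 * ((M *v w) \<bullet> w)"
      using symm[of w v]
      by (simp add: r_def matrix_scaleR_left matrix_vector_right_distrib inner_add_left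
          inner_add_right power2_eq_square algebra_simps inner_commute)
    moreover have "r * ((v + t *\<^sub>R w) \<bullet> (v + t *\<^sub>R w)) =
        r + 2 * t * ((r *\<^sub>R v) \<bullet> w) + t\<^sup>2 * (r * (w \<bullet> w))"
      using \<open>norm v = 1\<close>
      by (simp add: inner_add_left inner_add_right power2_eq_square algebra_simps inner_commute
          norm_eq_1)
    ultimately show "0 \<le> 2 * t * (w \<bullet> w) + t\<^sup>2 * (r * (w \<bullet> w) - (M *v w) \<bullet> w)"
      by (simp add: w_def inner_diff_left algebra_simps)
  qed
  then have "M *v v = complex_of_real r *s v"
    by (simp add: w_def csmult_of_real)
  then show thesis using that \<open>norm v = 1\<close> \<open>v \<in> V\<close> by (auto simp: V_def)
qed

lemma hermitian_eigenbasis: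
  fixes M :: "complex^'m^'m"
  assumes herm: "ctranspose M = M"
  obtains e l where "\<And>i::'m. M *v e i = complex_of_real (l i) *s e i"
    "\<And>i j. cinner (e i) (e j) = (if i = j then 1 else 0)"
proof -
  have "\<exists>e l. (\<forall>i\<in>I. M *v e i = complex_of_real (l i) *s e i) \<and>
      (\<forall>i\<in>I. \<forall>j\<in>I. cinner (e i) (e j) = (if i = j then 1 else 0))" if "finite I" for I :: "'m set"
    using that
  proof induction
    case (insert k I)
    then obtain e l where el: "\<And>i. i \<in> I \<Longrightarrow> M *v e i = complex_of_real (l i) *s e i"
      "\<And>i j. i \<in> I \<Longrightarrow> j \<in> I \<Longrightarrow> cinner (e i) (e j) = (if i = j then 1 else 0)" by blast
    have "card I < CARD('m)"
      using insert by (intro psubset_card_mono) auto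
    with herm insert(1) obtain v r where v: "norm v = 1" "M *v v = complex_of_real r *s v"
      "\<And>i. i \<in> I \<Longrightarrow> cinner v (e i) = 0"
      using hermitian_extend_eigenvectors[of M I e l] el(1) by metis
    have "cinner (e i) v = 0" if "i \<in> I" for i
      using v(3)[OF that] cinner_commute[of "e i" v] by simp
    moreover have "cinner v v = 1" using v(1) by (simp add: cinner_self)
    ultimately show ?case using v el insert(2)
      by (intro exI[of _ "e(k := v)"] exI[of _ "l(k := r)"]) auto
  qed auto
  from this[of UNIV] show thesis using that by auto
qed

lemma ctranspose_mult_self:
  fixes U :: "complex^'m^'m"
  shows "(ctranspose U ** U) $ i $ j = cinner (column j U) (column i U)"
  by (simp add: matrix_matrix_mult_def ctranspose_def transpose_def map_matrix_def cinner_def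
      column_def mult.commute)

lemma mult_diag_mat: "((U::complex^'m^'m) ** diag_mat a) $ i $ j = U $ i $ j * a j"
proof -
  have "(U ** diag_mat a) $ i $ j = (\<Sum>k\<in>UNIV. if k = j then U $ i $ k * a k else 0)"
    unfolding matrix_matrix_mult_def diag_mat_def vec_lambda_beta
    by (rule sum.cong) auto
  then show ?thesis by simp
qed

theorem nonneg_definite_spectral:
  fixes M :: "complex^'m^'m"
  assumes "nonneg_definite M"
  obtains U and d :: "'m \<Rightarrow> real" where "ctranspose U ** U = mat 1" "\<And>i. 0 \<le> d i"
    "M = U ** diag_mat (\<lambda>i. complex_of_real (d i)) ** ctranspose U"
proof -
  from assms have herm: "ctranspose M = M" and pos: "\<And>v. 0 \<le> Re (cinner (M *v v) v)"
    by (auto simp: nonneg_definite_def)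
  obtain e l where el: "\<And>i::'m. M *v e i = complex_of_real (l i) *s e i"
    "\<And>i j. cinner (e i) (e j) = (if i = j then 1 else 0)"
    using hermitian_eigenbasis[OF herm] by metis
  define U where "U = (\<chi> i j. e j $ i)"
  have col: "column j U = e j" for j by (simp add: U_def column_def vec_eq_iff)
  have 1: "ctranspose U ** U = mat 1"
    by (simp add: vec_eq_iff ctranspose_mult_self col el mat_def)
  have 2: "0 \<le> l i" for i
    using pos[of "e i"] el(1)[of i] el(2)[of i i] by (simp add: cinner_scale_left)
  have "(M ** U) $ i $ j = (U ** diag_mat (\<lambda>i. complex_of_real (l i))) $ i $ j" for i j
  proof -
    have "(M ** U) $ i $ j = (M *v e j) $ i"
      by (simp add: matrix_matrix_mult_def matrix_vector_mult_def U_def)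
    also have "\<dots> = complex_of_real (l j) * e j $ i" by (simp add: el)
    also have "\<dots> = (U ** diag_mat (\<lambda>i. complex_of_real (l i))) $ i $ j"
      by (simp add: mult_diag_mat) (simp add: U_def)
    finally show ?thesis .
  qed
  then have "M ** U = U ** diag_mat (\<lambda>i. complex_of_real (l i))" by (simp add: vec_eq_iff)
  moreover have "U ** ctranspose U = mat 1" using 1 matrix_left_right_inverse by blast
  ultimately have "M = U ** diag_mat (\<lambda>i. complex_of_real (l i)) ** ctranspose U"
    by (metis matrix_mul_assoc matrix_mul_rid)
  with 1 2 that show thesis by blast
qed

section \<open>Real powers of nonnegative definite matrices\<close>

definition mat_pow :: "complex^'m^'m \<Rightarrow> nat \<Rightarrow> complex^'m^'m" where
  "mat_pow M n = (((**) M) ^^ n) (mat 1)"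

lemma mat_pow_simps [simp]: "mat_pow M 0 = mat 1" "mat_pow M (Suc n) = M ** mat_pow M n"
  by (simp_all add: mat_pow_def)

definition mat_poly :: "(nat \<Rightarrow> real) \<Rightarrow> nat \<Rightarrow> complex^'m^'m \<Rightarrow> complex^'m^'m" where
  "mat_poly a n M = (\<Sum>i\<le>n. a i *\<^sub>R mat_pow M i)"

lemma diag_mat_mult: "diag_mat a ** diag_mat b = diag_mat (\<lambda>i. a i * b i)"
  unfolding vec_eq_iff mult_diag_mat by (simp add: diag_mat_def)

lemma sandwich_diag_mat:
  "(U ** diag_mat a ** ctranspose U) $ i $ j = (\<Sum>k\<in>UNIV. U $ i $ k * a k * cnj (U $ j $ k))"
  by (simp add: matrix_matrix_mult_def[of "U ** diag_mat a"] mult_diag_mat)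
    (simp add: ctranspose_def transpose_def map_matrix_def)

lemma mat_pow_sandwich:
  fixes U :: "complex^'m^'m"
  assumes U: "ctranspose U ** U = mat 1"
  shows "mat_pow (U ** diag_mat d ** ctranspose U) n = U ** diag_mat (\<lambda>i. d i ^ n) ** ctranspose U"
proof (induction n)
  case 0
  have "U ** ctranspose U = mat 1" using U matrix_left_right_inverse by blast
  moreover have "diag_mat (\<lambda>i::'m. 1) = mat 1" by (simp add: vec_eq_iff diag_mat_def mat_def)
  ultimately show ?case by (simp add: matrix_mul_rid)
next
  case (Suc n)
  have "mat_pow (U ** diag_mat d ** ctranspose U) (Suc n) =
      U ** diag_mat d ** (ctranspose U ** U) ** diag_mat (\<lambda>i. d i ^ n) ** ctranspose U"
    by (simp add: Suc matrix_mul_assoc)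
  also have "\<dots> = U ** (diag_mat d ** diag_mat (\<lambda>i. d i ^ n)) ** ctranspose U"
    by (simp add: U matrix_mul_assoc)
  finally show ?case by (simp add: diag_mat_mult)
qed

lemma mat_poly_sandwich:
  fixes U :: "complex^'m^'m"
  assumes U: "ctranspose U ** U = mat 1"
  shows "mat_poly a n (U ** diag_mat (\<lambda>i. complex_of_real (d i)) ** ctranspose U) =
    U ** diag_mat (\<lambda>i. complex_of_real (\<Sum>k\<le>n. a k * d i ^ k)) ** ctranspose U"
  by (simp add: vec_eq_iff mat_poly_def mat_pow_sandwich[OF U] sandwich_diag_mat)
    (simp add: sum_distrib_left sum_distrib_right scaleR_conv_of_real sum.swap[of _ "{..n}"] mult_ac)

text \<open>For \<open>s < 0\<close> the function \<open>x powr s\<close> with value \<open>0\<close> at \<open>0\<close> is not continuous; it is the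
  pointwise limit of the continuous functions obtained by cutting it off linearly near \<open>0\<close>.
  A diagonal sequence of Weierstrass approximations on \<open>[0, n]\<close> then converges pointwise.\<close>

lemma powr_pointwise_limit_of_polynomials:
  obtains a :: "nat \<Rightarrow> nat \<Rightarrow> real" and N where
    "\<And>x. 0 \<le> x \<Longrightarrow> (\<lambda>n. \<Sum>k\<le>N n. a n k * x ^ k) \<longlonglongrightarrow> x powr s"
proof -
  define g where "g n x = min 1 (real (Suc n) * x) * max x (1 / real (Suc n)) powr s" for n x
  have ex: "\<exists>a N. \<forall>x\<in>{0..real n}. \<bar>g n x - (\<Sum>k\<le>N. a k * x ^ k)\<bar> < 1 / real (Suc n)" for n
  proof -
    have "continuous_on {0..real n} (g n)"
      unfolding g_def
      by (intro continuous_intros) (auto simp: max_def intro: order.trans)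
    then obtain p where p: "real_polynomial_function p"
      "\<And>x. x \<in> {0..real n} \<Longrightarrow> \<bar>g n x - p x\<bar> < 1 / real (Suc n)"
      using Stone_Weierstrass_real_polynomial_function[of "{0..real n}" "g n" "1 / real (Suc n)"]
      by auto
    moreover obtain a N where "p = (\<lambda>x. \<Sum>i\<le>N. a i * x ^ i)"
      using p(1) by (auto simp: real_polynomial_function_iff_sum)
    ultimately show ?thesis by blast
  qed
  then obtain a N where aN:
    "\<And>n x. x \<in> {0..real n} \<Longrightarrow> \<bar>g n x - (\<Sum>k\<le>N n. a n k * x ^ k)\<bar> < 1 / real (Suc n)"
    by metis
  have "(\<lambda>n. \<Sum>k\<le>N n. a n k * x ^ k) \<longlonglongrightarrow> x powr s" if "0 \<le> x" for x
  proof -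
    have "(\<lambda>n. g n x - (\<Sum>k\<le>N n. a n k * x ^ k)) \<longlonglongrightarrow> 0"
    proof (rule Lim_null_comparison)
      show "eventually (\<lambda>n. norm (g n x - (\<Sum>k\<le>N n. a n k * x ^ k)) \<le> 1 / real (Suc n)) sequentially"
        using eventually_ge_at_top[of "nat \<lceil>x\<rceil>"]
        by eventually_elim (use aN that in \<open>auto intro!: less_imp_le simp: nat_ceiling_le_eq\<close>)
    qed (use LIMSEQ_inverse_real_of_nat in \<open>simp add: inverse_eq_divide\<close>)
    moreover have "(\<lambda>n. g n x) \<longlonglongrightarrow> x powr s"
    proof (rule tendsto_eventually)
      show "eventually (\<lambda>n. g n x = x powr s) sequentially"
      proof (cases "x = 0")
        case False
        with that have "x > 0" by simp
        show ?thesis using eventually_ge_at_top[of "nat \<lceil>1/x\<rceil>"]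
        proof eventually_elim
          case (elim n)
          then have "1 / x \<le> real (Suc n)" by linarith
          then have "1 / real (Suc n) \<le> x" "1 \<le> real (Suc n) * x"
            using \<open>x > 0\<close> by (auto simp: field_simps)
          then show ?case by (simp add: g_def max_def)
        qed
      qed (simp add: g_def)
    qed
    ultimately show ?thesis
      using tendsto_diff[of "\<lambda>n. g n x" "x powr s" sequentially
          "\<lambda>n. g n x - (\<Sum>k\<le>N n. a n k * x ^ k)" 0] by simp
  qed
  then show thesis using that by blast
qed

lemma tendsto_sandwich_diag_mat:
  fixes U :: "complex^'m^'m"
  assumes "\<And>i. (\<lambda>n. f n i) \<longlonglongrightarrow> g i"
  shows "(\<lambda>n. U ** diag_mat (f n) ** ctranspose U) \<longlonglongrightarrow> U ** diag_mat g ** ctranspose U"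
  by (intro vec_tendstoI) (unfold sandwich_diag_mat, intro tendsto_intros assms)

lemma mat_poly_tendsto_sandwich:
  fixes U :: "complex^'m^'m"
  assumes "\<And>x. 0 \<le> x \<Longrightarrow> (\<lambda>n. \<Sum>k\<le>N n. a n k * x ^ k) \<longlonglongrightarrow> x powr s"
    and "ctranspose U ** U = mat 1" "\<And>i. 0 \<le> d i"
    "M = U ** diag_mat (\<lambda>i. complex_of_real (d i)) ** ctranspose U"
  shows "(\<lambda>n. mat_poly (a n) (N n) M) \<longlonglongrightarrow>
    U ** diag_mat (\<lambda>i. complex_of_real (d i powr s)) ** ctranspose U"
  unfolding assms(4) mat_poly_sandwich[OF assms(2)]
  by (intro tendsto_sandwich_diag_mat tendsto_of_real assms)

text \<open>The limit of the polynomials in \<open>M\<close> does not refer to a diagonalisation, so all diagonalisations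
  of \<open>M\<close> give the same power.\<close>

lemma mat_powr_eq:
  fixes U :: "complex^'m^'m"
  assumes U: "ctranspose U ** U = mat 1" "\<And>i. 0 \<le> d i"
    "M = U ** diag_mat (\<lambda>i. complex_of_real (d i)) ** ctranspose U"
  shows "mat_powr M s = U ** diag_mat (\<lambda>i. complex_of_real (d i powr s)) ** ctranspose U"
  unfolding mat_powr_def
proof (rule the_equality)
  obtain a N where aN: "\<And>x. 0 \<le> x \<Longrightarrow> (\<lambda>n. \<Sum>k\<le>N n. a n k * x ^ k) \<longlonglongrightarrow> x powr s"
    using powr_pointwise_limit_of_polynomials by blast
  note lim = mat_poly_tendsto_sandwich[OF aN]
  fix L
  assume "\<exists>U (d :: 'm \<Rightarrow> real). ctranspose U ** U = mat 1 \<and> (\<forall>i. 0 \<le> d i) \<and>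
    M = U ** diag_mat (\<lambda>i. complex_of_real (d i)) ** ctranspose U \<and>
    L = U ** diag_mat (\<lambda>i. complex_of_real (d i powr s)) ** ctranspose U"
  then obtain V e where "ctranspose V ** V = mat 1" "\<And>i. 0 \<le> e i"
    "M = V ** diag_mat (\<lambda>i. complex_of_real (e i)) ** ctranspose V"
    "L = V ** diag_mat (\<lambda>i. complex_of_real (e i powr s)) ** ctranspose V" by blast
  from lim[OF _ this(1-3)] lim[OF _ U] show
    "L = U ** diag_mat (\<lambda>i. complex_of_real (d i powr s)) ** ctranspose U"
    unfolding \<open>L = _\<close> by (rule LIMSEQ_unique)
qed (use U in blast)

lemma continuous_on_matrix_mult:
  fixes f g :: "'a::topological_space \<Rightarrow> complex^'m^'m"
  assumes "continuous_on S f" "continuous_on S g"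
  shows "continuous_on S (\<lambda>x. f x ** g x)"
  unfolding matrix_matrix_mult_def
  by (intro continuous_intros assms)

lemma continuous_on_mat_poly: "continuous_on UNIV (mat_poly a n :: complex^'m^'m \<Rightarrow> _)"
proof -
  have "continuous_on UNIV (\<lambda>M::complex^'m^'m. mat_pow M k)" for k
  proof (induction k)
    case (Suc k)
    then show ?case by (simp add: continuous_on_matrix_mult)
  qed simp
  then show ?thesis unfolding mat_poly_def by (intro continuous_intros)
qed

text \<open>A choice of diagonalisations need not depend measurably on the matrix; measurability of the power
  comes instead from its being a pointwise limit of polynomials in the entries.\<close>

lemma borel_measurable_mat_powr:
  fixes W :: "'a \<Rightarrow> complex^'m^'m"
  assumes W: "W \<in> borel_measurable M" and pos: "\<And>x. nonneg_definite (W x)"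
  shows "(\<lambda>x. mat_powr (W x) s) \<in> borel_measurable M"
proof -
  obtain a N where aN: "\<And>x. 0 \<le> x \<Longrightarrow> (\<lambda>n. \<Sum>k\<le>N n. a n k * x ^ k) \<longlonglongrightarrow> x powr s"
    using powr_pointwise_limit_of_polynomials by blast
  show ?thesis
  proof (rule borel_measurable_LIMSEQ_metric)
    show "(\<lambda>x. mat_poly (a n) (N n) (W x)) \<in> borel_measurable M" for n
      using borel_measurable_continuous_onI[OF continuous_on_mat_poly] W
      by (rule measurable_compose_rev)
    show "(\<lambda>n. mat_poly (a n) (N n) (W x)) \<longlonglongrightarrow> mat_powr (W x) s" for x
    proof -
      obtain U d where U: "ctranspose U ** U = mat 1" "\<And>i. 0 \<le> d i"
        "W x = U ** diag_mat (\<lambda>i. complex_of_real (d i)) ** ctranspose U"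
        using nonneg_definite_spectral[OF pos] by metis
      show ?thesis
        using mat_poly_tendsto_sandwich[OF aN U] mat_powr_eq[OF U, of s] by simp
    qed
  qed
qed

text \<open>The powers with exponents \<open>s\<close> and \<open>- s\<close> are Hermitian and inverse to each other, so this is the
  Cauchy-Schwarz inequality for \<open>mat_powr M s *v x\<close> and \<open>mat_powr M (- s) *v y\<close>. It is the duality between
  the norms given by a weight and by its inverse.\<close>

lemma cinner_le_mat_powr:
  fixes M :: "complex^'m^'m"
  assumes "nonneg_definite M" "invertible M"
  shows "cmod (cinner x y) \<le> norm (mat_powr M s *v x) * norm (mat_powr M (- s) *v y)"
proof -
  obtain U d where U: "ctranspose U ** U = mat 1" "\<And>i. 0 \<le> d i"
    "M = U ** diag_mat (\<lambda>i. complex_of_real (d i)) ** ctranspose U"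
    using nonneg_definite_spectral[OF assms(1)] by metis
  have U': "U ** ctranspose U = mat 1" using U(1) matrix_left_right_inverse by blast
  have d: "d i > 0" for i
  proof (rule ccontr)
    assume "\<not> d i > 0"
    with U(2)[of i] have "d i = 0" by simp
    have "M ** U = U ** diag_mat (\<lambda>i. complex_of_real (d i)) ** (ctranspose U ** U)"
      unfolding U(3) by (simp add: matrix_mul_assoc)
    then have "M ** U = U ** diag_mat (\<lambda>i. complex_of_real (d i))"
      by (simp add: U(1) matrix_mul_rid)
    moreover have "(M *v column i U) $ k = (M ** U) $ k $ i" for k
      by (simp add: matrix_vector_mult_def matrix_matrix_mult_def column_def)
    ultimately have "M *v column i U = 0"
      by (simp add: vec_eq_iff mult_diag_mat \<open>d i = 0\<close>)
    then have "column i U = 0" using assms(2)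
      by (metis invertible_def matrix_vector_mul_assoc matrix_vector_mul_lid matrix_vector_mult_0_right)
    moreover have "(ctranspose U ** U) $ i $ i = 1" by (simp add: U(1) mat_def)
    ultimately show False by (simp add: ctranspose_mult_self)
  qed
  define S where "S r = U ** diag_mat (\<lambda>i. complex_of_real (d i powr r)) ** ctranspose U" for r
  have S: "mat_powr M r = S r" for r unfolding S_def by (rule mat_powr_eq[OF U])
  have "S (-s) ** S s = U ** diag_mat (\<lambda>i. complex_of_real (d i powr - s)) ** (ctranspose U ** U) **
      diag_mat (\<lambda>i. complex_of_real (d i powr s)) ** ctranspose U"
    by (simp add: S_def matrix_mul_assoc)
  also have "\<dots> = U ** (diag_mat (\<lambda>i. complex_of_real (d i powr - s)) **
      diag_mat (\<lambda>i. complex_of_real (d i powr s))) ** ctranspose U"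
    by (simp add: U(1) matrix_mul_assoc)
  also have "\<dots> = U ** mat 1 ** ctranspose U"
  proof -
    have "complex_of_real (d i powr - s) * complex_of_real (d i powr s) = 1" for i
      using d[of i] by (simp flip: of_real_mult powr_add)
    moreover have "diag_mat (\<lambda>i::'m. 1) = mat 1" by (simp add: vec_eq_iff diag_mat_def mat_def)
    ultimately show ?thesis by (simp add: diag_mat_mult)
  qed
  also have "\<dots> = mat 1" by (simp add: U' matrix_mul_rid)
  finally have inv: "S (-s) ** S s = mat 1" .
  have herm: "ctranspose (S r) = S r" for r
  proof -
    have "ctranspose N $ i $ j = cnj (N $ j $ i)" for N :: "complex^'m^'m" and i j
      by (simp add: ctranspose_def transpose_def map_matrix_def)
    then show ?thesis by (simp add: vec_eq_iff S_def sandwich_diag_mat mult_ac)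
  qed
  have "cinner x y = cinner (S (-s) *v (S s *v x)) y"
    by (simp add: matrix_vector_mul_assoc inv)
  also have "\<dots> = cinner (S s *v x) (S (-s) *v y)"
    by (simp add: cinner_ctranspose herm)
  finally show ?thesis unfolding S using cinner_Cauchy_Schwarz by metis
qed

section \<open>Rapidly decreasing functions\<close>

definition rapidly_decreasing :: "(real^'d \<Rightarrow> complex) \<Rightarrow> bool" where
  "rapidly_decreasing g \<longleftrightarrow> (\<forall>n::nat. \<exists>C. \<forall>x. (1 + norm x) ^ n * cmod (g x) \<le> C)"

lemma rapidly_decreasingE:
  assumes "rapidly_decreasing g"
  obtains C where "0 \<le> C" "\<And>x. (1 + norm x) ^ n * cmod (g x) \<le> C"
proof -
  from assms obtain C where C: "\<And>x. (1 + norm x) ^ n * cmod (g x) \<le> C"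
    unfolding rapidly_decreasing_def by blast
  have "0 \<le> (1 + norm (0::real^'a)) ^ n * cmod (g 0)" by simp
  also have "\<dots> \<le> C" by (rule C)
  finally show thesis using C that by blast
qed

lemma one_plus_norm_triangle:
  "1 + norm (x + y) \<le> (1 + norm x) * (1 + norm (y::'a::real_normed_vector))"
  using norm_triangle_ineq[of x y] mult_nonneg_nonneg[of "norm x" "norm y"]
  by (simp add: algebra_simps del: mult_nonneg_nonneg)

text \<open>Dyadic balls take the place of polar coordinates. If \<open>l\<close> is least with \<open>norm x < 2 ^ l\<close>, then
  \<open>2 ^ l\<close> is at most \<open>2 * (1 + norm x)\<close>, and the term with index \<open>l\<close> alone is large enough.\<close>

lemma inverse_power_norm_le_ball_sum:
  fixes x :: "'a::real_normed_vector"
  shows "ennreal (1 / (1 + norm x) ^ M) \<le> (\<Sum>l. ennreal (2 ^ M * (1 / 2 ^ M) ^ l) * indicator (ball 0 (2 ^ l)) x)"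
proof -
  have "\<exists>l. norm x < 2 ^ l" by (rule real_arch_pow) simp
  then obtain l where l: "norm x < 2 ^ l" "\<And>k. k < l \<Longrightarrow> \<not> norm x < 2 ^ k"
    using exists_least_iff[of "\<lambda>l. norm x < 2 ^ l"] by blast
  have "1 / (1 + norm x) ^ M \<le> 2 ^ M * (1 / 2 ^ M) ^ l"
  proof (cases l)
    case 0
    have "1 / (1 + norm x) ^ M \<le> 1" using one_le_power[of "1 + norm x" M] by (simp add: divide_le_eq_1 add_pos_nonneg)
    also have "(1::real) \<le> 2 ^ M" by (rule one_le_power) simp
    finally show ?thesis using 0 by simp
  next
    case (Suc k)
    then have "2 ^ k \<le> 1 + norm x" using l(2)[of k] by simp
    then have "(2 ^ k) ^ M \<le> (1 + norm x) ^ M" by (rule power_mono) simp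
    then have "1 / (1 + norm x) ^ M \<le> 1 / (2 ^ k) ^ M"
      by (intro divide_left_mono mult_pos_pos zero_less_power) (auto intro: add_pos_nonneg)
    also have "\<dots> = 2 ^ M * (1 / 2 ^ M) ^ l"
      by (simp add: Suc power_divide mult.commute flip: power_mult)
    finally show ?thesis .
  qed
  then have "ennreal (1 / (1 + norm x) ^ M) \<le> ennreal (2 ^ M * (1 / 2 ^ M) ^ l) * indicator (ball 0 (2 ^ l)) x"
    using l(1) by (simp add: ennreal_leI)
  also have "\<dots> \<le> (\<Sum>l. ennreal (2 ^ M * (1 / 2 ^ M) ^ l) * indicator (ball 0 (2 ^ l)) x)"
  proof -
    have "f l \<le> (\<Sum>l. f l)" for f :: "nat \<Rightarrow> ennreal"
      using sum_le_suminf[of f "{l}"] by simp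
    then show ?thesis .
  qed
  finally show ?thesis .
qed

text \<open>The volume of the dyadic ball with index \<open>l\<close> grows like \<open>(2 ^ DIM('a)) ^ l\<close>. The exponent exceeds the
  dimension by one, which leaves a geometric series with ratio \<open>1 / 2\<close>.\<close>

lemma integrable_inverse_power_norm:
  "integrable lborel (\<lambda>x::'a::euclidean_space. 1 / (1 + norm x) ^ (DIM('a) + 1))"
proof (rule integrableI_nonneg)
  define M where "M = DIM('a) + 1"
  define v where "v = unit_ball_vol (real DIM('a))"
  have v: "0 \<le> v" by (simp add: v_def unit_ball_vol_nonneg)
  have [measurable]: "ball (0::'a) (2 ^ l) \<in> sets borel" for l by simp
  have "(\<integral>\<^sup>+(x::'a). ennreal (1 / (1 + norm x) ^ M) \<partial>lborel) \<le>
      (\<integral>\<^sup>+(x::'a). (\<Sum>l. ennreal (2 ^ M * (1 / 2 ^ M) ^ l) * indicator (ball 0 (2 ^ l)) x) \<partial>lborel)"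
    by (intro nn_integral_mono inverse_power_norm_le_ball_sum)
  also have "\<dots> = (\<Sum>l. (\<integral>\<^sup>+(x::'a). ennreal (2 ^ M * (1 / 2 ^ M) ^ l) * indicator (ball 0 (2 ^ l)) x \<partial>lborel))"
    by (rule nn_integral_suminf) measurable
  also have "\<dots> = (\<Sum>l. ennreal (2 ^ M * v * (1 / 2) ^ l))"
  proof (intro suminf_cong)
    fix l
    have "(\<integral>\<^sup>+(x::'a). ennreal (2 ^ M * (1 / 2 ^ M) ^ l) * indicator (ball 0 (2 ^ l)) x \<partial>lborel) =
        ennreal (2 ^ M * (1 / 2 ^ M) ^ l) * ennreal (v * (2 ^ l) ^ DIM('a))"
      by (simp add: nn_integral_cmult_indicator emeasure_ball v_def)
    also have "\<dots> = ennreal (2 ^ M * v * ((1 / 2 ^ M) * 2 ^ DIM('a)) ^ l)"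
    proof -
      have "(2 ^ l) ^ DIM('a) = ((2::real) ^ DIM('a)) ^ l"
        by (simp add: mult.commute flip: power_mult)
      then have "2 ^ M * (1 / 2 ^ M) ^ l * (v * (2 ^ l) ^ DIM('a)) = 2 ^ M * v * ((1 / 2 ^ M) * 2 ^ DIM('a)) ^ l"
        by (simp only: power_mult_distrib mult_ac)
      then show ?thesis using v by (simp flip: ennreal_mult)
    qed
    also have "(1 / 2 ^ M) * 2 ^ DIM('a) = (1 / 2 :: real)" by (simp add: M_def)
    finally show "(\<integral>\<^sup>+(x::'a). ennreal (2 ^ M * (1 / 2 ^ M) ^ l) * indicator (ball 0 (2 ^ l)) x \<partial>lborel) =
      ennreal (2 ^ M * v * (1 / 2) ^ l)" .
  qed
  also have "\<dots> < \<infinity>"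
    using v by (subst suminf_ennreal2) (auto intro!: summable_mult summable_geometric)
  finally show "(\<integral>\<^sup>+(x::'a). ennreal (1 / (1 + norm x) ^ (DIM('a) + 1)) \<partial>lborel) < \<infinity>"
    by (simp add: M_def)
qed auto

lemma integrable_power_rapidly_decreasing:
  fixes g :: "real^'d \<Rightarrow> complex"
  assumes "rapidly_decreasing g" and [measurable]: "g \<in> borel_measurable borel"
  shows "integrable lborel (\<lambda>x. (1 + norm x) ^ n * cmod (g x))"
proof -
  define M where "M = DIM(real^'d) + 1"
  obtain C where C: "0 \<le> C" "\<And>x. (1 + norm x) ^ (n + M) * cmod (g x) \<le> C"
    using rapidly_decreasingE[OF assms(1)] by metis
  show ?thesis
  proof (rule Bochner_Integration.integrable_bound)
    show "integrable lborel (\<lambda>x::real^'d. C * (1 / (1 + norm x) ^ M))"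
      unfolding M_def by (intro integrable_mult_right integrable_inverse_power_norm)
    have "(1 + norm x) ^ n * cmod (g x) \<le> C * (1 / (1 + norm x) ^ M)" for x
    proof -
      have "1 + norm x > 0" by (simp add: add_pos_nonneg)
      then show ?thesis using C(2)[of x] by (simp add: field_simps power_add)
    qed
    then show "AE x in lborel. norm ((1 + norm x) ^ n * cmod (g x)) \<le> norm (C * (1 / (1 + norm x) ^ M))"
      using C(1) by (auto simp: abs_mult)
  qed measurable
qed

lemma integrable_rapidly_decreasing:
  fixes g :: "real^'d \<Rightarrow> complex"
  assumes "rapidly_decreasing g" "g \<in> borel_measurable borel"
  shows "integrable lborel g"
  using integrable_power_rapidly_decreasing[OF assms, of 0] assms(2) by (simp add: integrable_norm_iff)

lemma rapidly_decreasing_bounded_linear: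
  assumes "bounded_linear L" "rapidly_decreasing g"
  shows "rapidly_decreasing (\<lambda>x. L (g x))"
  unfolding rapidly_decreasing_def
proof
  fix n
  obtain K where K: "0 \<le> K" "\<And>z. norm (L z) \<le> norm z * K"
    using bounded_linear.nonneg_bounded[OF assms(1)] by blast
  obtain C where C: "\<And>x. (1 + norm x) ^ n * cmod (g x) \<le> C"
    using rapidly_decreasingE[OF assms(2)] by metis
  have "(1 + norm x) ^ n * cmod (L (g x)) \<le> C * K" for x
  proof -
    have "(1 + norm x) ^ n * cmod (L (g x)) \<le> (1 + norm x) ^ n * (cmod (g x) * K)"
      by (intro mult_left_mono K) simp
    also have "\<dots> = ((1 + norm x) ^ n * cmod (g x)) * K" by simp
    also have "\<dots> \<le> C * K" by (intro mult_right_mono C K)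
    finally show ?thesis .
  qed
  then show "\<exists>C. \<forall>x. (1 + norm x) ^ n * cmod (L (g x)) \<le> C" by blast
qed

lemma rapidly_decreasing_add:
  assumes "rapidly_decreasing g" "rapidly_decreasing h"
  shows "rapidly_decreasing (\<lambda>x. g x + h x)"
  unfolding rapidly_decreasing_def
proof
  fix n
  obtain C where C: "\<And>x. (1 + norm x) ^ n * cmod (g x) \<le> C"
    using rapidly_decreasingE[OF assms(1)] by metis
  obtain D where D: "\<And>x. (1 + norm x) ^ n * cmod (h x) \<le> D"
    using rapidly_decreasingE[OF assms(2)] by metis
  have "(1 + norm x) ^ n * cmod (g x + h x) \<le> C + D" for x
  proof -
    have "(1 + norm x) ^ n * cmod (g x + h x) \<le> (1 + norm x) ^ n * (cmod (g x) + cmod (h x))"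
      by (intro mult_left_mono norm_triangle_ineq) simp
    then show ?thesis using C[of x] D[of x] by (simp add: distrib_left)
  qed
  then show "\<exists>C. \<forall>x. (1 + norm x) ^ n * cmod (g x + h x) \<le> C" by blast
qed

lemma rapidly_decreasing_affine:
  fixes M :: "real^'d^'d"
  assumes "rapidly_decreasing g" "invertible M"
  shows "rapidly_decreasing (\<lambda>x. g (M *v x + b))"
  unfolding rapidly_decreasing_def
proof
  fix n
  obtain N where N: "N ** M = mat 1" using assms(2) by (auto simp: invertible_def)
  obtain K where K: "0 \<le> K" "\<And>x. norm (N *v x) \<le> norm x * K"
    using bounded_linear.nonneg_bounded[OF matrix_vector_mul_bounded_linear] by blast
  \<comment> \<open>the inverse of \<open>M\<close> bounds \<open>norm x\<close> by \<open>norm (M *v x + b)\<close>\<close>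
  define K' where "K' = 1 + K + norm (N *v b)"
  have K': "1 + norm x \<le> K' * (1 + norm (M *v x + b))" for x
  proof -
    have "x = N *v (M *v x + b) - N *v b"
      by (simp add: matrix_vector_right_distrib matrix_vector_mul_assoc N)
    then have "norm x \<le> norm (M *v x + b) * K + norm (N *v b)"
      using norm_triangle_ineq4[of "N *v (M *v x + b)" "N *v b"] K(2)[of "M *v x + b"] by simp
    moreover have "0 \<le> norm (M *v x + b) * norm (N *v b)" by simp
    ultimately show ?thesis
      using K(1) norm_ge_zero[of "M *v x + b"] unfolding K'_def distrib_left distrib_right
      by (simp add: mult.commute del: norm_ge_zero)
  qed
  obtain C where C: "\<And>x. (1 + norm x) ^ n * cmod (g x) \<le> C"
    using rapidly_decreasingE[OF assms(1)] by metis
  have "(1 + norm x) ^ n * cmod (g (M *v x + b)) \<le> K' ^ n * C" for x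
  proof -
    have "(1 + norm x) ^ n * cmod (g (M *v x + b)) \<le> (K' * (1 + norm (M *v x + b))) ^ n * cmod (g (M *v x + b))"
      by (intro mult_right_mono power_mono K') auto
    also have "\<dots> = K' ^ n * ((1 + norm (M *v x + b)) ^ n * cmod (g (M *v x + b)))"
      by (simp add: power_mult_distrib)
    also have "\<dots> \<le> K' ^ n * C"
      using K(1) by (intro mult_left_mono C) (simp add: K'_def)
    finally show ?thesis .
  qed
  then show "\<exists>C. \<forall>x. (1 + norm x) ^ n * cmod (g (M *v x + b)) \<le> C" by blast
qed

section \<open>Schwartz functions\<close>

abbreviation partial :: "'d \<Rightarrow> (real^'d \<Rightarrow> complex) \<Rightarrow> real^'d \<Rightarrow> complex" where
  "partial i g \<equiv> iter_partial [i] g"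

lemma iter_partial_append: "iter_partial (is @ js) g = iter_partial is (iter_partial js g)"
  by (induction "is") auto

lemma partial_eqI:
  assumes "\<And>x. (g has_derivative g' x) (at x)"
  shows "partial i g = (\<lambda>x. g' x (axis i 1))"
  using frechet_derivative_at[OF assms] by (simp add: fun_eq_iff)

text \<open>The iterated partial derivatives of \<open>g\<close> stay in \<open>X\<close>. For affine images and for convolutions it is
  easier to describe a suitable \<open>X\<close> than the iterated derivatives themselves.\<close>

lemma schwartz_coinduct:
  assumes "g \<in> X"
    and "\<And>h x. h \<in> X \<Longrightarrow> h differentiable at x"
    and "\<And>h. h \<in> X \<Longrightarrow> rapidly_decreasing h"
    and "\<And>h i. h \<in> X \<Longrightarrow> partial i h \<in> X"
  shows "g \<in> schwartz"
proof -
  have "iter_partial is g \<in> X" for "is"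
    by (induction "is") (use assms(1,4) in auto)
  then show ?thesis using assms(2,3) by (auto simp: schwartz_def rapidly_decreasing_def)
qed

lemma schwartz_iter_partial: "g \<in> schwartz \<Longrightarrow> iter_partial is g \<in> schwartz"
  unfolding schwartz_def by (auto simp flip: iter_partial_append)

lemma schwartz_differentiable: "g \<in> schwartz \<Longrightarrow> g differentiable at x"
  unfolding schwartz_def by (drule CollectD, drule spec[of _ "[]"]) simp

lemma schwartz_rapidly_decreasing: "g \<in> schwartz \<Longrightarrow> rapidly_decreasing g"
  unfolding schwartz_def rapidly_decreasing_def by (drule CollectD, drule spec[of _ "[]"]) simp

lemma frechet_derivative_partial:
  fixes g :: "real^'d \<Rightarrow> complex"
  assumes "g differentiable at x"
  shows "frechet_derivative g (at x) h = (\<Sum>i\<in>UNIV. (h $ i) *\<^sub>R partial i g x)"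
proof -
  interpret linear "frechet_derivative g (at x)" by (rule linear_frechet_derivative[OF assms])
  have "frechet_derivative g (at x) h = frechet_derivative g (at x) (\<Sum>i\<in>UNIV. (h $ i) *\<^sub>R axis i 1)"
    using basis_expansion[of h] by (simp add: scalar_mult_eq_scaleR)
  then show ?thesis by (simp add: sum scale)
qed

lemma schwartz_has_derivative:
  assumes "g \<in> schwartz"
  shows "(g has_derivative (\<lambda>h. \<Sum>i\<in>UNIV. (h $ i) *\<^sub>R partial i g x)) (at x)"
proof -
  have d: "g differentiable at x" by (rule schwartz_differentiable[OF assms])
  then have "(g has_derivative frechet_derivative g (at x)) (at x)"
    by (simp add: frechet_derivative_works)
  moreover have "frechet_derivative g (at x) = (\<lambda>h. \<Sum>i\<in>UNIV. (h $ i) *\<^sub>R partial i g x)"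
    using frechet_derivative_partial[OF d] by (rule ext)
  ultimately show ?thesis by (simp del: iter_partial.simps)
qed

lemma schwartz_continuous: "g \<in> schwartz \<Longrightarrow> continuous_on S g"
  by (meson continuous_at_imp_continuous_on differentiable_imp_continuous_within schwartz_differentiable)

lemma schwartz_borel: "g \<in> schwartz \<Longrightarrow> g \<in> borel_measurable borel"
  by (rule borel_measurable_continuous_onI[OF schwartz_continuous])

lemma iter_partial_bounded_linear:
  assumes "bounded_linear L" "g \<in> schwartz"
  shows "iter_partial is (\<lambda>x. L (g x)) = (\<lambda>x. L (iter_partial is g x))"
proof (induction "is")
  case (Cons i "is")
  have "iter_partial (i # is) (\<lambda>x. L (g x)) = partial i (\<lambda>x. L (iter_partial is g x))"
    by (simp add: Cons)
  also have "\<dots> = (\<lambda>x. L (frechet_derivative (iter_partial is g) (at x) (axis i 1)))"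
    using schwartz_differentiable[OF schwartz_iter_partial[OF assms(2)]]
    by (intro partial_eqI bounded_linear.has_derivative[OF assms(1)])
      (auto simp: frechet_derivative_works)
  finally show ?case by simp
qed simp

lemma schwartz_bounded_linear:
  assumes L: "bounded_linear L" and g: "g \<in> schwartz"
  shows "(\<lambda>x. L (g x)) \<in> schwartz"
proof (rule schwartz_coinduct[where X = "(\<lambda>g x. L (g x)) ` schwartz"])
  fix h assume "h \<in> (\<lambda>g x. L (g x)) ` schwartz"
  then obtain g where g: "g \<in> schwartz" "h = (\<lambda>x. L (g x))" by blast
  show "h differentiable at x" for x
    unfolding g(2) differentiable_def
    using bounded_linear.has_derivative[OF L schwartz_has_derivative[OF g(1)]] by blast
  show "rapidly_decreasing h"
    unfolding g(2) by (rule rapidly_decreasing_bounded_linear[OF L schwartz_rapidly_decreasing[OF g(1)]])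
  show "partial i h \<in> (\<lambda>g x. L (g x)) ` schwartz" for i
    unfolding g(2) iter_partial_bounded_linear[OF L g(1)]
    using schwartz_iter_partial[OF g(1)] by blast
qed (use g in blast)

lemma iter_partial_add:
  assumes "g \<in> schwartz" "h \<in> schwartz"
  shows "iter_partial is (\<lambda>x. g x + h x) = (\<lambda>x. iter_partial is g x + iter_partial is h x)"
proof (induction "is")
  case (Cons i "is")
  have "iter_partial (i # is) (\<lambda>x. g x + h x) = partial i (\<lambda>x. iter_partial is g x + iter_partial is h x)"
    by (simp add: Cons)
  also have "\<dots> = (\<lambda>x. frechet_derivative (iter_partial is g) (at x) (axis i 1) +
      frechet_derivative (iter_partial is h) (at x) (axis i 1))"
    using schwartz_differentiable[OF schwartz_iter_partial[OF assms(1)]]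
      schwartz_differentiable[OF schwartz_iter_partial[OF assms(2)]]
    by (intro partial_eqI has_derivative_add) (auto simp: frechet_derivative_works)
  finally show ?case by simp
qed simp

lemma schwartz_add:
  assumes g: "g \<in> schwartz" and h: "h \<in> schwartz"
  shows "(\<lambda>x. g x + h x) \<in> schwartz"
proof (rule schwartz_coinduct[where X = "(\<lambda>(g, h) x. g x + h x) ` (schwartz \<times> schwartz)"])
  fix f assume "f \<in> (\<lambda>(g, h) x. g x + h x) ` (schwartz \<times> schwartz)"
  then obtain g h where gh: "g \<in> schwartz" "h \<in> schwartz" "f = (\<lambda>x. g x + h x)" by auto
  show "f differentiable at x" for x
    unfolding gh(3) by (intro differentiable_add schwartz_differentiable gh)
  show "rapidly_decreasing f"
    unfolding gh(3) by (intro rapidly_decreasing_add schwartz_rapidly_decreasing gh)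
  show "partial i f \<in> (\<lambda>(g, h) x. g x + h x) ` (schwartz \<times> schwartz)" for i
    unfolding gh(3) iter_partial_add[OF gh(1,2)]
    using schwartz_iter_partial[OF gh(1)] schwartz_iter_partial[OF gh(2)]
    by (auto simp del: iter_partial.simps)
qed (use g h in auto)

lemma schwartz_cmult: "g \<in> schwartz \<Longrightarrow> (\<lambda>x. c * g x) \<in> schwartz"
  by (rule schwartz_bounded_linear[OF bounded_linear_mult_right])

lemma iter_partial_cmult:
  "g \<in> schwartz \<Longrightarrow> iter_partial is (\<lambda>x. c * g x) = (\<lambda>x. c * iter_partial is g x)"
  by (rule iter_partial_bounded_linear[OF bounded_linear_mult_right])

lemma schwartz_zero: "(\<lambda>x. 0) \<in> schwartz"
proof (rule schwartz_coinduct[where X = "{\<lambda>x. 0}"])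
  show "h \<in> {\<lambda>x. 0} \<Longrightarrow> rapidly_decreasing h" for h
    by (auto simp: rapidly_decreasing_def)
qed auto

lemma schwartz_sum:
  assumes "finite V" "\<And>v. v \<in> V \<Longrightarrow> g v \<in> schwartz"
  shows "(\<lambda>x. \<Sum>v\<in>V. c v * g v x) \<in> schwartz"
  using assms by (induction) (auto intro!: schwartz_zero schwartz_add schwartz_cmult)

lemma iter_partial_sum:
  assumes "finite V" "\<And>v. v \<in> V \<Longrightarrow> g v \<in> schwartz"
  shows "iter_partial is (\<lambda>x. \<Sum>v\<in>V. c v * g v x) = (\<lambda>x. \<Sum>v\<in>V. c v * iter_partial is (g v) x)"
  using assms
proof induction
  case empty
  show ?case using iter_partial_cmult[OF schwartz_zero, of "is" 0] by simp
next
  case (insert v V)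
  then show ?case
    by (simp add: iter_partial_add[OF schwartz_cmult schwartz_sum] iter_partial_cmult)
qed

text \<open>The affine images of Schwartz functions are not closed under partial derivatives, but their
  span is, by the chain rule.\<close>

inductive_set affine_span :: "real^'d^'d \<Rightarrow> real^'d \<Rightarrow> (real^'d \<Rightarrow> complex) set" for M b where
  base: "g \<in> schwartz \<Longrightarrow> (\<lambda>x. g (M *v x + b)) \<in> affine_span M b"
| zero: "(\<lambda>x. 0) \<in> affine_span M b"
| add: "g \<in> affine_span M b \<Longrightarrow> h \<in> affine_span M b \<Longrightarrow> (\<lambda>x. g x + h x) \<in> affine_span M b"
| scale: "g \<in> affine_span M b \<Longrightarrow> (\<lambda>x. r *\<^sub>R g x) \<in> affine_span M b"

lemma affine_span_sum:
  assumes "\<And>i. i \<in> I \<Longrightarrow> g i \<in> affine_span M b"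
  shows "(\<lambda>x. \<Sum>i\<in>I. g i x) \<in> affine_span M b"
  using assms by (induction I rule: infinite_finite_induct) (auto intro: affine_span.intros)

lemma schwartz_affine:
  fixes M :: "real^'d^'d"
  assumes "g \<in> schwartz" and M: "invertible M"
  shows "(\<lambda>x. g (M *v x + b)) \<in> schwartz"
proof (rule schwartz_coinduct)
  show "(\<lambda>x. g (M *v x + b)) \<in> affine_span M b" by (rule affine_span.base[OF assms(1)])
next
  have deriv: "\<forall>x. h differentiable at x \<and> (\<forall>i. partial i h \<in> affine_span M b)"
    if "h \<in> affine_span M b" for h
    using that
  proof induction
    case (base g)
    have d: "((\<lambda>x. g (M *v x + b)) has_derivative
        (\<lambda>h. \<Sum>i\<in>UNIV. ((M *v h) $ i) *\<^sub>R partial i g (M *v x + b))) (at x)" for x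
    proof (rule has_derivative_compose[of "\<lambda>x. M *v x + b" "\<lambda>h. M *v h" x UNIV g, OF _ schwartz_has_derivative[OF base]])
      show "((\<lambda>x. M *v x + b) has_derivative (*v) M) (at x)"
        by (intro has_derivative_add_const linear_imp_has_derivative) simp
    qed
    have "partial j (\<lambda>x. g (M *v x + b)) =
        (\<lambda>x. \<Sum>i\<in>UNIV. ((M *v axis j 1) $ i) *\<^sub>R partial i g (M *v x + b))" for j
      by (rule partial_eqI[OF d])
    moreover have "\<dots> j \<in> affine_span M b" for j
      by (intro affine_span_sum affine_span.scale affine_span.base schwartz_iter_partial base)
    ultimately show ?case using d by (auto simp: differentiable_def simp del: iter_partial.simps)
  next
    case zero
    have "partial i (\<lambda>x. 0) = (\<lambda>x::real^'d. 0)" for i by (simp add: fun_eq_iff)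
    then show ?case using affine_span.zero[of M b] by (simp del: iter_partial.simps)
  next
    case (add g h)
    have "partial i (\<lambda>x. g x + h x) = (\<lambda>x. partial i g x + partial i h x)" for i
      using add.IH by (intro partial_eqI[THEN trans] has_derivative_add)
        (auto simp: frechet_derivative_works)
    then show ?case using add by (auto intro: affine_span.add simp del: iter_partial.simps)
  next
    case (scale g r)
    have "partial i (\<lambda>x. r *\<^sub>R g x) = (\<lambda>x. r *\<^sub>R partial i g x)" for i
      using scale.IH by (intro partial_eqI[THEN trans])
        (auto simp: frechet_derivative_works intro!: has_derivative_scaleR_right)
    then show ?case using scale by (auto intro: affine_span.scale simp del: iter_partial.simps)
  qed
  show "h differentiable at x" "partial i h \<in> affine_span M b" if "h \<in> affine_span M b" for h x i
    using deriv[OF that] by blast+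
  show "rapidly_decreasing h" if "h \<in> affine_span M b" for h
    using that
  proof induction
    case (base g)
    then show ?case by (intro rapidly_decreasing_affine schwartz_rapidly_decreasing M)
  next
    case zero
    show ?case by (auto simp: rapidly_decreasing_def intro: exI[of _ 0])
  next
    case (add g h)
    then show ?case by (intro rapidly_decreasing_add)
  next
    case (scale g r)
    then show ?case using rapidly_decreasing_bounded_linear[OF bounded_linear_scaleR_right] by blast
  qed
qed

lemma schwartz_translate: "g \<in> schwartz \<Longrightarrow> (\<lambda>x. g (x - y)) \<in> schwartz"
  using schwartz_affine[of g "mat 1" "- y"] by (simp add: invertible_def)

lemma iter_partial_translate:
  assumes "g \<in> schwartz"
  shows "iter_partial is (\<lambda>x. g (x - y)) = (\<lambda>x. iter_partial is g (x - y))"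
proof (induction "is")
  case (Cons i "is")
  have d: "((\<lambda>x. iter_partial is g (x - y)) has_derivative
      (\<lambda>h. \<Sum>j\<in>UNIV. (h $ j) *\<^sub>R partial j (iter_partial is g) (x - y))) (at x)" for x
    by (rule has_derivative_compose[of "\<lambda>x. x - y" "\<lambda>h. h" x UNIV, OF _
          schwartz_has_derivative[OF schwartz_iter_partial[OF assms]]])
      (auto intro!: derivative_eq_intros)
  have "iter_partial (i # is) (\<lambda>x. g (x - y)) = partial i (\<lambda>x. iter_partial is g (x - y))"
    by (simp add: Cons)
  also have "\<dots> = (\<lambda>x. \<Sum>j\<in>UNIV. (axis i 1 $ j) *\<^sub>R partial j (iter_partial is g) (x - y))"
    by (rule partial_eqI[OF d])
  also have "\<dots> = (\<lambda>x. partial i (iter_partial is g) (x - y))"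
    by (simp add: axis_def if_distrib[where f = "\<lambda>r. r *\<^sub>R _"] cong: if_cong del: iter_partial.simps)
  finally show ?case by simp
qed simp

lemma onorm_partials_le:
  fixes c :: "'d::finite \<Rightarrow> complex"
  shows "onorm (\<lambda>h::real^'d. \<Sum>i\<in>UNIV. (h $ i) *\<^sub>R c i) \<le> (\<Sum>i\<in>UNIV. cmod (c i))"
proof (rule onorm_le)
  fix h :: "real^'d"
  have "norm (\<Sum>i\<in>UNIV. (h $ i) *\<^sub>R c i) \<le> (\<Sum>i\<in>UNIV. \<bar>h $ i\<bar> * cmod (c i))"
    by (rule norm_sum[THEN order_trans]) simp
  also have "\<dots> \<le> (\<Sum>i\<in>UNIV. norm h * cmod (c i))"
    by (intro sum_mono mult_right_mono component_le_norm_cart) simp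
  finally show "norm (\<Sum>i\<in>UNIV. (h $ i) *\<^sub>R c i) \<le> (\<Sum>i\<in>UNIV. cmod (c i)) * norm h"
    by (simp add: sum_distrib_left mult.commute)
qed

text \<open>By the mean value theorem the difference is controlled by a derivative at some \<open>w\<close> on the segment
  from \<open>x - y\<close> to \<open>x - s\<close>. There \<open>1 + norm x\<close> is at most \<open>(1 + norm w) * (1 + norm y + norm s)\<close>, so the
  polynomial weight at \<open>x\<close> is absorbed by the decay of the derivative at \<open>w\<close>.\<close>

lemma schwartz_shift_diff:
  assumes g: "g \<in> schwartz"
  obtains C where "0 \<le> C"
    "\<And>x y s. (1 + norm x) ^ n * cmod (g (x - y) - g (x - s)) \<le> C * (norm (y - s) * (1 + norm y + norm s) ^ n)"
proof -
  have "\<exists>C\<ge>0. \<forall>x. (1 + norm x) ^ n * cmod (partial i g x) \<le> C" for i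
    using rapidly_decreasingE[OF schwartz_rapidly_decreasing[OF schwartz_iter_partial[OF g]]] by metis
  then obtain D where D: "\<And>i. 0 \<le> D i" "\<And>i x. (1 + norm x) ^ n * cmod (partial i g x) \<le> D i"
    by metis
  define C where "C = (\<Sum>i\<in>UNIV. D i)"
  have "(1 + norm x) ^ n * cmod (g (x - y) - g (x - s)) \<le> C * (norm (y - s) * (1 + norm y + norm s) ^ n)"
    for x y s
  proof -
    define B where "B = C * (1 + norm y + norm s) ^ n / (1 + norm x) ^ n"
    have pos: "(1 + norm x) ^ n > 0" "1 + norm x \<noteq> 0"
      using norm_ge_zero[of x] by (auto intro!: zero_less_power add_pos_nonneg simp del: norm_ge_zero)
    have "cmod (g (x - y) - g (x - s)) \<le> B * norm ((x - y) - (x - s))"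
    proof (rule differentiable_bound[of "closed_segment (x - y) (x - s)" g])
      fix w assume w: "w \<in> closed_segment (x - y) (x - s)"
      show "(g has_derivative (\<lambda>h. \<Sum>i\<in>UNIV. (h $ i) *\<^sub>R partial i g w)) (at w within closed_segment (x - y) (x - s))"
        by (rule has_derivative_at_withinI[OF schwartz_has_derivative[OF g]])
      from w obtain r where r: "0 \<le> r" "r \<le> 1" "w = (1 - r) *\<^sub>R (x - y) + r *\<^sub>R (x - s)"
        by (auto simp: in_segment)
      define t where "t = (1 - r) *\<^sub>R y + r *\<^sub>R s"
      have x: "x = w + t" by (simp add: r(3) t_def algebra_simps)
      have "norm t \<le> (1 - r) * norm y + r * norm s"
        unfolding t_def using r(1,2) by (intro norm_triangle_le) simp
      also have "\<dots> \<le> 1 * norm y + 1 * norm s"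
        using r by (intro add_mono mult_right_mono) auto
      finally have t: "1 + norm t \<le> 1 + norm y + norm s" by simp
      have "1 + norm x \<le> (1 + norm w) * (1 + norm t)"
        unfolding x by (rule one_plus_norm_triangle)
      also have "\<dots> \<le> (1 + norm w) * (1 + norm y + norm s)"
        using t by (intro mult_left_mono) auto
      finally have xw: "(1 + norm x) ^ n \<le> ((1 + norm w) * (1 + norm y + norm s)) ^ n"
        by (rule power_mono) simp
      have "(1 + norm x) ^ n * (\<Sum>i\<in>UNIV. cmod (partial i g w)) \<le>
          ((1 + norm w) * (1 + norm y + norm s)) ^ n * (\<Sum>i\<in>UNIV. cmod (partial i g w))"
        by (intro mult_right_mono xw sum_nonneg) simp
      also have "\<dots> = (\<Sum>i\<in>UNIV. (1 + norm w) ^ n * cmod (partial i g w)) * (1 + norm y + norm s) ^ n"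
        by (simp add: power_mult_distrib sum_distrib_left mult_ac del: iter_partial.simps)
      also have "\<dots> \<le> C * (1 + norm y + norm s) ^ n"
        unfolding C_def by (intro mult_right_mono sum_mono D) simp
      finally have "(\<Sum>i\<in>UNIV. cmod (partial i g w)) \<le> B"
        using pos by (simp add: B_def field_simps del: iter_partial.simps)
      then show "onorm (\<lambda>h. \<Sum>i\<in>UNIV. (h $ i) *\<^sub>R partial i g w) \<le> B"
        by (rule order_trans[OF onorm_partials_le])
    qed auto
    then have "(1 + norm x) ^ n * cmod (g (x - y) - g (x - s)) \<le> (1 + norm x) ^ n * (B * norm (y - s))"
      using pos(1) by (intro mult_left_mono) (auto simp: norm_minus_commute)
    also have "\<dots> = C * (norm (y - s) * (1 + norm y + norm s) ^ n)"
      using pos by (simp add: B_def)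
    finally show ?thesis .
  qed
  moreover have "0 \<le> C" unfolding C_def by (intro sum_nonneg D)
  ultimately show thesis using that by blast
qed

text \<open>The preceding estimate with weight \<open>1\<close> says that the partial derivatives are Lipschitz; this
  makes the remainder quadratic, uniformly in \<open>x\<close>.\<close>

lemma schwartz_taylor:
  assumes g: "g \<in> schwartz"
  obtains L where "0 \<le> L"
    "\<And>x h. cmod (g (x + h) - g x - (\<Sum>i\<in>UNIV. (h $ i) *\<^sub>R partial i g x)) \<le> L * (norm h)\<^sup>2"
proof -
  have "\<exists>C\<ge>0. \<forall>y s. cmod (partial i g (0 - y) - partial i g (0 - s)) \<le> C * norm (y - s)" for i
    using schwartz_shift_diff[OF schwartz_iter_partial[OF g, of "[i]"], of 0]
    by (metis mult_1 mult.right_neutral power_0)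
  then obtain D where D: "\<And>i. 0 \<le> D i"
    "\<And>i y s. cmod (partial i g (0 - y) - partial i g (0 - s)) \<le> D i * norm (y - s)"
    by metis
  define L where "L = (\<Sum>i\<in>UNIV. D i)"
  have L: "0 \<le> L" unfolding L_def by (intro sum_nonneg D)
  have "cmod (g (x + h) - g x - (\<Sum>i\<in>UNIV. (h $ i) *\<^sub>R partial i g x)) \<le> L * (norm h)\<^sup>2" for x h
  proof -
    let ?d = "\<lambda>w h. \<Sum>i\<in>UNIV. (h $ i) *\<^sub>R partial i g w"
    have "norm (g (x + h) - g x - ?d x ((x + h) - x)) \<le> norm ((x + h) - x) * (L * norm h)"
    proof (rule differentiable_bound_linearization[of x "x + h" "cball x (norm h)" g ?d])
      show "x + t *\<^sub>R (x + h - x) \<in> cball x (norm h)" if "t \<in> {0..1}" for t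
        using that mult_left_le_one_le[of "norm h" t] by (simp add: dist_norm)
      show "(g has_derivative ?d w) (at w within cball x (norm h))" for w
        by (rule has_derivative_at_withinI[OF schwartz_has_derivative[OF g]])
      show "onorm (?d w - ?d x) \<le> L * norm h" if w: "w \<in> cball x (norm h)" for w
      proof -
        have eq: "?d w - ?d x = (\<lambda>v. \<Sum>i\<in>UNIV. (v $ i) *\<^sub>R (partial i g w - partial i g x))"
          by (simp add: fun_eq_iff sum_subtractf scaleR_diff_right del: iter_partial.simps)
        have "onorm (?d w - ?d x) \<le> (\<Sum>i\<in>UNIV. cmod (partial i g w - partial i g x))"
          unfolding eq by (rule onorm_partials_le)
        also have "\<dots> \<le> (\<Sum>i\<in>UNIV. D i * norm (x - w))"
          using D(2)[of _ "-w" "-x"] by (intro sum_mono) (simp del: iter_partial.simps)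
        also have "\<dots> = L * norm (x - w)" by (simp add: L_def sum_distrib_right)
        also have "\<dots> \<le> L * norm h" using w L by (intro mult_left_mono) (auto simp: dist_norm)
        finally show ?thesis .
      qed
    qed simp
    then show ?thesis by (simp add: power2_eq_square mult_ac del: iter_partial.simps)
  qed
  with L that show thesis by blast
qed

section \<open>Convolution with a rapidly decreasing function\<close>

definition convolve :: "(real^'d \<Rightarrow> complex) \<Rightarrow> (real^'d \<Rightarrow> complex) \<Rightarrow> real^'d \<Rightarrow> complex" where
  "convolve g h x = (LINT y|lborel. g (x - y) * h y)"

lemma rapidly_decreasing_bounded:
  assumes "rapidly_decreasing g"
  obtains C where "0 \<le> C" "\<And>x. cmod (g x) \<le> C"
proof -
  obtain C where "0 \<le> C" "\<And>x. (1 + norm x) ^ 0 * cmod (g x) \<le> C"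
    using rapidly_decreasingE[OF assms] by blast
  then show thesis by (intro that[of C]) auto
qed

lemma integrable_convolve:
  fixes g h :: "real^'d \<Rightarrow> complex"
  assumes g: "rapidly_decreasing g" and h: "rapidly_decreasing h"
    and [measurable]: "g \<in> borel_measurable borel" "h \<in> borel_measurable borel"
  shows "integrable lborel (\<lambda>y. g (x - y) * h y)"
proof -
  obtain C where C: "0 \<le> C" "\<And>x. cmod (g x) \<le> C"
    using rapidly_decreasing_bounded[OF g] by blast
  show ?thesis
  proof (rule Bochner_Integration.integrable_bound)
    show "integrable lborel (\<lambda>y. complex_of_real C * h y)"
      by (intro integrable_mult_right integrable_rapidly_decreasing h) measurable
    show "AE y in lborel. norm (g (x - y) * h y) \<le> norm (complex_of_real C * h y)"
      using C by (auto simp: norm_mult intro!: mult_right_mono)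
  qed measurable
qed

lemma rapidly_decreasing_convolve:
  fixes g h :: "real^'d \<Rightarrow> complex"
  assumes g: "rapidly_decreasing g" and h: "rapidly_decreasing h"
    and [measurable]: "g \<in> borel_measurable borel" "h \<in> borel_measurable borel"
  shows "rapidly_decreasing (convolve g h)"
  unfolding rapidly_decreasing_def
proof
  fix n
  obtain C where C: "0 \<le> C" "\<And>x. (1 + norm x) ^ n * cmod (g x) \<le> C"
    using rapidly_decreasingE[OF g] by metis
  define K where "K = (LINT y|lborel. C * ((1 + norm y) ^ n * cmod (h y)))"
  have "(1 + norm x) ^ n * cmod (convolve g h x) \<le> K" for x
  proof -
    have "(1 + norm x) ^ n * cmod (convolve g h x) \<le>
        (1 + norm x) ^ n * (LINT y|lborel. cmod (g (x - y) * h y))"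
      unfolding convolve_def by (intro mult_left_mono integral_norm_bound) simp
    also have "\<dots> = (LINT y|lborel. (1 + norm x) ^ n * cmod (g (x - y) * h y))" by simp
    also have "\<dots> \<le> K"
      unfolding K_def
    proof (rule integral_mono)
      show "integrable lborel (\<lambda>y. (1 + norm x) ^ n * cmod (g (x - y) * h y))"
        by (intro integrable_mult_right integrable_norm integrable_convolve g h) measurable
      show "integrable lborel (\<lambda>y. C * ((1 + norm y) ^ n * cmod (h y)))"
        by (intro integrable_mult_right integrable_power_rapidly_decreasing h) measurable
      fix y
      have "(1 + norm x) ^ n \<le> ((1 + norm (x - y)) * (1 + norm y)) ^ n"
        using one_plus_norm_triangle[of "x - y" y] by (intro power_mono) auto
      then have "(1 + norm x) ^ n * cmod (g (x - y) * h y) \<le>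
          ((1 + norm (x - y)) * (1 + norm y)) ^ n * cmod (g (x - y) * h y)"
        by (rule mult_right_mono) simp
      also have "\<dots> = ((1 + norm (x - y)) ^ n * cmod (g (x - y))) * ((1 + norm y) ^ n * cmod (h y))"
        by (simp add: norm_mult power_mult_distrib)
      also have "\<dots> \<le> C * ((1 + norm y) ^ n * cmod (h y))"
        by (intro mult_right_mono C) simp
      finally show "(1 + norm x) ^ n * cmod (g (x - y) * h y) \<le> C * ((1 + norm y) ^ n * cmod (h y))" .
    qed
    finally show ?thesis .
  qed
  then show "\<exists>C. \<forall>x. (1 + norm x) ^ n * cmod (convolve g h x) \<le> C" by blast
qed

text \<open>Since the Taylor remainder of \<open>g\<close> is quadratic uniformly in its argument, it remains quadratic after
  integration against \<open>h\<close>.\<close>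

lemma has_derivative_convolve:
  fixes g h :: "real^'d \<Rightarrow> complex"
  assumes g: "g \<in> schwartz" and h: "rapidly_decreasing h" and [measurable]: "h \<in> borel_measurable borel"
  shows "(convolve g h has_derivative (\<lambda>v. \<Sum>i\<in>UNIV. (v $ i) *\<^sub>R convolve (partial i g) h x)) (at x)"
proof -
  obtain L where L: "0 \<le> L"
    "\<And>x v. cmod (g (x + v) - g x - (\<Sum>i\<in>UNIV. (v $ i) *\<^sub>R partial i g x)) \<le> L * (norm v)\<^sup>2"
    using schwartz_taylor[OF g] by blast
  have int: "integrable lborel (\<lambda>y. iter_partial is g (x - y) * h y)" for "is" x
    using schwartz_iter_partial[OF g, of "is"] assms(3)
    by (intro integrable_convolve[OF schwartz_rapidly_decreasing h schwartz_borel])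
  note int0 = int[of "[]", simplified]
  have hint: "integrable lborel h" by (intro integrable_rapidly_decreasing h) simp
  define K where "K = L * (LINT y|lborel. cmod (h y))"
  let ?r = "\<lambda>v y. g (x + v - y) - g (x - y) - (\<Sum>i\<in>UNIV. (v $ i) *\<^sub>R partial i g (x - y))"
  have bound: "cmod (convolve g h (x + v) - convolve g h x - (\<Sum>i\<in>UNIV. (v $ i) *\<^sub>R convolve (partial i g) h x))
      \<le> K * (norm v)\<^sup>2" for v
  proof -
    have "convolve g h (x + v) - convolve g h x - (\<Sum>i\<in>UNIV. (v $ i) *\<^sub>R convolve (partial i g) h x) =
        (LINT y|lborel. g (x + v - y) * h y - g (x - y) * h y - (\<Sum>i\<in>UNIV. (v $ i) *\<^sub>R (partial i g (x - y) * h y)))"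
      unfolding convolve_def
      by (subst Bochner_Integration.integral_diff Bochner_Integration.integral_sum integral_scaleR_right;
          (intro Bochner_Integration.integrable_diff Bochner_Integration.integrable_sum
            integrable_scaleR_right int0 int | rule refl)?)+
    also have "\<dots> = (LINT y|lborel. ?r v y * h y)"
      by (rule Bochner_Integration.integral_cong)
        (simp_all add: left_diff_distrib sum_distrib_right del: iter_partial.simps)
    also have "cmod \<dots> \<le> (LINT y|lborel. (L * (norm v)\<^sup>2) * cmod (h y))"
    proof (rule order_trans[OF integral_norm_bound integral_mono])
      have "integrable lborel (\<lambda>y. g (x + v - y) * h y - g (x - y) * h y - (\<Sum>i\<in>UNIV. (v $ i) *\<^sub>R (partial i g (x - y) * h y)))"
        by (intro Bochner_Integration.integrable_diff Bochner_Integration.integrable_sum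
            integrable_scaleR_right int0 int)
      then have "integrable lborel (\<lambda>y. ?r v y * h y)"
        by (simp add: left_diff_distrib sum_distrib_right del: iter_partial.simps)
      then show "integrable lborel (\<lambda>y. cmod (?r v y * h y))"
        by (rule integrable_norm)
      show "integrable lborel (\<lambda>y. (L * (norm v)\<^sup>2) * cmod (h y))"
        using hint by simp
      show "cmod (?r v y * h y) \<le> (L * (norm v)\<^sup>2) * cmod (h y)" for y
      proof -
        have "x + v - y = x - y + v" by simp
        with L(2)[of "x - y" v] have "cmod (?r v y) \<le> L * (norm v)\<^sup>2" by metis
        then show ?thesis unfolding norm_mult by (rule mult_right_mono) simp
      qed
    qed
    finally show ?thesis by (simp add: K_def mult_ac)
  qed
  show ?thesis
    unfolding has_derivative_at
  proof
    show "bounded_linear (\<lambda>v. \<Sum>i\<in>UNIV. (v $ i) *\<^sub>R convolve (partial i g) h x)"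
      by (intro bounded_linear_sum bounded_linear_scaleR_const bounded_linear_vec_nth)
    show "(\<lambda>v. norm (convolve g h (x + v) - convolve g h x - (\<Sum>i\<in>UNIV. (v $ i) *\<^sub>R convolve (partial i g) h x)) / norm v) \<midarrow>0\<rightarrow> 0"
    proof (rule Lim_null_comparison[where g = "\<lambda>v. K * norm v"])
      show "(\<lambda>v. K * norm v) \<midarrow>0\<rightarrow> (0::real)"
        by (intro tendsto_mult_right_zero tendsto_norm_zero tendsto_ident_at)
      show "\<forall>\<^sub>F v in at 0. norm (norm (convolve g h (x + v) - convolve g h x -
          (\<Sum>i\<in>UNIV. (v $ i) *\<^sub>R convolve (partial i g) h x)) / norm v) \<le> K * norm v"
      proof (intro always_eventually allI)
        fix v
        show "norm (norm (convolve g h (x + v) - convolve g h x -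
          (\<Sum>i\<in>UNIV. (v $ i) *\<^sub>R convolve (partial i g) h x)) / norm v) \<le> K * norm v"
          using bound[of v] by (cases "v = 0") (simp_all add: divide_le_eq power2_eq_square mult_ac
              del: iter_partial.simps)
      qed
    qed
  qed
qed

text \<open>Every derivative falls on \<open>g\<close>, so the convolutions of Schwartz functions with \<open>h\<close> form a set that is
  closed under partial derivatives.\<close>

lemma convolve_schwartz:
  fixes g h :: "real^'d \<Rightarrow> complex"
  assumes g: "g \<in> schwartz" and h: "rapidly_decreasing h" and m: "h \<in> borel_measurable borel"
  shows "convolve g h \<in> schwartz" "iter_partial is (convolve g h) = convolve (iter_partial is g) h"
proof -
  have p: "partial i (convolve g h) = convolve (partial i g) h" if "g \<in> schwartz" for i g
  proof -
    have "partial i (convolve g h) = (\<lambda>x. \<Sum>j\<in>UNIV. (axis i 1 $ j) *\<^sub>R convolve (partial j g) h x)"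
      by (rule partial_eqI[OF has_derivative_convolve[OF that h m]])
    then show ?thesis
      by (simp add: axis_def if_distrib[where f = "\<lambda>r. r *\<^sub>R _"] cong: if_cong del: iter_partial.simps)
  qed
  show "iter_partial is (convolve g h) = convolve (iter_partial is g) h" 
  proof (induction "is")
    case (Cons i "is")
    then show ?case using p[OF schwartz_iter_partial[OF g], of i "is"] by simp
  qed simp
  show "convolve g h \<in> schwartz"
  proof (rule schwartz_coinduct[where X = "(\<lambda>g. convolve g h) ` schwartz"])
    fix f assume "f \<in> (\<lambda>g. convolve g h) ` schwartz"
    then obtain g where g: "g \<in> schwartz" "f = convolve g h" by blast
    show "f differentiable at x" for x
      unfolding g(2) differentiable_def using has_derivative_convolve[OF g(1) h m] by blast
    show "rapidly_decreasing f" unfolding g(2)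
      by (intro rapidly_decreasing_convolve schwartz_rapidly_decreasing schwartz_borel g h m)
    show "partial i f \<in> (\<lambda>g. convolve g h) ` schwartz" for i
      unfolding g(2) p[OF g(1)] using schwartz_iter_partial[OF g(1)] by blast
  qed (use g in blast)
qed

section \<open>Tempered distributions\<close>

lemma tempered_add: "u \<in> tempered \<Longrightarrow> g \<in> schwartz \<Longrightarrow> h \<in> schwartz \<Longrightarrow> u (\<lambda>x. g x + h x) = u g + u h"
  by (auto simp: tempered_def)

lemma tempered_cmult: "u \<in> tempered \<Longrightarrow> g \<in> schwartz \<Longrightarrow> u (\<lambda>x. c * g x) = c * u g"
  by (auto simp: tempered_def)

lemma tempered_zero: "u \<in> tempered \<Longrightarrow> u (\<lambda>x. 0) = 0"
  using tempered_cmult[OF _ schwartz_zero, of u 0] by simp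

lemma tempered_sum:
  assumes "u \<in> tempered" "finite V" "\<And>v. v \<in> V \<Longrightarrow> g v \<in> schwartz"
  shows "u (\<lambda>x. \<Sum>v\<in>V. c v * g v x) = (\<Sum>v\<in>V. c v * u (g v))"
  using assms(2,3)
proof induction
  case (insert v V)
  have "u (\<lambda>x. c v * g v x + (\<Sum>v\<in>V. c v * g v x)) = u (\<lambda>x. c v * g v x) + u (\<lambda>x. \<Sum>v\<in>V. c v * g v x)"
    using insert by (intro tempered_add assms(1) schwartz_cmult schwartz_sum) auto
  then show ?case using insert by (simp add: tempered_cmult[OF assms(1)])
qed (simp add: tempered_zero[OF assms(1)])

lemma schwartz_diff: "g \<in> schwartz \<Longrightarrow> h \<in> schwartz \<Longrightarrow> (\<lambda>x. g x - h x) \<in> schwartz"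
  using schwartz_add[OF _ schwartz_cmult[of h "-1"]] by simp

lemma tempered_diff: "u \<in> tempered \<Longrightarrow> g \<in> schwartz \<Longrightarrow> h \<in> schwartz \<Longrightarrow> u (\<lambda>x. g x - h x) = u g - u h"
  using tempered_add[OF _ _ schwartz_cmult[of h "-1"], of u g] tempered_cmult[of u h "-1"] by simp

lemma iter_partial_diff:
  "g \<in> schwartz \<Longrightarrow> h \<in> schwartz \<Longrightarrow>
    iter_partial is (\<lambda>x. g x - h x) = (\<lambda>x. iter_partial is g x - iter_partial is h x)"
  using iter_partial_add[OF _ schwartz_cmult[of h "-1"], of g "is"] iter_partial_cmult[of h "is" "-1"]
  by simp

text \<open>Continuity at the origin and homogeneity give boundedness by one of the seminorms. An explicit
  bound \<open>K\<close> of the weighted derivatives stands in for the supremum in the seminorm.\<close>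

lemma tempered_bounded:
  fixes u :: "(real^'d \<Rightarrow> complex) \<Rightarrow> complex"
  assumes u: "u \<in> tempered"
  obtains n C where "0 \<le> C" "\<And>h K. h \<in> schwartz \<Longrightarrow>
    (\<And>is x. length is \<le> n \<Longrightarrow> (1 + norm x) ^ n * cmod (iter_partial is h x) \<le> K) \<Longrightarrow> cmod (u h) \<le> C * K"
proof -
  have "\<forall>g\<in>schwartz. \<forall>e>0. \<exists>n. \<exists>\<delta>>0. \<forall>h\<in>schwartz.
      schwartz_seminorm n (\<lambda>x. h x - g x) < \<delta> \<longrightarrow> cmod (u h - u g) < e"
    using u by (simp add: tempered_def)
  from this[THEN bspec, OF schwartz_zero, THEN spec, of 1]
  obtain n \<delta> where \<delta>: "\<delta> > 0" and cont: "\<And>h. h \<in> schwartz \<Longrightarrow>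
      schwartz_seminorm n (\<lambda>x. h x - 0) < \<delta> \<Longrightarrow> cmod (u h - u (\<lambda>x. 0)) < 1"
    by auto
  have bound: "cmod (u h) \<le> 2 / \<delta> * K"
    if h: "h \<in> schwartz" and K: "0 < K"
      and le: "\<And>is x. length is \<le> n \<Longrightarrow> (1 + norm x) ^ n * cmod (iter_partial is h x) \<le> K" for h K
  proof -
    \<comment> \<open>the factor that brings \<open>h\<close> into the ball of radius \<open>\<delta>\<close>\<close>
    define c where "c = \<delta> / (2 * K)"
    have c: "c > 0" using \<delta> K by (simp add: c_def)
    have "schwartz_seminorm n (\<lambda>x. complex_of_real c * h x - 0) \<le> \<delta> / 2"
      unfolding schwartz_seminorm_def
    proof (rule cSUP_least)
      show "{is::'d list. length is \<le> n} \<times> (UNIV :: (real^'d) set) \<noteq> {}" by (auto intro: exI[of _ "[]"])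
      fix z :: "'d list \<times> (real^'d)" assume "z \<in> {is. length is \<le> n} \<times> (UNIV :: (real^'d) set)"
      then obtain "is" x where z: "z = (is, x)" "length is \<le> n" by auto
      have "(1 + norm x) ^ n * cmod (iter_partial is (\<lambda>x. complex_of_real c * h x - 0) x) =
          c * ((1 + norm x) ^ n * cmod (iter_partial is h x))"
        using c by (simp add: iter_partial_cmult[OF h] norm_mult)
      also have "\<dots> \<le> c * K" using c by (intro mult_left_mono le z) auto
      also have "\<dots> = \<delta> / 2" using K by (simp add: c_def)
      finally show "(case z of (is, x) \<Rightarrow> (1 + norm x) ^ n *
          cmod (iter_partial is (\<lambda>x. complex_of_real c * h x - 0) x)) \<le> \<delta> / 2"
        by (simp add: z)
    qed
    also have "\<dots> < \<delta>" using \<delta> by simp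
    finally have "cmod (u (\<lambda>x. complex_of_real c * h x) - u (\<lambda>x. 0)) < 1"
      by (rule cont[OF schwartz_cmult[OF h]])
    then have "c * cmod (u h) < 1"
      using c by (simp add: tempered_cmult[OF u h] tempered_zero[OF u] norm_mult)
    then have "cmod (u h) \<le> 1 / c" using c by (simp add: field_simps)
    then show ?thesis using K by (simp add: c_def field_simps)
  qed
  show thesis
  proof (rule that[of "2 / \<delta>" n])
    fix h :: "real^'d \<Rightarrow> complex" and K assume h: "h \<in> schwartz"
      and le: "\<And>is x. length is \<le> n \<Longrightarrow> (1 + norm x) ^ n * cmod (iter_partial is h x) \<le> K"
    have "0 \<le> (1 + norm (0::real^'d)) ^ n * cmod (iter_partial [] h 0)" by simp
    also have "\<dots> \<le> K" by (rule le) simp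
    finally have K: "0 \<le> K" .
    show "cmod (u h) \<le> 2 / \<delta> * K"
    \<comment> \<open>\<open>K\<close> may vanish, so the bound is applied to slightly larger values\<close>
    proof (rule field_le_epsilon)
      fix e :: real assume e: "e > 0"
      have "cmod (u h) \<le> 2 / \<delta> * (K + e * \<delta> / 2)"
      proof (rule bound[OF h])
        show "0 < K + e * \<delta> / 2" using K e \<delta> by (intro add_nonneg_pos) auto
        show "(1 + norm x) ^ n * cmod (iter_partial is h x) \<le> K + e * \<delta> / 2"
          if "length is \<le> n" for "is" x
          using le[OF that, of x] mult_pos_pos[OF e \<delta>] by linarith
      qed
      then show "cmod (u h) \<le> 2 / \<delta> * K + e" using \<delta> by (simp add: field_simps)
    qed
  qed (use \<delta> in simp)
qed

lemma schwartz_shift_diff_uniform: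
  fixes g :: "real^'a \<Rightarrow> complex"
  assumes g: "g \<in> schwartz"
  obtains D where "0 \<le> D"
    "\<And>is x y s. length is \<le> n \<Longrightarrow> (1 + norm x) ^ n * cmod (iter_partial is g (x - y) - iter_partial is g (x - s))
      \<le> D * (norm (y - s) * (1 + norm y + norm s) ^ n)"
proof -
  have "\<exists>C\<ge>0. \<forall>x y s. (1 + norm x) ^ n * cmod (iter_partial is g (x - y) - iter_partial is g (x - s))
      \<le> C * (norm (y - s) * (1 + norm y + norm s) ^ n)" for "is"
    by (rule schwartz_shift_diff[OF schwartz_iter_partial[OF g], of n "is"]) blast
  then obtain C where C: "\<And>is. 0 \<le> C is"
    "\<And>is x y s. (1 + norm x) ^ n * cmod (iter_partial is g (x - y) - iter_partial is g (x - s))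
      \<le> C is * (norm (y - s) * (1 + norm y + norm s) ^ n)"
    by metis
  define I where "I = {is::'a list. length is \<le> n}"
  have "finite I" unfolding I_def using finite_lists_length_le[of "UNIV :: 'a set" n] by simp
  show thesis
  proof (rule that[of "sum C I"])
    fix "is" :: "'a list" and x y s :: "real^'a"
    assume "length is \<le> n"
    then have "C is \<le> sum C I"
      using \<open>finite I\<close> C(1) by (intro member_le_sum) (auto simp: I_def)
    then have "C is * (norm (y - s) * (1 + norm y + norm s) ^ n) \<le> sum C I * (norm (y - s) * (1 + norm y + norm s) ^ n)"
      by (rule mult_right_mono) simp
    with C(2)[of x "is" y s] show "(1 + norm x) ^ n * cmod (iter_partial is g (x - y) - iter_partial is g (x - s))
      \<le> sum C I * (norm (y - s) * (1 + norm y + norm s) ^ n)" by linarith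
  qed (intro sum_nonneg C)
qed

lemma integral_simple_function_mult:
  fixes k :: "'b \<Rightarrow> complex" and h :: "'a \<Rightarrow> complex"
  assumes s: "simple_function M s" and h: "integrable M h"
  defines "c \<equiv> \<lambda>v. LINT y|M. indicator (s -` {v} \<inter> space M) y * h y"
  shows "integrable M (\<lambda>y. k (s y) * h y)"
    "(LINT y|M. k (s y) * h y) = (\<Sum>v\<in>s ` space M. c v * k v)"
proof -
  have fin: "finite (s ` space M)" using s by (simp add: simple_function_def)
  have int: "integrable M (\<lambda>y. indicator (s -` {v} \<inter> space M) y * h y)" for v
  proof -
    have "s -` {v} \<inter> space M \<in> sets M" by (rule simple_functionD(2)[OF s])
    from integrable_mult_indicator[OF this h] show ?thesis
      by (rule Bochner_Integration.integrable_cong[THEN iffD1, rotated -1]) (auto simp: indicator_def)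
  qed
  have eq: "k (s y) * h y = (\<Sum>v\<in>s ` space M. k v * (indicator (s -` {v} \<inter> space M) y * h y))"
    if "y \<in> space M" for y
  proof -
    have "(\<Sum>v\<in>s ` space M. k v * (indicator (s -` {v} \<inter> space M) y * h y)) =
        (\<Sum>v\<in>s ` space M. if v = s y then k v * h y else 0)"
      using that by (intro sum.cong) (auto simp: indicator_def)
    then show ?thesis using fin that by simp
  qed
  have "integrable M (\<lambda>y. \<Sum>v\<in>s ` space M. k v * (indicator (s -` {v} \<inter> space M) y * h y))"
    by (intro Bochner_Integration.integrable_sum integrable_mult_right int)
  then show "integrable M (\<lambda>y. k (s y) * h y)"
    by (rule Bochner_Integration.integrable_cong[THEN iffD2, rotated -1]) (auto simp: eq)
  have "(LINT y|M. k (s y) * h y) = (LINT y|M. (\<Sum>v\<in>s ` space M. k v * (indicator (s -` {v} \<inter> space M) y * h y)))"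
    by (rule Bochner_Integration.integral_cong) (auto simp: eq)
  also have "\<dots> = (\<Sum>v\<in>s ` space M. k v * c v)"
    unfolding c_def by (subst Bochner_Integration.integral_sum) (auto intro!: integrable_mult_right int)
  finally show "(LINT y|M. k (s y) * h y) = (\<Sum>v\<in>s ` space M. c v * k v)"
    by (simp add: mult.commute)
qed

text \<open>Replacing \<open>y\<close> by simple functions \<open>s y\<close> that approximate the identity turns the convolution into
  a finite linear combination of translates, where \<open>u\<close> may be moved inside. The Schwartz seminorms of
  the error are bounded by the integral of \<open>norm (y - s y)\<close> against a polynomial weight and \<open>h\<close>.\<close>

theorem tempered_convolve:
  fixes g h :: "real^'d \<Rightarrow> complex"
  assumes u: "u \<in> tempered" and g: "g \<in> schwartz" and h: "rapidly_decreasing h"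
    and hm[measurable]: "h \<in> borel_measurable borel"
  shows "continuous_on UNIV (\<lambda>y. u (\<lambda>x. g (x - y)))"
    and "integrable lborel (\<lambda>y. u (\<lambda>x. g (x - y)) * h y)"
    and "u (convolve g h) = (LINT y|lborel. u (\<lambda>x. g (x - y)) * h y)"
proof -
  obtain n C where C: "0 \<le> C" and ub: "\<And>h K. h \<in> schwartz \<Longrightarrow>
    (\<And>is x. length is \<le> n \<Longrightarrow> (1 + norm x) ^ n * cmod (iter_partial is h x) \<le> K) \<Longrightarrow> cmod (u h) \<le> C * K"
    by (rule tempered_bounded[OF u]) blast
  obtain D where D: "0 \<le> D"
    "\<And>is x y s. length is \<le> n \<Longrightarrow> (1 + norm x) ^ n * cmod (iter_partial is g (x - y) - iter_partial is g (x - s))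
      \<le> D * (norm (y - s) * (1 + norm y + norm s) ^ n)"
    using schwartz_shift_diff_uniform[OF g, of n] by blast
  \<comment> \<open>the cost of replacing \<open>y\<close> by \<open>s\<close>, up to the constants \<open>C\<close> and \<open>D\<close>\<close>
  define e where "e y s = norm (y - s) * (1 + norm y + norm s) ^ n" for y s :: "real^'d"
  have e_nonneg: "0 \<le> e y s" for y s by (simp add: e_def)
  define f where "f y = u (\<lambda>x. g (x - y))" for y
  have f_diff: "cmod (f y - f s) \<le> C * D * e y s" for y s
  proof -
    have "f y - f s = u (\<lambda>x. g (x - y) - g (x - s))"
      unfolding f_def by (rule tempered_diff[symmetric, OF u]; intro schwartz_translate g)
    also have "cmod \<dots> \<le> C * (D * e y s)"
      using D(2) by (intro ub schwartz_diff schwartz_translate g)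
        (simp add: e_def iter_partial_diff iter_partial_translate schwartz_translate g)
    finally show ?thesis by simp
  qed
  have cont: "continuous_on UNIV f"
  proof (intro continuous_at_imp_continuous_on ballI)
    fix y
    have "((\<lambda>s. C * D * e s y) \<longlongrightarrow> C * D * e y y) (at y)"
      unfolding e_def by (intro tendsto_intros)
    then have "((\<lambda>s. C * D * e s y) \<longlongrightarrow> 0) (at y)" by (simp add: e_def)
    then have "((\<lambda>s. f s - f y) \<longlongrightarrow> 0) (at y)"
      by (rule Lim_null_comparison[rotated]) (use f_diff in auto)
    then show "isCont f y" by (simp add: isCont_def LIM_zero_iff)
  qed
  then show "continuous_on UNIV (\<lambda>y. u (\<lambda>x. g (x - y)))" unfolding f_def .
  from cont have [measurable]: "f \<in> borel_measurable borel" by (rule borel_measurable_continuous_onI)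
  have hint: "integrable lborel h" by (rule integrable_rapidly_decreasing[OF h hm])
  have fint: "integrable lborel (\<lambda>y. f y * h y)"
  proof (rule Bochner_Integration.integrable_bound)
    show "integrable lborel (\<lambda>y. (cmod (f 0) + C * D) * ((1 + norm y) ^ (n + 1) * cmod (h y)))"
      by (intro integrable_mult_right integrable_power_rapidly_decreasing h hm)
    have "cmod (f y) \<le> (cmod (f 0) + C * D) * (1 + norm y) ^ (n + 1)" for y
    proof -
      have "e y 0 \<le> (1 + norm y) ^ (n + 1)"
        by (simp add: e_def mult_right_mono)
      then have "C * D * e y 0 \<le> C * D * (1 + norm y) ^ (n + 1)"
        using C D(1) by (intro mult_left_mono) auto
      moreover have "cmod (f y) \<le> cmod (f 0) + cmod (f y - f 0)"
        using norm_triangle_ineq[of "f 0" "f y - f 0"] by simp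
      moreover have "cmod (f 0) * 1 \<le> cmod (f 0) * (1 + norm y) ^ (n + 1)"
        by (intro mult_left_mono one_le_power) auto
      ultimately show ?thesis using f_diff[of y 0] by (simp add: distrib_right)
    qed
    then have "norm (f y * h y) \<le> (cmod (f 0) + C * D) * ((1 + norm y) ^ (n + 1) * cmod (h y))" for y
      unfolding norm_mult mult.assoc[symmetric] by (rule mult_right_mono) simp
    then show "AE y in lborel. norm (f y * h y) \<le> norm ((cmod (f 0) + C * D) * ((1 + norm y) ^ (n + 1) * cmod (h y)))"
      using C D(1) by (simp add: abs_mult)
  qed measurable
  then show "integrable lborel (\<lambda>y. u (\<lambda>x. g (x - y)) * h y)" unfolding f_def .
  obtain s where s: "\<And>N. simple_function lborel (s N)"
      and s_lim: "\<And>y. (\<lambda>N. s N y) \<longlonglongrightarrow> y" and s_le: "\<And>N y. norm (s N y) \<le> 2 * norm (y::real^'d)"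
    using borel_measurable_implies_sequence_metric[of "\<lambda>y::real^'d. y" lborel 0] by auto
  \<comment> \<open>the total cost of replacing \<open>y\<close> by \<open>s N y\<close>; it vanishes in the limit by dominated convergence\<close>
  define K where "K N = (LINT y|lborel. e y (s N y) * cmod (h y))" for N
  have e_bound: "e y (s N y) * cmod (h y) \<le> 3 ^ (n + 1) * ((1 + norm y) ^ (n + 1) * cmod (h y))" for N y
  proof -
    have "norm (y - s N y) \<le> 3 * (1 + norm y)"
      using norm_triangle_ineq4[of y "s N y"] s_le[of N y] by simp
    moreover have "(1 + norm y + norm (s N y)) ^ n \<le> (3 * (1 + norm y)) ^ n"
      using s_le[of N y] by (intro power_mono) auto
    ultimately have "e y (s N y) \<le> (3 * (1 + norm y)) * (3 * (1 + norm y)) ^ n"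
      unfolding e_def by (intro mult_mono) auto
    then have "e y (s N y) \<le> (3 * (1 + norm y)) ^ (n + 1)" by simp
    then have "e y (s N y) * cmod (h y) \<le> (3 * (1 + norm y)) ^ (n + 1) * cmod (h y)"
      by (rule mult_right_mono) simp
    then show ?thesis by (simp only: power_mult_distrib mult_ac)
  qed
  have [measurable]: "s N \<in> borel_measurable borel" for N
    using borel_measurable_simple_function[OF s[of N]] by simp
  have e_meas[measurable]: "(\<lambda>y. e y (s N y)) \<in> borel_measurable borel" for N
    unfolding e_def by measurable
  have w: "integrable lborel (\<lambda>y. 3 ^ (n + 1) * ((1 + norm y) ^ (n + 1) * cmod (h y)))"
    by (intro integrable_mult_right integrable_power_rapidly_decreasing h hm)
  have e_int: "integrable lborel (\<lambda>y. e y (s N y) * cmod (h y))" for N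
    by (rule Bochner_Integration.integrable_bound[OF w])
      (use e_bound e_nonneg in \<open>auto simp: abs_mult\<close>)
  have "K \<longlonglongrightarrow> (LINT y|lborel. 0 * cmod (h y))"
    unfolding K_def
  proof (rule integral_dominated_convergence[OF _ _ w])
    show "AE y in lborel. (\<lambda>N. e y (s N y) * cmod (h y)) \<longlonglongrightarrow> 0 * cmod (h y)"
    proof (intro AE_I2 tendsto_mult_right)
      fix y
      have "(\<lambda>N. e y (s N y)) \<longlonglongrightarrow> e y y" unfolding e_def by (intro tendsto_intros s_lim)
      then show "(\<lambda>N. e y (s N y)) \<longlonglongrightarrow> 0" by (simp add: e_def)
    qed
    show "AE y in lborel. norm (e y (s N y) * cmod (h y)) \<le> 3 ^ (n + 1) * ((1 + norm y) ^ (n + 1) * cmod (h y))" for N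
      using e_bound e_nonneg by (auto simp: abs_mult)
  qed measurable
  then have K_lim: "K \<longlonglongrightarrow> 0" by simp
  have K_bound: "cmod (LINT y|lborel. F y * h y) \<le> E * K N"
    if "integrable lborel (\<lambda>y. F y * h y)" "\<And>y. cmod (F y) \<le> E * e y (s N y)" for E F N
  proof -
    have "cmod (LINT y|lborel. F y * h y) \<le> (LINT y|lborel. E * (e y (s N y) * cmod (h y)))"
    proof (rule order_trans[OF integral_norm_bound integral_mono])
      show "cmod (F y * h y) \<le> E * (e y (s N y) * cmod (h y))" for y
        unfolding norm_mult mult.assoc[symmetric] by (intro mult_right_mono that) simp
    qed (intro integrable_norm integrable_mult_right that e_int)+
    then show ?thesis by (simp add: K_def)
  qed
  have main: "cmod (u (convolve g h) - (LINT y|lborel. f y * h y)) \<le> 2 * (C * D) * K N" for N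
  proof -
    define c where "c v = (LINT y|lborel. indicator (s N -` {v} \<inter> space lborel) y * h y)" for v
    define V where "V = range (s N)"
    have "finite V" using s[of N] by (simp add: simple_function_def V_def)
    have sums: "integrable lborel (\<lambda>y. k (s N y) * h y)" "(LINT y|lborel. k (s N y) * h y) = (\<Sum>v\<in>V. c v * k v)" for k
      using integral_simple_function_mult[OF s[of N] hint, of k] by (simp_all add: c_def V_def)
    \<comment> \<open>the convolution with \<open>s N y\<close> in place of \<open>y\<close>, a finite combination of translates of \<open>g\<close>\<close>
    define S where "S = (\<lambda>x. \<Sum>v\<in>V. c v * g (x - v))"
    have S: "S \<in> schwartz" unfolding S_def by (intro schwartz_sum \<open>finite V\<close> schwartz_translate g)
    have "u S = (\<Sum>v\<in>V. c v * f v)"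
      unfolding S_def f_def by (intro tempered_sum u \<open>finite V\<close> schwartz_translate g)
    then have uS: "u S = (LINT y|lborel. f (s N y) * h y)" by (simp add: sums)
    have conv: "convolve g h \<in> schwartz" by (rule convolve_schwartz[OF g h hm])
    have "cmod (u (\<lambda>x. convolve g h x - S x)) \<le> C * (D * K N)"
    proof (rule ub[OF schwartz_diff[OF conv S]])
      fix "is" :: "'d list" and x
      assume len: "length is \<le> n"
      have int: "integrable lborel (\<lambda>y. iter_partial is g (x - y) * h y)"
        using schwartz_iter_partial[OF g, of "is"] hm
        by (intro integrable_convolve[OF schwartz_rapidly_decreasing h schwartz_borel])
      have "iter_partial is (\<lambda>x. convolve g h x - S x) x =
          (LINT y|lborel. iter_partial is g (x - y) * h y) - (\<Sum>v\<in>V. c v * iter_partial is g (x - v))"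
        unfolding iter_partial_diff[OF conv S] convolve_schwartz(2)[OF g h hm]
        unfolding S_def
        by (subst iter_partial_sum[OF \<open>finite V\<close>])
          (auto simp: convolve_def iter_partial_translate[OF g] intro: schwartz_translate g)
      also have "\<dots> = (LINT y|lborel. (iter_partial is g (x - y) - iter_partial is g (x - s N y)) * h y)"
        unfolding left_diff_distrib sums(2)[of "\<lambda>y. iter_partial is g (x - y)", symmetric]
        by (rule Bochner_Integration.integral_diff[symmetric, OF int sums(1)])
      finally have eq: "iter_partial is (\<lambda>x. convolve g h x - S x) x =
        (LINT y|lborel. (iter_partial is g (x - y) - iter_partial is g (x - s N y)) * h y)" .
      have pos: "(1 + norm x) ^ n > 0"
        using norm_ge_zero[of x] by (intro zero_less_power add_pos_nonneg) auto
      have "cmod (iter_partial is (\<lambda>x. convolve g h x - S x) x) \<le> (D / (1 + norm x) ^ n) * K N"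
        unfolding eq
      proof (rule K_bound)
        show "integrable lborel (\<lambda>y. (iter_partial is g (x - y) - iter_partial is g (x - s N y)) * h y)"
          unfolding left_diff_distrib
          by (rule Bochner_Integration.integrable_diff[OF int sums(1)])
        show "cmod (iter_partial is g (x - y) - iter_partial is g (x - s N y)) \<le> D / (1 + norm x) ^ n * e y (s N y)" for y
          using D(2)[OF len, of x y "s N y"] pos by (simp add: e_def field_simps)
      qed
      then show "(1 + norm x) ^ n * cmod (iter_partial is (\<lambda>x. convolve g h x - S x) x) \<le> D * K N"
        using pos by (simp add: field_simps)
    qed
    then have 1: "cmod (u (convolve g h) - (LINT y|lborel. f (s N y) * h y)) \<le> C * D * K N"
      by (simp add: tempered_diff[OF u conv S] uS)
    have "(LINT y|lborel. f y * h y) - (LINT y|lborel. f (s N y) * h y) = (LINT y|lborel. (f y - f (s N y)) * h y)"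
      unfolding left_diff_distrib by (rule Bochner_Integration.integral_diff[symmetric, OF fint sums(1)])
    also have "cmod \<dots> \<le> C * D * K N"
    proof (rule K_bound)
      show "integrable lborel (\<lambda>y. (f y - f (s N y)) * h y)"
        unfolding left_diff_distrib by (rule Bochner_Integration.integrable_diff[OF fint sums(1)])
    qed (rule f_diff)
    finally have 2: "cmod ((LINT y|lborel. f y * h y) - (LINT y|lborel. f (s N y) * h y)) \<le> C * D * K N" .
    show ?thesis
      using 1 2 norm_triangle_ineq4[of "u (convolve g h) - (LINT y|lborel. f (s N y) * h y)"
          "(LINT y|lborel. f y * h y) - (LINT y|lborel. f (s N y) * h y)"] by simp
  qed
  have "(\<lambda>N. 2 * (C * D) * K N) \<longlonglongrightarrow> 0" using tendsto_mult_right_zero[OF K_lim] by simp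
  then have "cmod (u (convolve g h) - (LINT y|lborel. f y * h y)) \<le> 0"
    using main by (intro LIMSEQ_le_const) auto
  then show "u (convolve g h) = (LINT y|lborel. u (\<lambda>x. g (x - y)) * h y)"
    by (simp add: f_def)
qed

section \<open>Integer powers of the dilation\<close>

lemma matrix_inv_mult:
  assumes "invertible (A::real^'d^'d)"
  shows "A ** matrix_inv A = mat 1" "matrix_inv A ** A = mat 1"
proof -
  have "\<exists>A'. A ** A' = mat 1 \<and> A' ** A = mat 1"
    using assms by (simp add: invertible_def)
  then have "A ** matrix_inv A = mat 1 \<and> matrix_inv A ** A = mat 1"
    unfolding matrix_inv_def by (rule someI_ex)
  then show "A ** matrix_inv A = mat 1" "matrix_inv A ** A = mat 1" by auto
qed

lemma mat_powi_0 [simp]: "mat_powi A 0 = mat 1"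
  by (simp add: mat_powi_def)

lemma mat_powi_succ:
  assumes "invertible (A::real^'d^'d)"
  shows "mat_powi A (k + 1) = A ** mat_powi A k"
proof (cases "0 \<le> k")
  case True
  then have "nat (k + 1) = Suc (nat k)" by simp
  with True show ?thesis by (simp add: mat_powi_def)
next
  case False
  then have "nat (- k) = Suc (nat (- (k + 1)))" by simp
  then have "A ** mat_powi A k = (A ** matrix_inv A) ** (((**) (matrix_inv A)) ^^ nat (- (k + 1))) (mat 1)"
    using False by (simp add: mat_powi_def matrix_mul_assoc)
  also have "\<dots> = mat_powi A (k + 1)"
    using False by (cases "k = -1") (auto simp: mat_powi_def matrix_inv_mult[OF assms])
  finally show ?thesis by simp
qed

lemma mat_powi_pred:
  assumes "invertible (A::real^'d^'d)"
  shows "mat_powi A (k - 1) = matrix_inv A ** mat_powi A k"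
  using mat_powi_succ[OF assms, of "k - 1"]
  by (simp add: matrix_mul_assoc matrix_inv_mult[OF assms])

lemma mat_powi_add:
  assumes "invertible (A::real^'d^'d)"
  shows "mat_powi A (k + l) = mat_powi A k ** mat_powi A l"
proof (induction k rule: int_induct[where k = 0])
  case (step1 i)
  then show ?case using mat_powi_succ[OF assms, of "i + l"] mat_powi_succ[OF assms, of i]
    by (simp add: matrix_mul_assoc add_ac)
next
  case (step2 i)
  then show ?case using mat_powi_pred[OF assms, of "i + l"] mat_powi_pred[OF assms, of i]
    by (simp add: matrix_mul_assoc algebra_simps)
qed simp

lemma mat_powi_minus_cancel:
  assumes "invertible (A::real^'d^'d)"
  shows "mat_powi A (- k) ** mat_powi A k = mat 1" "mat_powi A k ** mat_powi A (- k) = mat 1"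
    "mat_powi A (- k) *v (mat_powi A k *v x) = x" "mat_powi A k *v (mat_powi A (- k) *v x) = x"
proof -
  show 1: "mat_powi A (- k) ** mat_powi A k = mat 1" "mat_powi A k ** mat_powi A (- k) = mat 1"
    using mat_powi_add[OF assms, of "-k" k] mat_powi_add[OF assms, of k "-k"] by simp_all
  show "mat_powi A (- k) *v (mat_powi A k *v x) = x" "mat_powi A k *v (mat_powi A (- k) *v x) = x"
    by (simp_all add: matrix_vector_mul_assoc 1)
qed

lemma invertible_mat_powi: "invertible (A::real^'d^'d) \<Longrightarrow> invertible (mat_powi A k)"
  unfolding invertible_def[of "mat_powi A k"] using mat_powi_minus_cancel[of A k] by blast

lemma det_matrix_inv:
  assumes "invertible (A::real^'d^'d)"
  shows "det (matrix_inv A) = inverse (det A)"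
  using det_mul[of A "matrix_inv A"] matrix_inv_mult(1)[OF assms]
  by (metis det_I inverse_unique)

lemma det_mat_powi:
  assumes "invertible (A::real^'d^'d)"
  shows "det (mat_powi A k) = det A powi k"
proof (induction k rule: int_induct[where k = 0])
  case (step1 i)
  have "det A \<noteq> 0" using assms by (simp add: invertible_det_nz)
  with step1 show ?case by (simp add: mat_powi_succ[OF assms] det_mul power_int_add)
next
  case (step2 i)
  have "det A \<noteq> 0" using assms by (simp add: invertible_det_nz)
  with step2 show ?case
    by (simp add: mat_powi_pred[OF assms] det_mul power_int_diff det_matrix_inv[OF assms] field_simps)
qed simp

lemma transpose_matrix_inv:
  assumes "invertible (A::real^'d^'d)"
  shows "matrix_inv (transpose A) = transpose (matrix_inv A)"
proof -
  have "transpose (matrix_inv A) ** transpose A = mat 1"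
    by (simp add: matrix_inv_mult[OF assms] transpose_mat flip: matrix_transpose_mul)
  then show ?thesis
    using matrix_inv_mult(1)[OF transpose_invertible[OF assms]]
    by (metis matrix_mul_assoc matrix_mul_lid matrix_mul_rid)
qed

lemma transpose_mat_powi:
  assumes "invertible (A::real^'d^'d)"
  shows "mat_powi (transpose A) k = transpose (mat_powi A k)"
proof -
  have A': "invertible (transpose A)" using assms by (simp add: transpose_invertible)
  have comm: "mat_powi A i ** A = A ** mat_powi A i" "mat_powi A i ** matrix_inv A = matrix_inv A ** mat_powi A i" for i
    using mat_powi_add[OF assms, of i 1] mat_powi_add[OF assms, of i "-1"]
      mat_powi_succ[OF assms, of i] mat_powi_pred[OF assms, of i] mat_powi_succ[OF assms, of 0]
      mat_powi_pred[OF assms, of 0] by simp_all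
  show ?thesis
  proof (induction k rule: int_induct[where k = 0])
    case (step1 i)
    then show ?case
      using comm(1)[of i] by (simp add: mat_powi_succ A' assms flip: matrix_transpose_mul)
  next
    case (step2 i)
    then show ?case
      using comm(2)[of i]
      by (simp add: mat_powi_pred A' assms transpose_matrix_inv flip: matrix_transpose_mul)
  qed (simp add: transpose_mat)
qed

section \<open>Linear change of variables\<close>

text \<open>Both sides are multiplicative in \<open>M\<close>, and every matrix is a product of matrices with a zero row,
  diagonal matrices, transpositions and shears. For a shear, a translation of the box, under which
  its image is translated too, makes the coordinate that is added nonnegative, as
  \<open>measure_shear_interval\<close> requires.\<close>

theorem measure_matrix_image:
  fixes M :: "real^'d^'d"
  assumes "S \<in> lmeasurable"
  shows "(*v) M ` S \<in> lmeasurable \<and> measure lebesgue ((*v) M ` S) = \<bar>det M\<bar> * measure lebesgue S"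
proof -
  have box: "\<forall>S\<in>lmeasurable. (*v) A ` S \<in> lmeasurable \<and> measure lebesgue ((*v) A ` S) = \<bar>det A\<bar> * measure lebesgue S"
    if "\<And>a b. measure lebesgue ((*v) A ` cbox a b) = measure lebesgue (cbox a b)" "\<bar>det A\<bar> = 1" for A :: "real^'d^'d"
  proof
    fix S :: "(real^'d) set" assume S: "S \<in> lmeasurable"
    have "measure lebesgue ((*v) A ` cbox a b) = 1 * measure lebesgue (cbox a b)" for a b
      using that(1)[of a b] by simp
    from measure_linear_sufficient[OF matrix_vector_mul_linear S this]
    show "(*v) A ` S \<in> lmeasurable \<and> measure lebesgue ((*v) A ` S) = \<bar>det A\<bar> * measure lebesgue S"
      unfolding that(2) by simp
  qed
  have "\<forall>S\<in>lmeasurable. (*v) M ` S \<in> lmeasurable \<and> measure lebesgue ((*v) M ` S) = \<bar>det M\<bar> * measure lebesgue S"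
  proof (induction M rule: induct_matrix_elementary_alt)
    case (1 A B)
    have "(*v) (A ** B) ` S = (*v) A ` (*v) B ` S" for S
      by (simp add: image_image matrix_vector_mul_assoc)
    with 1 show ?case by (simp add: det_mul abs_mult)
  next
    case (2 A i)
    then have "det A = 0" by (rule det_zero_row)
    then have "\<not> inj ((*v) A)" 
      using det_nz_iff_inj[OF matrix_vector_mul_linear[of A]] by simp
    then have "negligible ((*v) A ` S)" for S
      by (intro negligible_linear_singular_image) auto
    from negligible_imp_measurable[OF this] negligible_imp_measure0[OF this] show ?case
      using \<open>det A = 0\<close> by simp
  next
    case (3 A)
    have "(\<Sum>j\<in>UNIV. A $ i $ j * x $ j) = (\<Sum>j\<in>UNIV. if j = i then A $ i $ i * x $ i else 0)" for i and x :: "real^'d"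
      by (rule sum.cong) (use 3 in auto)
    then have "(*v) A = (\<lambda>x. \<chi> i. A $ i $ i * x $ i)"
      by (simp add: fun_eq_iff matrix_vector_mult_def)
    then show ?case
      using measurable_stretch[of _ "\<lambda>i. A $ i $ i"] measure_stretch[of _ "\<lambda>i. A $ i $ i"] det_diagonal[of A] 3
      by simp
  next
    case (4 m n)
    let ?t = "Transposition.transpose m n"
    let ?A = "(\<chi> i j. mat 1 $ i $ ?t j) :: real^'d^'d"
    let ?h = "\<lambda>x::real^'d. \<chi> i. x $ ?t i"
    have "(\<Sum>j\<in>UNIV. mat 1 $ i $ ?t j * x $ j) = (\<Sum>j\<in>UNIV. if j = ?t i then x $ j else 0)" for i and x :: "real^'d"
    proof (rule sum.cong)
      fix j
      have "(i = ?t j) = (j = ?t i)" by (metis transpose_involutory)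
      then show "mat 1 $ i $ ?t j * x $ j = (if j = ?t i then x $ j else 0)"
        unfolding mat_def by simp
    qed simp
    then have A: "(*v) ?A = ?h"
      by (simp add: fun_eq_iff matrix_vector_mult_def)
    show ?case
    proof (rule box)
      fix a b :: "real^'d"
      have inv: "?h (?h x) = x" for x by (simp add: vec_eq_iff)
      have mem: "?h x \<in> cbox (?h a) (?h b)" if "x \<in> cbox a b" for x a b :: "real^'d"
        using that by (auto simp: mem_box_cart)
      have eq: "?h ` cbox a b = cbox (?h a) (?h b)"
      proof safe
        fix y assume "y \<in> cbox (?h a) (?h b)"
        then show "y \<in> ?h ` cbox a b"
          using mem[of y "?h a" "?h b"] inv by (metis image_eqI)
      qed (rule mem)
      show "measure lebesgue ((*v) ?A ` cbox a b) = measure lebesgue (cbox a b)"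
      proof (cases "cbox a b = {}")
        case False
        then have "cbox (?h a) (?h b) \<noteq> {}" unfolding eq[symmetric] by simp
        then have "measure lebesgue (cbox (?h a) (?h b)) = (\<Prod>i\<in>UNIV. b $ ?t i - a $ ?t i)"
          by (simp add: content_cbox_cart)
        also have "\<dots> = (\<Prod>i\<in>UNIV. b $ i - a $ i)"
          by (rule prod.reindex_bij_betw) simp
        finally show ?thesis using False by (simp add: A eq content_cbox_cart)
      qed simp
      show "\<bar>det ?A\<bar> = 1"
        by (simp add: det_permute_columns permutes_swap_id sign_swap_id abs_mult)
    qed
  next
    case (5 m n)
    let ?A = "(\<chi> i j. of_bool (i = m \<and> j = n \<or> i = j)) :: real^'d^'d"
    let ?h = "\<lambda>x::real^'d. \<chi> i. if i = m then x $ m + x $ n else x $ i"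
    have "(\<Sum>j\<in>UNIV. of_bool (i = m \<and> j = n \<or> i = j) * x $ j) =
        (\<Sum>j\<in>UNIV. (if j = i then x $ j else 0) + (if j = n then if i = m then x $ n else 0 else 0))"
      for i and x :: "real^'d" by (rule sum.cong) (use 5 in auto)
    then have A: "(*v) ?A = ?h"
      by (simp add: fun_eq_iff matrix_vector_mult_def sum.distrib vec_eq_iff)
    show ?case
    proof (rule box)
      fix a b :: "real^'d"
      define w where "w = axis n (a $ n)"
      have ab: "cbox a b = (+) w ` cbox (a - w) (b - w)"
        by (simp flip: cbox_translation)
      have "(*v) ?A ` cbox a b = (+) (?A *v w) ` ((*v) ?A ` cbox (a - w) (b - w))"
        unfolding ab by (simp add: image_image matrix_vector_right_distrib)
      then have "measure lebesgue ((*v) ?A ` cbox a b) = measure lebesgue ((*v) ?A ` cbox (a - w) (b - w))"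
        by (simp add: measure_translation)
      also have "\<dots> = measure lebesgue (cbox (a - w) (b - w))"
      proof (cases "cbox (a - w) (b - w) = {}")
        case False
        have "0 \<le> (a - w) $ n" by (simp add: w_def)
        from measure_shear_interval[OF \<open>m \<noteq> n\<close> False this] show ?thesis unfolding A .
      qed simp
      also have "\<dots> = measure lebesgue (cbox a b)" unfolding ab by (rule measure_translation[symmetric])
      finally show "measure lebesgue ((*v) ?A ` cbox a b) = measure lebesgue (cbox a b)" .
      have "?A = (\<chi> k. if k = m then row m (mat 1) + 1 *s row n (mat 1) else row k (mat 1))"
        using 5 by (auto simp: vec_eq_iff row_def mat_def)
      then have "det ?A = 1"
        using det_row_operation[OF 5, of "mat 1" 1] by simp
      then show "\<bar>det ?A\<bar> = 1" by simp
    qed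
  qed
  with assms show ?thesis by blast
qed

lemma borel_measurable_matrix_vector [measurable]: "(*v) (M::real^'d^'e) \<in> borel_measurable borel"
  by (intro borel_measurable_continuous_onI linear_continuous_on matrix_vector_mul_bounded_linear)

lemma lborel_linear:
  fixes M :: "real^'d^'d"
  assumes M: "invertible M"
  shows "lborel = density (distr lborel borel ((*v) M)) (\<lambda>_. ennreal \<bar>det M\<bar>)"
proof (rule lborel_eqI)
  fix l u :: "real^'d" assume le: "\<And>b. b \<in> Basis \<Longrightarrow> l \<bullet> b \<le> u \<bullet> b"
  define N where "N = matrix_inv M"
  note N = matrix_inv_mult[OF M, folded N_def]
  have eq: "(*v) M -` box l u = (*v) N ` box l u"
  proof safe
    fix x assume "M *v x \<in> box l u"
    then show "x \<in> (*v) N ` box l u"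
      by (intro image_eqI[of _ _ "M *v x"]) (auto simp: matrix_vector_mul_assoc N)
  qed (auto simp: matrix_vector_mul_assoc N)
  have meas: "(*v) N ` box l u \<in> lmeasurable" "measure lebesgue ((*v) N ` box l u) = \<bar>det N\<bar> * measure lebesgue (box l u)"
    using measure_matrix_image[of "box l u" N] by auto
  have sb: "(*v) M -` box l u \<in> sets borel"
    using measurable_sets[OF borel_measurable_matrix_vector, of "box l u" M] by simp
  have "emeasure lborel ((*v) M -` box l u) = emeasure lebesgue ((*v) M -` box l u)"
    using sb by simp
  also have "\<dots> = ennreal (\<bar>det N\<bar> * measure lebesgue (box l u))"
    unfolding eq by (metis emeasure_eq_measure2 meas)
  finally have "emeasure lborel ((*v) M -` box l u) = ennreal (\<bar>det N\<bar> * measure lebesgue (box l u))" .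
  then have "emeasure (density (distr lborel borel ((*v) M)) (\<lambda>_. ennreal \<bar>det M\<bar>)) (box l u) =
      ennreal \<bar>det M\<bar> * ennreal (\<bar>det N\<bar> * measure lebesgue (box l u))"
    by (simp add: emeasure_density nn_integral_cmult_indicator emeasure_distr)
  also have "\<dots> = ennreal ((\<bar>det M\<bar> * \<bar>det N\<bar>) * measure lebesgue (box l u))"
    by (simp add: ennreal_mult mult.assoc)
  also have "\<bar>det M\<bar> * \<bar>det N\<bar> = 1"
    by (simp add: N(1) flip: abs_mult det_mul)
  also have "ennreal (1 * measure lebesgue (box l u)) = ennreal (\<Prod>b\<in>Basis. (u - l) \<bullet> b)"
    using le by (simp add: measure_lborel_box_eq)
  finally show "emeasure (density (distr lborel borel ((*v) M)) (\<lambda>_. ennreal \<bar>det M\<bar>)) (box l u) =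
      ennreal (\<Prod>b\<in>Basis. (u - l) \<bullet> b)" .
qed simp

lemma integral_linear:
  fixes M :: "real^'d^'d" and f :: "real^'d \<Rightarrow> complex"
  assumes M: "invertible M" and [measurable]: "f \<in> borel_measurable borel"
  shows "(LINT x|lborel. f x) = complex_of_real \<bar>det M\<bar> * (LINT x|lborel. f (M *v x))"
  by (subst lborel_linear[OF M]) (simp add: integral_density integral_distr scaleR_conv_of_real)

lemma lborel_translate: "distr lborel borel (\<lambda>x. x - a) = (lborel :: 'a::euclidean_space measure)"
proof -
  have "(\<lambda>x. x - a) = (+) (- a)" by (simp add: fun_eq_iff)
  then show ?thesis using lborel_distr_plus[of "- a"] by metis
qed

lemma integral_translate:
  fixes f :: "real^'d \<Rightarrow> 'b::{banach,second_countable_topology}"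
  assumes [measurable]: "f \<in> borel_measurable borel"
  shows "(LINT x|lborel. f (x - a)) = (LINT x|lborel. f x)"
  by (subst (2) lborel_translate[of a, symmetric]) (simp add: integral_distr)

lemma integrable_translate:
  fixes f :: "real^'d \<Rightarrow> 'b::{banach,second_countable_topology}"
  assumes [measurable]: "f \<in> borel_measurable borel" and "integrable lborel f"
  shows "integrable lborel (\<lambda>x. f (x - a))"
  using assms(2) by (subst (asm) lborel_translate[of a, symmetric]) (simp add: integrable_distr_eq)

lemma integral_affine:
  fixes f :: "real^'d \<Rightarrow> complex"
  assumes "c > 0" and [measurable]: "f \<in> borel_measurable borel"
  shows "(LINT x|lborel. f x) = complex_of_real (c ^ DIM(real^'d)) * (LINT z|lborel. f (a + c *\<^sub>R z))"
  using assms(1)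
  by (subst lborel_affine[of c a]) (simp_all add: integral_density integral_distr,
    simp add: scaleR_conv_of_real[where 'a = complex])

section \<open>The Fourier transform\<close>

abbreviation character :: "real^'d \<Rightarrow> real^'d \<Rightarrow> complex" where
  "character \<xi> x \<equiv> exp (- (\<i> * complex_of_real (x \<bullet> \<xi>)))"

lemma norm_character [simp]: "cmod (character \<xi> x) = 1"
  by simp

lemma fourier_lborel:
  assumes [measurable]: "g \<in> borel_measurable borel"
  shows "fourier g \<xi> = (LINT x|lborel. g x * character \<xi> x)"
  unfolding fourier_def by (rule integral_completion) measurable

lemma integrable_mult_unimodular:
  fixes f k :: "'a \<Rightarrow> complex"
  assumes "integrable M f" "k \<in> borel_measurable M" "\<And>x. cmod (k x) = 1"
  shows "integrable M (\<lambda>x. f x * k x)"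
  by (rule Bochner_Integration.integrable_bound[OF assms(1)])
    (use assms in \<open>auto simp: norm_mult\<close>)

lemma fourier_cnj:
  assumes [measurable]: "g \<in> borel_measurable borel"
  shows "fourier (\<lambda>x. cnj (g x)) \<xi> = cnj (fourier g (- \<xi>))"
proof -
  have m: "(\<lambda>x. cnj (g x)) \<in> borel_measurable borel"
    by (rule measurable_compose[OF assms borel_measurable_continuous_onI[OF continuous_on_cnj[OF continuous_on_id]]])
  have "fourier (\<lambda>x. cnj (g x)) \<xi> = (LINT x|lborel. cnj (g x * character (- \<xi>) x))"
    unfolding fourier_lborel[OF m] by (rule Bochner_Integration.integral_cong) (auto simp: exp_cnj)
  also have "\<dots> = cnj (fourier g (- \<xi>))"
    unfolding fourier_lborel[OF assms] by (rule Bochner_Integration.integral_cnj)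
  finally show ?thesis .
qed

lemma fourier_reflect:
  assumes [measurable]: "g \<in> borel_measurable borel"
  shows "fourier (\<lambda>x. g (- x)) \<xi> = fourier g (- \<xi>)"
proof -
  have "(LINT x|lborel. g x * character (- \<xi>) x) =
      (LINT x|distr lborel borel uminus. g x * character (- \<xi>) x)"
    using lborel_affine[of "-1" "0::real^'a"] by (simp add: density_1 fun_Compl_def one_ennreal_def[symmetric])
  also have "\<dots> = (LINT x|lborel. g (- x) * character \<xi> x)"
    by (subst integral_distr) auto
  finally show ?thesis by (simp add: fourier_lborel)
qed

lemma fourier_convolve:
  fixes g h :: "real^'d \<Rightarrow> complex"
  assumes g: "rapidly_decreasing g" and h: "rapidly_decreasing h"
    and [measurable]: "g \<in> borel_measurable borel" "h \<in> borel_measurable borel"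
  shows "fourier (convolve g h) \<xi> = fourier g \<xi> * fourier h \<xi>"
proof -
  have gi: "integrable lborel g" and hi: "integrable lborel h"
    by (intro integrable_rapidly_decreasing g h; measurable)+
  define F where "F y x = g (x - y) * h y * character \<xi> x" for y x
  have Fm[measurable]: "case_prod F \<in> borel_measurable (lborel \<Otimes>\<^sub>M lborel)"
    unfolding F_def by measurable
  have Fint: "integrable lborel (F y)" for y
    unfolding F_def using integrable_translate[OF _ gi, of y]
    by (intro integrable_mult_unimodular integrable_mult_left) auto
  have "integrable (lborel \<Otimes>\<^sub>M lborel) (case_prod F)"
  proof (rule lborel_pair.Fubini_integrable[OF Fm])
    have "(LINT x|lborel. norm (F y x)) = (LINT x|lborel. cmod (g x)) * cmod (h y)" for y
    proof -
      have "(LINT x|lborel. norm (F y x)) = (LINT x|lborel. cmod (g (x - y)) * cmod (h y))"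
        by (simp add: F_def norm_mult)
      also have "\<dots> = (LINT x|lborel. cmod (g (x - y))) * cmod (h y)" by simp
      also have "(LINT x|lborel. cmod (g (x - y))) = (LINT x|lborel. cmod (g x))"
        by (rule integral_translate[where f = "\<lambda>x. cmod (g x)"]) measurable
      finally show ?thesis .
    qed
    then show "integrable lborel (\<lambda>y. LINT x|lborel. norm (case (y, x) of (y, x) \<Rightarrow> F y x))"
      using hi by simp
  qed (use Fint in auto)
  from lborel_pair.Fubini_integral[OF this]
  have swap: "(LINT x|lborel. (LINT y|lborel. F y x)) = (LINT y|lborel. (LINT x|lborel. F y x))"
    by simp
  have cm: "convolve g h \<in> borel_measurable borel"
    unfolding convolve_def[abs_def] by measurable
  have "fourier (convolve g h) \<xi> = (LINT x|lborel. (LINT y|lborel. F y x))"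
    unfolding fourier_lborel[OF cm] F_def convolve_def by simp
  also note swap
  also have "(LINT y|lborel. (LINT x|lborel. F y x)) = (LINT y|lborel. fourier g \<xi> * (h y * character \<xi> y))"
  proof (intro Bochner_Integration.integral_cong refl)
    fix y
    show "(LINT x|lborel. F y x) = fourier g \<xi> * (h y * character \<xi> y)"
  proof -
    have "(LINT x|lborel. F y x) = (LINT x|lborel. (g (x - y) * character \<xi> (x - y)) * (h y * character \<xi> y))"
      unfolding F_def by (rule Bochner_Integration.integral_cong)
        (auto simp: inner_diff_left algebra_simps simp flip: exp_add)
    also have "\<dots> = (LINT x|lborel. g (x - y) * character \<xi> (x - y)) * (h y * character \<xi> y)"
      by simp
    also have "(LINT x|lborel. g (x - y) * character \<xi> (x - y)) = fourier g \<xi>"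
      unfolding fourier_lborel[OF assms(3)]
      by (rule integral_translate[where f = "\<lambda>x. g x * character \<xi> x"]) measurable
    finally show ?thesis .
  qed
  qed
  also have "(LINT y|lborel. fourier g \<xi> * (h y * character \<xi> y)) = fourier g \<xi> * fourier h \<xi>"
    unfolding fourier_lborel[OF assms(4)] by simp
  finally show ?thesis .
qed

subsection \<open>Injectivity\<close>

definition gaussian :: "'a::euclidean_space \<Rightarrow> real" where
  "gaussian x = (\<Prod>b\<in>Basis. std_normal_density (x \<bullet> b))"

lemma gaussian_eq: "gaussian x = (1 / sqrt (2 * pi)) ^ DIM('a) * exp (- (norm x)\<^sup>2 / 2)" for x :: "'a::euclidean_space"
proof -
  have "gaussian x = (\<Prod>b\<in>Basis. (1 / sqrt (2 * pi)) * exp (- (x \<bullet> b)\<^sup>2 / 2))"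
    unfolding gaussian_def by (simp add: normal_density_def)
  also have "\<dots> = (1 / sqrt (2 * pi)) ^ DIM('a) * exp (\<Sum>b\<in>Basis. - (x \<bullet> b)\<^sup>2 / 2)"
    by (subst prod.distrib) (simp add: exp_sum)
  also have "(\<Sum>b\<in>Basis. - (x \<bullet> b)\<^sup>2 / 2) = - (norm x)\<^sup>2 / 2"
    unfolding power2_norm_eq_inner[of x] euclidean_inner[of x x]
    by (simp add: sum_negf power2_eq_square flip: sum_divide_distrib)
  finally show ?thesis .
qed

lemma std_normal_char:
  "integrable lborel (\<lambda>t. complex_of_real (std_normal_density t) * exp (\<i> * complex_of_real (s * t)))"
  "(LINT t|lborel. complex_of_real (std_normal_density t) * exp (\<i> * complex_of_real (s * t))) =
    complex_of_real (exp (- s\<^sup>2 / 2))"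
proof -
  have "integrable lborel std_normal_density" by simp
  then have "integrable lborel (\<lambda>t. complex_of_real (std_normal_density t))" by simp
  then show "integrable lborel (\<lambda>t. complex_of_real (std_normal_density t) * exp (\<i> * complex_of_real (s * t)))"
    by (rule integrable_mult_unimodular) auto
  have "char std_normal_distribution s = (LINT t|lborel. std_normal_density t *\<^sub>R iexp (s * t))"
    unfolding char_def by (rule integral_density) auto
  then show "(LINT t|lborel. complex_of_real (std_normal_density t) * exp (\<i> * complex_of_real (s * t))) =
    complex_of_real (exp (- s\<^sup>2 / 2))"
    by (simp add: char_std_normal_distribution scaleR_conv_of_real)
qed

text \<open>The Gaussian is a product over the coordinates and Lebesgue measure is a product measure, so the
  integral is a product of characteristic functions of the standard normal distribution.\<close>

lemma gaussian_fourier: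
  fixes x :: "'a::euclidean_space"
  shows "integrable lborel (\<lambda>\<xi>::'a. complex_of_real (gaussian \<xi>) * exp (\<i> * complex_of_real (x \<bullet> \<xi>)))"
    and "(LINT \<xi>::'a|lborel. complex_of_real (gaussian \<xi>) * exp (\<i> * complex_of_real (x \<bullet> \<xi>))) =
      complex_of_real (exp (- (norm x)\<^sup>2 / 2))"
proof -
  interpret product_sigma_finite "\<lambda>_::'a. lborel :: real measure" by standard
  let ?f = "\<lambda>b t. complex_of_real (std_normal_density t) * exp (\<i> * complex_of_real ((x \<bullet> b) * t))"
  let ?P = "\<Pi>\<^sub>M b\<in>(Basis::'a set). (lborel :: real measure)"
  let ?T = "\<lambda>f. \<Sum>b\<in>(Basis::'a set). f b *\<^sub>R b"
  have eq: "complex_of_real (gaussian (?T f)) * exp (\<i> * complex_of_real (x \<bullet> ?T f)) = (\<Prod>b\<in>Basis. ?f b (f b))" for f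
    by (simp add: gaussian_def inner_sum_left inner_sum_right inner_Basis if_distrib sum.delta
        prod.distrib of_real_sum sum_distrib_left exp_sum mult_ac cong: if_cong)
  have T: "?T \<in> ?P \<rightarrow>\<^sub>M borel" by measurable
  have m: "(\<lambda>\<xi>::'a. complex_of_real (gaussian \<xi>) * exp (\<i> * complex_of_real (x \<bullet> \<xi>))) \<in> borel_measurable borel"
    unfolding gaussian_def by measurable
  have "integrable ?P (\<lambda>f. \<Prod>b\<in>Basis. ?f b (f b))"
    by (rule product_integrable_prod) (auto simp only: finite_Basis std_normal_char)
  then show "integrable lborel (\<lambda>\<xi>::'a. complex_of_real (gaussian \<xi>) * exp (\<i> * complex_of_real (x \<bullet> \<xi>)))"
    by (subst lborel_eq, subst integrable_distr_eq[OF T m]) (simp add: eq)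
  have "(LINT \<xi>::'a|lborel. complex_of_real (gaussian \<xi>) * exp (\<i> * complex_of_real (x \<bullet> \<xi>))) =
      (LINT f|?P. (\<Prod>b\<in>Basis. ?f b (f b)))"
    by (subst lborel_eq, subst integral_distr[OF T m]) (simp add: eq)
  also have "\<dots> = (\<Prod>b\<in>Basis. (LINT t|lborel. ?f b t))"
    by (rule product_integral_prod) (auto simp only: finite_Basis std_normal_char)
  also have "\<dots> = (\<Prod>b\<in>Basis. complex_of_real (exp (- (x \<bullet> b)\<^sup>2 / 2)))"
    by (simp only: std_normal_char)
  also have "\<dots> = complex_of_real (exp (\<Sum>b\<in>Basis. - (x \<bullet> b)\<^sup>2 / 2))"
    by (simp add: exp_sum)
  also have "(\<Sum>b\<in>Basis. - (x \<bullet> b)\<^sup>2 / 2) = - (norm x)\<^sup>2 / 2"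
    unfolding power2_norm_eq_inner[of x] euclidean_inner[of x x]
    by (simp add: sum_negf power2_eq_square flip: sum_divide_distrib)
  finally show "(LINT \<xi>::'a|lborel. complex_of_real (gaussian \<xi>) * exp (\<i> * complex_of_real (x \<bullet> \<xi>))) =
      complex_of_real (exp (- (norm x)\<^sup>2 / 2))" .
qed

lemma gaussian_integral:
  "integrable lborel (gaussian :: 'a::euclidean_space \<Rightarrow> real)" "(LINT x|lborel. gaussian (x::'a)) = 1"
proof -
  have 1: "integrable lborel (\<lambda>x. complex_of_real (gaussian (x::'a)))"
    using gaussian_fourier(1)[of "0::'a"] by simp
  then show "integrable lborel (gaussian :: 'a \<Rightarrow> real)"
    by (simp add: complex_of_real_integrable_eq)
  have "complex_of_real (LINT x|lborel. gaussian (x::'a)) = 1"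
    using gaussian_fourier(2)[of "0::'a"] by simp
  then show "(LINT x|lborel. gaussian (x::'a)) = 1" by (simp add: of_real_eq_1_iff)
qed

lemma gaussian_borel[measurable]: "(gaussian :: 'a::euclidean_space \<Rightarrow> real) \<in> borel_measurable borel"
  unfolding gaussian_def[abs_def] by measurable

lemma gaussian_nonneg: "0 \<le> gaussian x"
  by (simp add: gaussian_def prod_nonneg)

text \<open>A Gaussian of width \<open>e\<close> centred at \<open>a\<close> is a superposition of characters. By Fubini's theorem the
  average of \<open>w\<close> against it is an integral of the Fourier transform of \<open>w\<close>.\<close>

lemma gaussian_average_zero:
  fixes w :: "real^'d \<Rightarrow> complex"
  assumes w: "integrable lborel w" and [measurable]: "w \<in> borel_measurable borel"
    and zero: "\<And>\<xi>. fourier w \<xi> = 0" and e: "e > 0"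
  shows "(LINT z|lborel. w (a + e *\<^sub>R z) * complex_of_real (gaussian z)) = 0"
proof -
  define F where "F x \<xi> = w x * complex_of_real (gaussian \<xi>) * exp (\<i> * complex_of_real (((1/e) *\<^sub>R (a - x)) \<bullet> \<xi>))"
    for x \<xi> :: "real^'d"
  have Fm[measurable]: "case_prod F \<in> borel_measurable (lborel \<Otimes>\<^sub>M lborel)"
    unfolding F_def by measurable
  have gi: "integrable lborel (\<lambda>\<xi>::real^'d. complex_of_real (gaussian \<xi>))"
    using gaussian_integral(1)[where 'a = "real^'d"] by (rule integrable_of_real)
  have "integrable (lborel \<Otimes>\<^sub>M lborel) (case_prod F)"
  proof (rule lborel_pair.Fubini_integrable[OF Fm])
    have "(LINT \<xi>|lborel. norm (F x \<xi>)) = cmod (w x)" for x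
      by (simp add: F_def norm_mult gaussian_nonneg gaussian_integral)
    then show "integrable lborel (\<lambda>x. LINT \<xi>|lborel. norm (case (x, \<xi>) of (x, \<xi>) \<Rightarrow> F x \<xi>))"
      using w by simp
    have "integrable lborel (F x)" for x
      unfolding F_def by (intro integrable_mult_unimodular integrable_mult_right gi) auto
    then show "AE x in lborel. integrable lborel (\<lambda>\<xi>. case (x, \<xi>) of (x, \<xi>) \<Rightarrow> F x \<xi>)" by auto
  qed
  from lborel_pair.Fubini_integral[OF this]
  have swap: "(LINT \<xi>|lborel. (LINT x|lborel. F x \<xi>)) = (LINT x|lborel. (LINT \<xi>|lborel. F x \<xi>))"
    by simp
  have "(LINT x|lborel. F x \<xi>) = 0" for \<xi>
  proof -
    have "F x \<xi> = (w x * character ((1/e) *\<^sub>R \<xi>) x) *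
        (complex_of_real (gaussian \<xi>) * exp (\<i> * complex_of_real (((1/e) *\<^sub>R a) \<bullet> \<xi>)))" for x
    proof -
      have "exp (\<i> * complex_of_real (((1/e) *\<^sub>R (a - x)) \<bullet> \<xi>)) =
          character ((1/e) *\<^sub>R \<xi>) x * exp (\<i> * complex_of_real (((1/e) *\<^sub>R a) \<bullet> \<xi>))"
        by (simp add: inner_diff_left algebra_simps diff_divide_distrib flip: exp_add)
      then show ?thesis by (simp add: F_def)
    qed
    then have "(LINT x|lborel. F x \<xi>) = fourier w ((1/e) *\<^sub>R \<xi>) *
        (complex_of_real (gaussian \<xi>) * exp (\<i> * complex_of_real (((1/e) *\<^sub>R a) \<bullet> \<xi>)))"
      by (simp add: fourier_lborel)
    then show ?thesis by (simp add: zero)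
  qed
  then have "(LINT x|lborel. (LINT \<xi>|lborel. F x \<xi>)) = 0" using swap by simp
  moreover have "(LINT \<xi>|lborel. F x \<xi>) = w x * complex_of_real (exp (- (norm ((1/e) *\<^sub>R (a - x)))\<^sup>2 / 2))" for x
    unfolding F_def mult.assoc
    by (subst integral_mult_right_zero) (simp only: gaussian_fourier(2))
  ultimately have "0 = (LINT x|lborel. w x * complex_of_real (exp (- (norm ((1/e) *\<^sub>R (a - x)))\<^sup>2 / 2)))"
    by simp
  also have "\<dots> = complex_of_real (e ^ DIM(real^'d)) *
      (LINT z|lborel. w (a + e *\<^sub>R z) * complex_of_real (exp (- (norm ((1/e) *\<^sub>R (a - (a + e *\<^sub>R z))))\<^sup>2 / 2)))"
    using e by (subst integral_affine[of e _ a]) auto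
  also have "\<dots> = complex_of_real (e ^ DIM(real^'d) * sqrt (2 * pi) ^ DIM(real^'d)) *
      (LINT z|lborel. w (a + e *\<^sub>R z) * complex_of_real (gaussian z))"
  proof -
    have "exp (- (norm ((1/e) *\<^sub>R (a - (a + e *\<^sub>R z))))\<^sup>2 / 2) = sqrt (2 * pi) ^ DIM(real^'d) * gaussian z" for z :: "real^'d"
      using e by (simp add: gaussian_eq power_divide)
    then show ?thesis
      by (simp add: mult.left_commute[of "w _"] mult.assoc)
  qed
  finally show ?thesis using e by simp
qed

text \<open>The averages against Gaussians of width \<open>e\<close> vanish and tend to \<open>w a\<close> as \<open>e\<close> tends to \<open>0\<close>.\<close>

lemma fourier_injective:
  fixes w :: "real^'d \<Rightarrow> complex"
  assumes w: "rapidly_decreasing w" and cont: "continuous_on UNIV w" and zero: "\<And>\<xi>. fourier w \<xi> = 0"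
  shows "w a = 0"
proof -
  have [measurable]: "w \<in> borel_measurable borel" by (rule borel_measurable_continuous_onI[OF cont])
  have wi: "integrable lborel w" by (rule integrable_rapidly_decreasing[OF w]) measurable
  obtain C where C: "0 \<le> C" "\<And>x. cmod (w x) \<le> C"
    using rapidly_decreasing_bounded[OF w] by blast
  define e where "e n = 1 / real (Suc n)" for n
  have "(\<lambda>n. LINT z|lborel. w (a + e n *\<^sub>R z) * complex_of_real (gaussian z)) \<longlonglongrightarrow>
      (LINT z::real^'d|lborel. w a * complex_of_real (gaussian z))"
  proof (rule integral_dominated_convergence[where w = "\<lambda>z. C * gaussian z"])
    show "integrable lborel (\<lambda>z::real^'d. C * gaussian z)"
      using gaussian_integral(1)[where 'a = "real^'d"] by simp
    show "AE z in lborel. (\<lambda>n. w (a + e n *\<^sub>R z) * complex_of_real (gaussian z)) \<longlonglongrightarrow> w a * complex_of_real (gaussian z)"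
    proof (intro AE_I2 tendsto_mult_right)
      fix z
      have "e \<longlonglongrightarrow> 0" unfolding e_def using LIMSEQ_inverse_real_of_nat by (simp add: inverse_eq_divide)
      then have "(\<lambda>n. a + e n *\<^sub>R z) \<longlonglongrightarrow> a + 0 *\<^sub>R z" by (intro tendsto_intros)
      then show "(\<lambda>n. w (a + e n *\<^sub>R z)) \<longlonglongrightarrow> w a"
        using cont by (intro isCont_tendsto_compose[of a w]) (auto simp: continuous_on_eq_continuous_at)
    qed
    show "AE z in lborel. norm (w (a + e n *\<^sub>R z) * complex_of_real (gaussian z)) \<le> C * gaussian z" for n
      using C(2) by (intro AE_I2) (simp add: norm_mult gaussian_nonneg mult_right_mono)
  qed measurable
  moreover have "(LINT z|lborel. w (a + e n *\<^sub>R z) * complex_of_real (gaussian z)) = 0" for n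
    by (rule gaussian_average_zero[OF wi _ zero]) (auto simp: e_def)
  moreover have "(LINT z::real^'d|lborel. w a * complex_of_real (gaussian z)) = w a"
    using gaussian_integral(2)[where 'a = "real^'d"] by simp
  ultimately have "(\<lambda>n. 0) \<longlonglongrightarrow> w a" by (simp only:)
  then show "w a = 0" by (rule LIMSEQ_unique[OF tendsto_const, symmetric])
qed

lemma fourier_diff:
  assumes "g \<in> schwartz" "h \<in> schwartz"
  shows "fourier (\<lambda>x. g x - h x) \<xi> = fourier g \<xi> - fourier h \<xi>"
proof -
  have [measurable]: "g \<in> borel_measurable borel" "h \<in> borel_measurable borel"
    using assms by (auto intro: schwartz_borel)
  have "integrable lborel (\<lambda>x. f x * character \<xi> x)" if "f \<in> schwartz" for f
    by (intro integrable_mult_unimodular integrable_rapidly_decreasing schwartz_rapidly_decreasing schwartz_borel that)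
      auto
  then show ?thesis using assms by (simp add: fourier_lborel left_diff_distrib)
qed

lemma fourier_sum:
  assumes "finite I" "\<And>i. i \<in> I \<Longrightarrow> g i \<in> schwartz"
  shows "fourier (\<lambda>x. \<Sum>i\<in>I. g i x) \<xi> = (\<Sum>i\<in>I. fourier (g i) \<xi>)"
proof -
  have m: "g i \<in> borel_measurable borel" if "i \<in> I" for i
    using assms(2)[OF that] by (rule schwartz_borel)
  have "integrable lborel (\<lambda>x. f x * character \<xi> x)" if "f \<in> schwartz" for f
    by (intro integrable_mult_unimodular integrable_rapidly_decreasing schwartz_rapidly_decreasing schwartz_borel that)
      auto
  then have "(LINT x|lborel. (\<Sum>i\<in>I. g i x * character \<xi> x)) = (\<Sum>i\<in>I. (LINT x|lborel. g i x * character \<xi> x))"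
    using assms(2) by (intro Bochner_Integration.integral_sum) auto
  moreover have "(\<lambda>x. \<Sum>i\<in>I. g i x) \<in> borel_measurable borel" by (intro borel_measurable_sum m)
  ultimately show ?thesis by (simp add: fourier_lborel m sum_distrib_right)
qed

lemma schwartz_cnj: "g \<in> schwartz \<Longrightarrow> (\<lambda>x. cnj (g x)) \<in> schwartz"
  by (rule schwartz_bounded_linear[OF bounded_linear_cnj])

lemma schwartz_reflect: 
  fixes g :: "real^'d \<Rightarrow> complex"
  assumes "g \<in> schwartz" shows "(\<lambda>x. g (- x)) \<in> schwartz"
proof -
  have neg: "(- mat 1 :: real^'d^'d) *v x = - x" for x
  proof -
    have "(\<Sum>j\<in>UNIV. (- mat 1 :: real^'d^'d) $ i $ j * x $ j) = (\<Sum>j\<in>UNIV. if j = i then - x $ j else 0)" for i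
      by (rule sum.cong) (auto simp: mat_def)
    then show ?thesis by (simp add: matrix_vector_mult_def vec_eq_iff)
  qed
  have "(- mat 1 :: real^'d^'d) ** (- mat 1) = mat 1"
    by (rule matrix_eq[THEN iffD2]) (simp add: neg flip: matrix_vector_mul_assoc)
  then have "invertible (- mat 1 :: real^'d^'d)" unfolding invertible_def by blast
  from schwartz_affine[OF assms this, of 0] show ?thesis by (simp add: neg)
qed

lemma schwartz_dilate:
  fixes A :: "real^'d^'d"
  assumes "g \<in> schwartz" "invertible A" shows "dilate A g k \<in> schwartz"
  using schwartz_cmult[OF schwartz_affine[OF assms(1) invertible_mat_powi[OF assms(2), of k], of 0]]
  by (simp add: dilate_def[abs_def])

lemma inner_transpose: "(y::real^'d) \<bullet> (transpose N *v z) = (N *v y) \<bullet> z"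
  by (metis dot_lmul_matrix inner_commute transpose_matrix_vector)

lemma fourier_dilate:
  fixes A :: "real^'d^'d"
  assumes g: "g \<in> schwartz" and A: "invertible A"
  shows "fourier (dilate A g k) \<xi> = fourier g (mat_powi (transpose A) (- k) *v \<xi>)"
proof -
  let ?\<xi> = "mat_powi (transpose A) (- k) *v \<xi>"
  have [measurable]: "g \<in> borel_measurable borel" by (rule schwartz_borel[OF g])
  have "(mat_powi A k *v x) \<bullet> ?\<xi> = x \<bullet> \<xi>" for x
  proof -
    show ?thesis unfolding transpose_mat_powi[OF A] inner_transpose by (simp only: mat_powi_minus_cancel[OF A])
  qed
  then have "(LINT y|lborel. g y * character ?\<xi> y) =
      complex_of_real \<bar>det (mat_powi A k)\<bar> * (LINT x|lborel. g (mat_powi A k *v x) * character \<xi> x)"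
    by (subst integral_linear[OF invertible_mat_powi[OF A, of k]]) simp_all
  also have "\<dots> = (LINT x|lborel. dilate A g k x * character \<xi> x)"
    by (simp add: dilate_def det_mat_powi[OF A] power_int_abs mult.assoc)
  finally show ?thesis
    by (simp add: fourier_lborel schwartz_borel schwartz_dilate g A)
qed

section \<open>Adapted ellipsoids\<close>

text \<open>Rescaling the inclusion of \<open>r\<close> times the ellipsoid in its image under \<open>A\<close> yields preimages under \<open>A\<close>
  of arbitrary vectors, with control of their gauge \<open>norm (P *v x)\<close>. In particular \<open>A\<close> is
  surjective, hence invertible.\<close>

lemma adapted_ellipsoid_contraction:
  fixes A P :: "real^'d^'d"
  assumes "adapted_ellipsoid A P"
  obtains r where "1 < r" "invertible A" "invertible P"
    "\<And>x. norm (P *v (matrix_inv A *v x)) \<le> norm (P *v x) / r"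
proof -
  from assms obtain r where P: "invertible P" and r: "r > 1"
    and sub: "(*\<^sub>R) r ` ellipsoid P \<subseteq> (*v) A ` ellipsoid P"
    by (auto simp: adapted_ellipsoid_def)
  have P_scale: "P *v (c *\<^sub>R x) = c *\<^sub>R (P *v x)" for c x
    by (rule linear_scale[OF matrix_vector_mul_linear])
  have img: "\<exists>z. x = A *v z \<and> norm (P *v z) \<le> t" if "norm (P *v x) / r < t" for x t
  proof -
    have t: "t > 0" using that r by (smt (verit) divide_nonneg_pos norm_ge_zero)
    have "norm (P *v ((1 / (r * t)) *\<^sub>R x)) < 1"
      using that r t by (simp add: P_scale field_simps)
    then have "(1 / (r * t)) *\<^sub>R x \<in> ellipsoid P" by (simp add: ellipsoid_def)
    then have "r *\<^sub>R ((1 / (r * t)) *\<^sub>R x) \<in> (*v) A ` ellipsoid P" using sub by blast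
    then obtain z where z: "(1 / t) *\<^sub>R x = A *v z" "norm (P *v z) < 1"
      using r by (auto simp: ellipsoid_def)
    have "x = t *\<^sub>R ((1 / t) *\<^sub>R x)" using t by simp
    also have "\<dots> = A *v (t *\<^sub>R z)"
      unfolding z(1) by (rule linear_scale[OF matrix_vector_mul_linear, symmetric])
    finally have "x = A *v (t *\<^sub>R z)" .
    moreover have "norm (P *v (t *\<^sub>R z)) \<le> t"
      using z(2) t by (simp add: P_scale)
    ultimately show ?thesis by blast
  qed
  have "surj ((*v) A)"
    unfolding surj_def
  proof
    fix y
    show "\<exists>x. y = A *v x" using img[of y "norm (P *v y) / r + 1"] by auto
  qed
  then have A: "invertible A"
    using matrix_right_invertible_surjective matrix_left_right_inverse unfolding invertible_def by metis
  have "norm (P *v (matrix_inv A *v x)) \<le> norm (P *v x) / r" for x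
  proof (rule field_le_epsilon)
    fix e :: real assume "e > 0"
    then obtain z where z: "x = A *v z" "norm (P *v z) \<le> norm (P *v x) / r + e"
      using img[of x "norm (P *v x) / r + e"] by auto
    have "matrix_inv A *v x = z" by (simp add: z(1) matrix_vector_mul_assoc matrix_inv_mult[OF A])
    with z(2) show "norm (P *v (matrix_inv A *v x)) \<le> norm (P *v x) / r + e" by simp
  qed
  with r A P that show thesis by blast
qed

lemma contraction_powi:
  fixes A Q :: "real^'d^'d"
  assumes A: "invertible A" and r: "r > 0" and le: "\<And>x. norm (Q *v (matrix_inv A *v x)) \<le> norm (Q *v x) / r"
  shows "norm (Q *v (mat_powi A (- int n) *v x)) \<le> norm (Q *v x) / r ^ n"
proof (induction n)
  case (Suc n)
  have "- int (Suc n) = - int n - 1" by simp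
  then have "mat_powi A (- int (Suc n)) = matrix_inv A ** mat_powi A (- int n)"
    by (simp only: mat_powi_pred[OF A])
  then have "norm (Q *v (mat_powi A (- int (Suc n)) *v x)) = norm (Q *v (matrix_inv A *v (mat_powi A (- int n) *v x)))"
    by (simp add: matrix_vector_mul_assoc)
  also have "\<dots> \<le> norm (Q *v (mat_powi A (- int n) *v x)) / r" by (rule le)
  also have "\<dots> \<le> (norm (Q *v x) / r ^ n) / r" using Suc r by (intro divide_right_mono) auto
  finally show ?case by (simp add: mult.commute)
qed simp

text \<open>The transpose contracts the dual norm, whose unit ball is the polar of the ellipsoid.\<close>

lemma contraction_transpose:
  fixes A P :: "real^'d^'d"
  assumes A: "invertible A" and P: "invertible P" and r: "r > 0"
    and le: "\<And>x. norm (P *v (matrix_inv A *v x)) \<le> norm (P *v x) / r"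
  defines "Q \<equiv> transpose (matrix_inv P)"
  shows "norm (Q *v (matrix_inv (transpose A) *v \<xi>)) \<le> norm (Q *v \<xi>) / r"
proof -
  note adj = inner_transpose
  define v where "v = Q *v (matrix_inv (transpose A) *v \<xi>)"
  \<comment> \<open>a vector at which the dual norm of \<open>v\<close> is attained\<close>
  define x where "x = matrix_inv P *v v"
  have Px: "P *v x = v" by (simp add: x_def matrix_vector_mul_assoc matrix_inv_mult[OF P])
  have "(norm v)\<^sup>2 = x \<bullet> (matrix_inv (transpose A) *v \<xi>)"
  proof -
    have "(norm v)\<^sup>2 = v \<bullet> (Q *v (matrix_inv (transpose A) *v \<xi>))"
      unfolding power2_norm_eq_inner by (simp only: v_def)
    then show ?thesis unfolding Q_def adj x_def .
  qed
  also have "\<dots> = (matrix_inv A *v x) \<bullet> \<xi>"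
    unfolding transpose_matrix_inv[OF A] by (rule adj)
  also have "\<dots> = (matrix_inv P *v (P *v (matrix_inv A *v x))) \<bullet> \<xi>"
    by (simp add: matrix_vector_mul_assoc[of "matrix_inv P"] matrix_inv_mult[OF P])
  also have "\<dots> = (P *v (matrix_inv A *v x)) \<bullet> (Q *v \<xi>)"
    unfolding Q_def by (rule adj[symmetric])
  also have "\<dots> \<le> norm (P *v (matrix_inv A *v x)) * norm (Q *v \<xi>)" by (rule norm_cauchy_schwarz)
  also have "\<dots> \<le> (norm (P *v x) / r) * norm (Q *v \<xi>)" by (intro mult_right_mono le) simp
  also have "\<dots> = norm v * (norm (Q *v \<xi>) / r)" by (simp add: Px)
  finally have "norm v * norm v \<le> norm v * (norm (Q *v \<xi>) / r)" by (simp add: power2_eq_square)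
  then have "norm v \<le> norm (Q *v \<xi>) / r"
    using r mult_left_le_imp_le[of "norm v" "norm v" "norm (Q *v \<xi>) / r"] by (cases "v = 0") auto
  then show ?thesis by (simp add: v_def)
qed

text \<open>Along the backward orbits of \<open>B\<close> the norm \<open>norm (Q *v x)\<close> decreases geometrically, while on \<open>K\<close> it
  lies between two positive bounds.\<close>

lemma orbit_compact_bounded:
  fixes B Q :: "real^'d^'d"
  assumes B: "invertible B" and Q: "invertible Q" and r: "1 < r"
    and le: "\<And>x. norm (Q *v (matrix_inv B *v x)) \<le> norm (Q *v x) / r"
    and K: "compact K" "0 \<notin> K"
  obtains N :: nat where "\<And>x k. x \<in> K \<Longrightarrow> mat_powi B (- k) *v x \<in> K \<Longrightarrow> \<bar>k\<bar> \<le> int N"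
proof (cases "K = {}")
  case False
  have cont: "continuous_on K (\<lambda>x. norm (Q *v x))"
    by (intro continuous_intros linear_continuous_on matrix_vector_mul_bounded_linear)
  obtain a where a: "a \<in> K" "\<And>x. x \<in> K \<Longrightarrow> norm (Q *v a) \<le> norm (Q *v x)"
    using continuous_attains_inf[OF K(1) False cont] by blast
  obtain b where b: "b \<in> K" "\<And>x. x \<in> K \<Longrightarrow> norm (Q *v x) \<le> norm (Q *v b)"
    using continuous_attains_sup[OF K(1) False cont] by blast
  have "Q *v a \<noteq> 0"
  proof
    assume "Q *v a = 0"
    then have "matrix_inv Q *v (Q *v a) = 0" by simp
    then have "a = 0" by (simp add: matrix_vector_mul_assoc matrix_inv_mult[OF Q])
    with a(1) K(2) show False by simp
  qed
  then have pos: "norm (Q *v a) > 0" by simp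
  obtain N where N: "norm (Q *v b) / norm (Q *v a) < r ^ N" using real_arch_pow[OF r] by blast
  have small: "n < N" if "x \<in> K" "mat_powi B (- int n) *v x \<in> K" for x n
  proof (rule ccontr)
    assume "\<not> n < N"
    then have "r ^ N \<le> r ^ n" using r by (intro power_increasing) auto
    have "norm (Q *v a) \<le> norm (Q *v x) / r ^ n"
      using a(2)[OF that(2)] contraction_powi[OF B _ le, of n x] r by linarith
    also have "\<dots> \<le> norm (Q *v b) / r ^ n" using r b(2)[OF that(1)] by (intro divide_right_mono) auto
    finally have "r ^ n \<le> norm (Q *v b) / norm (Q *v a)"
      using pos r by (simp add: field_simps)
    with N \<open>r ^ N \<le> r ^ n\<close> show False by linarith
  qed
  show thesis
  proof (rule that[of N])
    fix x k assume x: "x \<in> K" "mat_powi B (- k) *v x \<in> K"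
    show "\<bar>k\<bar> \<le> int N"
    proof (cases "0 \<le> k")
      case True
      then obtain n where "k = int n" using nonneg_int_cases by blast
      then show ?thesis using small[of x n] x by simp
    next
      case False
      then obtain n where n: "- k = int n" by (metis nonneg_int_cases linear neg_0_le_iff_le)
      have "mat_powi B (- int n) *v (mat_powi B (- k) *v x) = x"
        using mat_powi_minus_cancel(3)[OF B, of "- k" x] n by simp
      then have "n < N" using small[of "mat_powi B (- k) *v x" n] x by simp
      then show ?thesis using n by simp
    qed
  qed
qed auto

text \<open>On the Fourier side this is the identity defining an admissible pair, multiplied by the conjugate
  of the Fourier transform of \<open>\<phi>\<close>: by compactness of the supports only finitely many of its terms
  do not vanish.\<close>

theorem reproducing_formula:
  fixes A P :: "real^'d^'d"
  assumes ad: "adapted_ellipsoid A P" and adm: "admissible_pair A \<phi> \<psi>"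
  defines "\<theta> \<equiv> \<lambda>i. convolve (\<lambda>x. cnj (dilate A \<psi> i x)) (\<lambda>x. cnj (\<phi> x))"
  obtains N :: nat where
    "\<And>x. cnj (\<phi> x) = (\<Sum>i\<in>{- int N..int N}. convolve (\<lambda>x. dilate A \<phi> i (- x)) (\<theta> i) x)"
proof -
  obtain r where r: "1 < r" and A: "invertible A" and P: "invertible P"
    and le: "\<And>x. norm (P *v (matrix_inv A *v x)) \<le> norm (P *v x) / r"
    using adapted_ellipsoid_contraction[OF ad] by blast
  define Q where "Q = transpose (matrix_inv P)"
  have Q: "invertible Q"
    unfolding Q_def by (intro transpose_invertible) (use matrix_inv_mult[OF P] in \<open>auto simp: invertible_def\<close>)
  have A': "invertible (transpose A)" by (rule transpose_invertible[OF A])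
  have leQ: "norm (Q *v (matrix_inv (transpose A) *v x)) \<le> norm (Q *v x) / r" for x
    unfolding Q_def using contraction_transpose[OF A P _ le] r by simp
  from adm have \<phi>: "\<phi> \<in> schwartz" and \<psi>: "\<psi> \<in> schwartz"
    and supp: "closure {\<xi>. fourier \<phi> \<xi> \<noteq> 0} \<subseteq> cbox (\<chi> i. - pi) (\<chi> i. pi) - {0}"
    and sum: "\<And>\<xi>. \<xi> \<noteq> 0 \<Longrightarrow> ((\<lambda>k::int. cnj (fourier \<phi> (mat_powi (transpose A) (- k) *v \<xi>)) *
                   fourier \<psi> (mat_powi (transpose A) (- k) *v \<xi>)) has_sum 1) UNIV"
    by (auto simp: admissible_pair_def)
  define K where "K = closure {\<xi>. fourier \<phi> \<xi> \<noteq> 0}"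
  have "bounded K" using supp unfolding K_def by (meson Diff_subset bounded_cbox bounded_subset)
  then have K: "compact K" "0 \<notin> K"
    using supp by (auto simp: compact_eq_bounded_closed K_def)
  obtain N where N: "\<And>x k. x \<in> K \<Longrightarrow> mat_powi (transpose A) (- k) *v x \<in> K \<Longrightarrow> \<bar>k\<bar> \<le> int N"
    using orbit_compact_bounded[OF A' Q r leQ K] by blast
  have inK: "\<xi> \<in> K" if "fourier \<phi> \<xi> \<noteq> 0" for \<xi>
    unfolding K_def by (rule subsetD[OF closure_subset]) (simp add: that)
  let ?I = "{- int N..int N}"
  have key: "(\<Sum>i\<in>?I. cnj (fourier \<phi> (mat_powi (transpose A) (- i) *v \<xi>)) *
      fourier \<psi> (mat_powi (transpose A) (- i) *v \<xi>)) * fourier \<phi> \<xi> = fourier \<phi> \<xi>" for \<xi>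
  proof (cases "fourier \<phi> \<xi> = 0")
    case False
    then have "\<xi> \<in> K" by (rule inK)
    then have "\<xi> \<noteq> 0" using K by auto
    have "fourier \<phi> (mat_powi (transpose A) (- i) *v \<xi>) = 0" if "i \<notin> ?I" for i
      using N[OF \<open>\<xi> \<in> K\<close>, of i] inK that by (cases "fourier \<phi> (mat_powi (transpose A) (- i) *v \<xi>) = 0") auto
    moreover define F where "F i = cnj (fourier \<phi> (mat_powi (transpose A) (- i) *v \<xi>)) *
      fourier \<psi> (mat_powi (transpose A) (- i) *v \<xi>)" for i
    ultimately have "(F has_sum 1) UNIV \<longleftrightarrow> (F has_sum 1) ?I"
      by (intro has_sum_cong_neutral) auto
    moreover have "(F has_sum 1) UNIV" unfolding F_def by (rule sum[OF \<open>\<xi> \<noteq> 0\<close>])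
    ultimately have "(\<Sum>i\<in>?I. F i) = 1"
      using has_sum_unique[OF has_sum_finite[of ?I F]] by auto
    then have "(\<Sum>i\<in>?I. cnj (fourier \<phi> (mat_powi (transpose A) (- i) *v \<xi>)) *
      fourier \<psi> (mat_powi (transpose A) (- i) *v \<xi>)) = 1"
      unfolding F_def .
    then show ?thesis by simp
  qed simp
  have \<psi>': "(\<lambda>x. cnj (dilate A \<psi> i x)) \<in> schwartz" for i by (intro schwartz_cnj schwartz_dilate \<psi> A)
  have \<phi>': "(\<lambda>x. dilate A \<phi> i (- x)) \<in> schwartz" for i by (intro schwartz_reflect schwartz_dilate \<phi> A)
  have \<theta>: "\<theta> i \<in> schwartz" for i
    unfolding \<theta>_def by (intro convolve_schwartz(1) \<psi>' schwartz_rapidly_decreasing schwartz_borel schwartz_cnj \<phi>)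
  have conv: "convolve (\<lambda>x. dilate A \<phi> i (- x)) (\<theta> i) \<in> schwartz" for i
    by (intro convolve_schwartz(1) \<phi>' schwartz_rapidly_decreasing schwartz_borel \<theta>)
  define S where "S x = (\<Sum>i\<in>?I. convolve (\<lambda>x. dilate A \<phi> i (- x)) (\<theta> i) x)" for x
  have S: "S \<in> schwartz"
    using schwartz_sum[of ?I "\<lambda>i. convolve (\<lambda>x. dilate A \<phi> i (- x)) (\<theta> i)" "\<lambda>_. 1"] conv
    by (simp add: S_def[abs_def])
  have w: "(\<lambda>x. cnj (\<phi> x) - S x) \<in> schwartz" by (intro schwartz_diff schwartz_cnj \<phi> S)
  have "cnj (\<phi> x) - S x = 0" for x
  proof (rule fourier_injective[OF schwartz_rapidly_decreasing[OF w] schwartz_continuous[OF w]])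
    fix \<xi>
    have "fourier (convolve (\<lambda>x. dilate A \<phi> i (- x)) (\<theta> i)) \<xi> =
        fourier \<phi> (mat_powi (transpose A) (- i) *v (- \<xi>)) *
        (cnj (fourier \<psi> (mat_powi (transpose A) (- i) *v (- \<xi>))) * cnj (fourier \<phi> (- \<xi>)))" for i
    proof -
      note sb = schwartz_rapidly_decreasing schwartz_borel
      have "fourier (convolve (\<lambda>x. dilate A \<phi> i (- x)) (\<theta> i)) \<xi> =
          fourier (\<lambda>x. dilate A \<phi> i (- x)) \<xi> * fourier (\<theta> i) \<xi>"
        by (intro fourier_convolve sb \<phi>' \<theta>)
      also have "fourier (\<lambda>x. dilate A \<phi> i (- x)) \<xi> = fourier \<phi> (mat_powi (transpose A) (- i) *v (- \<xi>))"
        unfolding fourier_reflect[OF schwartz_borel[OF schwartz_dilate[OF \<phi> A]]] by (rule fourier_dilate[OF \<phi> A])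
      also have "fourier (\<theta> i) \<xi> = fourier (\<lambda>x. cnj (dilate A \<psi> i x)) \<xi> * fourier (\<lambda>x. cnj (\<phi> x)) \<xi>"
        unfolding \<theta>_def by (intro fourier_convolve sb \<psi>' schwartz_cnj \<phi>)
      also have "fourier (\<lambda>x. cnj (dilate A \<psi> i x)) \<xi> = cnj (fourier \<psi> (mat_powi (transpose A) (- i) *v (- \<xi>)))"
        unfolding fourier_cnj[OF schwartz_borel[OF schwartz_dilate[OF \<psi> A]]] by (simp only: fourier_dilate[OF \<psi> A])
      also have "fourier (\<lambda>x. cnj (\<phi> x)) \<xi> = cnj (fourier \<phi> (- \<xi>))"
        by (rule fourier_cnj[OF schwartz_borel[OF \<phi>]])
      finally show ?thesis .
    qed
    then have "fourier S \<xi> = cnj ((\<Sum>i\<in>?I. cnj (fourier \<phi> (mat_powi (transpose A) (- i) *v (- \<xi>))) *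
      fourier \<psi> (mat_powi (transpose A) (- i) *v (- \<xi>))) * fourier \<phi> (- \<xi>))"
      unfolding S_def[abs_def] using conv by (simp add: fourier_sum sum_distrib_left mult_ac)
    also have "\<dots> = cnj (fourier \<phi> (- \<xi>))" by (simp only: key)
    finally have "fourier S \<xi> = fourier (\<lambda>x. cnj (\<phi> x)) \<xi>"
      by (simp add: fourier_cnj[OF schwartz_borel[OF \<phi>]])
    then show "fourier (\<lambda>x. cnj (\<phi> x) - S x) \<xi> = 0"
      by (simp add: fourier_diff[OF schwartz_cnj[OF \<phi>] S])
  qed
  then show thesis by (intro that[of N]) (simp add: S_def)
qed

section \<open>Powers and Hoelder's inequality in the extended nonnegative reals\<close>

lemma ennpowr_ennreal: "0 \<le> x \<Longrightarrow> ennpowr (ennreal x) a = ennreal (x powr a)"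
  by (simp add: ennpowr_def)

lemma ennpowr_top [simp]: "ennpowr top a = top"
  by (simp add: ennpowr_def infinity_ennreal_def)

lemma ennpowr_zero [simp]: "ennpowr 0 a = 0"
  by (simp add: ennpowr_def)

lemma ennpowr_one [simp]: "ennpowr x 1 = x"
  by (cases x) (auto simp: ennpowr_ennreal)

lemma ennpowr_mono: "x \<le> y \<Longrightarrow> 0 \<le> a \<Longrightarrow> ennpowr x a \<le> ennpowr y a"
  by (cases x; cases y) (auto simp: ennpowr_ennreal powr_mono2 top_unique intro!: ennreal_leI)

lemma ennpowr_eq_0_iff: "ennpowr x a = 0 \<longleftrightarrow> x = 0"
  by (cases x) (auto simp: ennpowr_ennreal ennreal_eq_0_iff)

lemma ennpowr_mult:
  assumes "0 < a"
  shows "ennpowr (x * y) a = ennpowr x a * ennpowr y a"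
proof (cases "x = top \<or> y = top")
  case True
  then show ?thesis
    by (cases "x = 0"; cases "y = 0") (auto simp: ennreal_top_mult ennreal_mult_top ennpowr_eq_0_iff)
next
  case False
  then show ?thesis
    by (cases x; cases y) (auto simp: ennpowr_ennreal powr_mult simp flip: ennreal_mult)
qed

lemma ennpowr_ennpowr: "ennpowr (ennpowr x a) b = ennpowr x (a * b)"
  by (cases x) (auto simp: ennpowr_ennreal powr_powr)

lemma borel_measurable_ennpowr [measurable]:
  assumes [measurable]: "f \<in> borel_measurable M"
  shows "(\<lambda>x. ennpowr (f x) a) \<in> borel_measurable M"
  unfolding ennpowr_def by measurable

text \<open>Comparison of the sum with its largest term works for exponents below and above \<open>1\<close> alike.\<close>

lemma ennpowr_sum_le:
  assumes "finite I" "0 < a"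
  shows "ennpowr (\<Sum>i\<in>I. x i) a \<le> ennreal (real (card I) powr a) * (\<Sum>i\<in>I. ennpowr (x i) a)"
proof (cases "I = {}")
  case False
  then have "Max (x ` I) \<in> x ` I" using assms by (intro Max_in) auto
  then obtain j where j: "j \<in> I" "x j = Max (x ` I)" by auto
  have "(\<Sum>i\<in>I. x i) \<le> of_nat (card I) * x j"
    using assms j(2) by (intro sum_bounded_above) auto
  then have "ennpowr (\<Sum>i\<in>I. x i) a \<le> ennpowr (ennreal (real (card I)) * x j) a"
    using assms by (intro ennpowr_mono) (auto simp: ennreal_of_nat_eq_real_of_nat)
  also have "\<dots> = ennreal (real (card I) powr a) * ennpowr (x j) a"
    using assms by (simp add: ennpowr_mult ennpowr_ennreal)
  also have "\<dots> \<le> ennreal (real (card I) powr a) * (\<Sum>i\<in>I. ennpowr (x i) a)"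
    using assms j by (intro mult_left_mono member_le_sum) auto
  finally show ?thesis .
qed simp

text \<open>Young's inequality, applied to \<open>f\<close> and \<open>g\<close> divided by their norms \<open>a\<close> and \<open>b\<close>. The cases in which a
  norm is zero or infinite are separate.\<close>

lemma nn_integral_Hoelder:
  fixes f g :: "'a \<Rightarrow> real"
  assumes pq: "1 < p" "1 < q" "1 / p + 1 / q = 1"
    and [measurable]: "f \<in> borel_measurable M" "g \<in> borel_measurable M"
    and nonneg: "\<And>x. 0 \<le> f x" "\<And>x. 0 \<le> g x"
  shows "(\<integral>\<^sup>+x. ennreal (f x * g x) \<partial>M) \<le>
    ennpowr (\<integral>\<^sup>+x. ennreal (f x powr p) \<partial>M) (1 / p) * ennpowr (\<integral>\<^sup>+x. ennreal (g x powr q) \<partial>M) (1 / q)"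
proof -
  define F where "F = (\<integral>\<^sup>+x. ennreal (f x powr p) \<partial>M)"
  define G where "G = (\<integral>\<^sup>+x. ennreal (g x powr q) \<partial>M)"
  have zero: "(\<integral>\<^sup>+x. ennreal (f x * g x) \<partial>M) = 0" if "F = 0 \<or> G = 0"
    using that
  proof
    assume "F = 0"
    then have "AE x in M. ennreal (f x powr p) = 0"
      unfolding F_def by (subst (asm) nn_integral_0_iff_AE) auto
    then have "AE x in M. ennreal (f x * g x) = 0"
      by eventually_elim (auto simp: ennreal_eq_0_iff)
    then show ?thesis by (subst nn_integral_0_iff_AE) auto
  next
    assume "G = 0"
    then have "AE x in M. ennreal (g x powr q) = 0"
      unfolding G_def by (subst (asm) nn_integral_0_iff_AE) auto
    then have "AE x in M. ennreal (f x * g x) = 0"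
      by eventually_elim (auto simp: ennreal_eq_0_iff)
    then show ?thesis by (subst nn_integral_0_iff_AE) auto
  qed
  consider "F = 0 \<or> G = 0" | "F \<noteq> 0" "G \<noteq> 0" "F = top \<or> G = top"
    | "F \<noteq> 0" "G \<noteq> 0" "F \<noteq> top" "G \<noteq> top" by blast
  then have "(\<integral>\<^sup>+x. ennreal (f x * g x) \<partial>M) \<le> ennpowr F (1 / p) * ennpowr G (1 / q)"
  proof cases
    case 1
    then show ?thesis using zero by simp
  next
    case 2
    then have "ennpowr F (1 / p) * ennpowr G (1 / q) = top"
      by (auto simp: ennreal_top_mult ennreal_mult_top ennpowr_eq_0_iff)
    then show ?thesis by simp
  next
    case 3
    then obtain F' G' where FG: "F = ennreal F'" "G = ennreal G'" "0 < F'" "0 < G'"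
      by (cases F; cases G) (auto simp: ennreal_eq_0_iff not_le)
    define a b where "a = F' powr (1 / p)" and "b = G' powr (1 / q)"
    have ab: "0 < a" "0 < b" "a powr p = F'" "b powr q = G'"
      using FG pq by (auto simp: a_def b_def powr_powr)
    have "f x * g x \<le> a * b / (p * F') * f x powr p + a * b / (q * G') * g x powr q" for x
    proof -
      have "(f x / a) * (g x / b) \<le> (f x / a) powr p / p + (g x / b) powr q / q"
        using pq nonneg ab by (intro Youngs_inequality) auto
      also have "\<dots> = f x powr p / (p * F') + g x powr q / (q * G')"
        using nonneg ab by (simp add: powr_divide mult.commute)
      finally have "a * b * ((f x / a) * (g x / b)) \<le> a * b * (f x powr p / (p * F') + g x powr q / (q * G'))"
        using ab by (intro mult_left_mono) auto
      then show ?thesis using ab by (simp add: distrib_left)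
    qed
    then have "(\<integral>\<^sup>+x. ennreal (f x * g x) \<partial>M) \<le>
        (\<integral>\<^sup>+x. ennreal (a * b / (p * F')) * ennreal (f x powr p) + ennreal (a * b / (q * G')) * ennreal (g x powr q) \<partial>M)"
      using ab pq FG by (intro nn_integral_mono) (auto simp flip: ennreal_mult ennreal_plus intro!: ennreal_leI)
    also have "\<dots> = ennreal (a * b / (p * F')) * F + ennreal (a * b / (q * G')) * G"
      unfolding F_def G_def by (simp add: nn_integral_add nn_integral_cmult)
    also have "\<dots> = ennreal (a * b / (p * F') * F' + a * b / (q * G') * G')"
      using FG ab pq by (simp flip: ennreal_mult ennreal_plus)
    also have "a * b / (p * F') * F' + a * b / (q * G') * G' = a * b * (1 / p + 1 / q)"
      using FG by (simp add: distrib_left)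
    also have "\<dots> = a * b" using pq by simp
    also have "ennreal (a * b) = ennpowr F (1 / p) * ennpowr G (1 / q)"
      using FG by (simp add: ennpowr_ennreal a_def b_def flip: ennreal_mult)
    finally show ?thesis .
  qed
  then show ?thesis by (simp add: F_def G_def)
qed

section \<open>Duality for averaged norms\<close>

text \<open>A finite-dimensional Hahn-Banach argument: a vector outside the closed convex circled set
  \<open>{N \<le> t}\<close> is separated from it by some \<open>z\<close>, whose dual norm is then too small. The values \<open>0\<close> and
  \<open>top\<close> of \<open>N\<close> at nonzero vectors are included.\<close>

lemma bidual_le:
  fixes N :: "complex^'m \<Rightarrow> ennreal"
  assumes scale: "\<And>c x. N (c *s x) = ennreal (cmod c) * N x"
    and closed: "\<And>t. 0 < t \<Longrightarrow> closed {x. N x \<le> ennreal t}"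
    and convex: "\<And>t. 0 < t \<Longrightarrow> convex {x. N x \<le> ennreal t}"
    and le: "\<And>z. ennreal (cmod (cinner v z)) \<le> D * dual_norm N z"
  shows "N v \<le> D"
proof (rule ccontr)
  assume "\<not> N v \<le> D"
  then obtain e where e: "D < e" "e < N v" using dense[of D "N v"] by (auto simp: not_le)
  then have "e \<noteq> top" by auto
  then obtain t where t: "e = ennreal t" "0 \<le> t" by (cases e) auto
  have "t > 0" using e t by (cases "t = 0") auto
  define K where "K = {x. N x \<le> ennreal t}"
  have "v \<notin> K" using e t by (simp add: K_def)
  then obtain a b where ab: "a \<bullet> v < b" "\<And>x. x \<in> K \<Longrightarrow> a \<bullet> x > b"
    using separating_hyperplane_closed_point[of K v] closed convex \<open>t > 0\<close> unfolding K_def by blast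
  define z where "z = - a"
  define \<beta> where "\<beta> = - b"
  have sep: "v \<bullet> z > \<beta>" "\<And>x. x \<in> K \<Longrightarrow> x \<bullet> z < \<beta>"
    using ab by (auto simp: z_def \<beta>_def inner_commute)
  have K_scale: "c *s x \<in> K" if "ennreal (cmod c) * N x \<le> ennreal t" for c x
    using that by (simp add: K_def scale)
  have "N 0 = 0" using scale[of 0 0] by simp
  then have "\<beta> > 0" using sep(2)[of 0] by (simp add: K_def)
  \<comment> \<open>\<open>K\<close> is circled, so the bound of the real part extends to the modulus\<close>
  have small: "cmod (cinner x z) < \<beta>" if "x \<in> K" for x
  proof -
    obtain c where c: "cmod c = 1" "cmod (cinner x z) = x \<bullet> (c *s z)" by (rule cinner_rotate)
    have "x \<bullet> (c *s z) = (cnj c *s x) \<bullet> z"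
      unfolding Re_cinner[symmetric] by (simp add: cinner_scale_left cinner_scale_right)
    also have "\<dots> < \<beta>" using that c by (intro sep(2) K_scale) (simp add: K_def)
    finally show ?thesis using c by simp
  qed
  have "dual_norm N z \<le> ennreal (\<beta> / t)"
    unfolding dual_norm_def
  proof (rule SUP_least)
    fix w
    have sym: "cmod (cinner z w) = cmod (cinner w z)"
      by (subst cinner_commute) simp
    consider "N w = top" | "N w = 0" | s where "N w = ennreal s" "s > 0"
      by (cases "N w") (auto simp: le_less)
    then show "ennreal (cmod (cinner z w)) / N w \<le> ennreal (\<beta> / t)"
    proof cases
      case 2
      have "cmod (cinner w z) = 0"
      proof (rule ccontr)
        assume n: "cmod (cinner w z) \<noteq> 0"
        have "cmod (cinner (complex_of_real (\<beta> / cmod (cinner w z)) *s w) z) < \<beta>"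
          using 2 by (intro small K_scale) simp
        then show False using n \<open>\<beta> > 0\<close> by (simp add: cinner_scale_left norm_mult norm_divide)
      qed
      then show ?thesis by (simp add: sym)
    next
      case 3
      have "cmod (cinner (complex_of_real (t / s) *s w) z) < \<beta>"
        using 3 \<open>t > 0\<close> by (intro small K_scale) (simp add: norm_divide flip: ennreal_mult)
      then have "cmod (cinner w z) / s \<le> \<beta> / t"
        using 3 \<open>t > 0\<close> by (simp add: cinner_scale_left norm_mult norm_divide field_simps)
      then show ?thesis using 3 by (simp add: sym divide_ennreal ennreal_leI)
    qed simp
  qed
  then have "ennreal (cmod (cinner v z)) \<le> D * ennreal (\<beta> / t)"
    using le[of z] mult_left_mono[of "dual_norm N z" "ennreal (\<beta> / t)" D] by (meson order_trans zero_le)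
  also have "\<dots> \<le> ennreal t * ennreal (\<beta> / t)"
    using e t by (intro mult_right_mono) auto
  also have "\<dots> = ennreal \<beta>" using \<open>t > 0\<close> \<open>\<beta> > 0\<close> by (simp flip: ennreal_mult)
  finally have "cmod (cinner v z) \<le> \<beta>" using \<open>\<beta> > 0\<close> by (simp add: ennreal_le_iff)
  moreover have "v \<bullet> z \<le> cmod (cinner v z)"
    unfolding Re_cinner[symmetric] by (rule complex_Re_le_cmod)
  ultimately show False using sep(1) by simp
qed

text \<open>Convexity of \<open>t powr p\<close> on the closed half line; the endpoint \<open>0\<close> is treated separately.\<close>

lemma powr_convex_combination:
  fixes a b :: real
  assumes p: "1 \<le> p" and ab: "0 \<le> a" "0 \<le> b" and uv: "0 \<le> u" "0 \<le> v" "u + v = 1"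
  shows "(u * a + v * b) powr p \<le> u * a powr p + v * b powr p"
proof -
  have shrink: "(w * c) powr p \<le> w * c powr p" if "0 \<le> w" "w \<le> 1" "0 \<le> c" for w c :: real
  proof (cases "w = 0")
    case False
    have "w powr p \<le> w powr 1" using that p False by (intro powr_mono') auto
    then show ?thesis using that False by (simp add: powr_mult mult_right_mono)
  qed simp
  show ?thesis
  proof (cases "a = 0 \<or> b = 0")
    case True
    then show ?thesis using shrink[of u a] shrink[of v b] ab uv by auto
  next
    case False
    then show ?thesis
      using powr_convex[OF p] ab uv unfolding convex_on_def by auto
  qed
qed

lemma matrix_weight_measurable:
  fixes W :: "real^'d \<Rightarrow> complex^'m^'m"
  assumes "matrix_weight W"
  shows "(\<lambda>t. mat_powr (W t) s) \<in> borel_measurable lebesgue"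
  using assms by (intro borel_measurable_mat_powr) (auto simp: matrix_weight_def)

lemma continuous_on_matrix_vector_complex:
  fixes f :: "'a::topological_space \<Rightarrow> complex^'m^'m"
  assumes "continuous_on S f" "continuous_on S g"
  shows "continuous_on S (\<lambda>x. f x *v g x)"
  unfolding matrix_vector_mult_def by (intro continuous_intros assms)

lemma borel_measurable_matrix_vector_complex:
  fixes f :: "'a \<Rightarrow> complex^'m^'m"
  assumes "f \<in> borel_measurable M" "g \<in> borel_measurable M"
  shows "(\<lambda>x. f x *v g x) \<in> borel_measurable M"
  using assms by (intro borel_measurable_continuous_Pair[where H = "(*v)"] continuous_on_matrix_vector_complex
      continuous_intros)

lemma weight_norm_measurable:
  assumes "matrix_weight W"
  shows "(\<lambda>t. weight_norm p W t y) \<in> borel_measurable lebesgue"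
    "(\<lambda>t. weight_norm_dual p W t y) \<in> borel_measurable lebesgue"
proof -
  have "(\<lambda>t. norm (mat_powr (W t) s *v y)) \<in> borel_measurable lebesgue" for s
    by (rule measurable_compose[OF borel_measurable_matrix_vector_complex[OF
            matrix_weight_measurable[OF assms] borel_measurable_const] borel_measurable_norm])
  then show "(\<lambda>t. weight_norm p W t y) \<in> borel_measurable lebesgue"
    "(\<lambda>t. weight_norm_dual p W t y) \<in> borel_measurable lebesgue"
    unfolding weight_norm_def weight_norm_dual_def by auto
qed

lemma matrix_vector_cscale: "(M::complex^'m^'m) *v (c *s x) = c *s (M *v x)"
  by (simp add: vec_eq_iff matrix_vector_mult_def sum_distrib_left mult_ac)

lemma ennreal_divide_le_iff:
  fixes a b m :: ennreal
  assumes "m \<noteq> 0" "m \<noteq> top"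
  shows "a / m \<le> b \<longleftrightarrow> a \<le> b * m"
  using assms divide_less_ennreal[of m a b] divide_le_posI_ennreal[of m a b]
    mult_divide_eq_ennreal[of m b] divide_right_mono_ennreal[of a "b * m" m]
    mult_right_mono[of "a / m" b m] ennreal_divide_times[of a m m]
  by (auto simp: zero_less_iff_neq_zero less_top[symmetric])

lemma ennreal_divide_antimono:
  fixes a x y :: ennreal
  assumes "x \<le> c * y" "c \<noteq> 0" "c \<noteq> top"
  shows "a / y \<le> c * (a / x)"
proof -
  obtain c' where c: "c = ennreal c'" "0 \<le> c'" using assms(3) by (cases c) auto
  show ?thesis
  proof (cases "x = 0 \<or> y = 0 \<or> y = top \<or> a = 0")
    case True
    then show ?thesis using assms by (auto simp: ennreal_mult_top)
  next
    case False
    then obtain r where r: "y = ennreal r" "r > 0" by (cases y) (auto simp: ennreal_eq_0_iff not_le)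
    have "x \<noteq> top" using assms(1) c r by (auto simp: top_unique simp flip: ennreal_mult)
    then obtain s where s: "x = ennreal s" "s > 0" using False by (cases x) (auto simp: ennreal_eq_0_iff not_le)
    have "s \<le> c' * r" using assms(1) c r s by (simp flip: ennreal_mult)
    then have c': "c' > 0" using s r by (metis less_le_trans mult_nonpos_nonneg not_le less_imp_le)
    show ?thesis
    proof (cases a)
      case (real u)
      have "u / r \<le> c' * (u / s)"
        using \<open>s \<le> c' * r\<close> r s real mult_left_mono[of s "c' * r" u] by (simp add: field_simps)
      then show ?thesis using r s real c by (simp add: divide_ennreal ennreal_leI flip: ennreal_mult)
    next
      case top
      then show ?thesis using s c c' by (simp add: ennreal_top_divide ennreal_mult_top)
    qed
  qed
qed

lemma avg_norm_le_iff:
  assumes p: "1 \<le> p" and Q: "0 < emeasure lebesgue Q" "emeasure lebesgue Q < top"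
    and D: "0 \<le> t"
  shows "avg_norm p N Q y \<le> ennreal t \<longleftrightarrow>
    (\<integral>\<^sup>+s\<in>Q. ennreal (N s y powr p) \<partial>lebesgue) \<le> ennreal (t powr p) * emeasure lebesgue Q"
proof -
  define I where "I = (\<integral>\<^sup>+s\<in>Q. ennreal (N s y powr p) \<partial>lebesgue)"
  define m where "m = emeasure lebesgue Q"
  have m: "m \<noteq> 0" "m \<noteq> top" using Q by (auto simp: m_def)
  have "ennpowr (I / m) (1 / p) \<le> ennreal t \<longleftrightarrow> I / m \<le> ennreal (t powr p)"
  proof
    assume "ennpowr (I / m) (1 / p) \<le> ennreal t"
    then have "ennpowr (ennpowr (I / m) (1 / p)) p \<le> ennpowr (ennreal t) p"
      using p by (intro ennpowr_mono) auto
    then show "I / m \<le> ennreal (t powr p)" using p D by (simp add: ennpowr_ennpowr ennpowr_ennreal)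
  next
    assume "I / m \<le> ennreal (t powr p)"
    then have "ennpowr (I / m) (1 / p) \<le> ennpowr (ennreal (t powr p)) (1 / p)"
      using p by (intro ennpowr_mono) auto
    then show "ennpowr (I / m) (1 / p) \<le> ennreal t"
      using p D by (simp add: ennpowr_ennreal powr_powr)
  qed
  also have "\<dots> \<longleftrightarrow> I \<le> ennreal (t powr p) * m"
    using m by (rule ennreal_divide_le_iff)
  finally show ?thesis by (simp add: avg_norm_def I_def m_def)
qed

text \<open>The balls of the average norm are convex because \<open>t powr p\<close> is convex, and closed by Fatou's lemma,
  so the average norm is determined by its dual.\<close>

lemma avg_norm_bidual_le:
  fixes W :: "real^'d \<Rightarrow> complex^'m^'m"
  assumes W: "matrix_weight W" and p: "1 \<le> p"
    and Q: "Q \<in> sets lebesgue" "0 < emeasure lebesgue Q" "emeasure lebesgue Q < top"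
    and le: "\<And>z. ennreal (cmod (cinner v z)) \<le> D * dual_norm (avg_norm p (weight_norm p W) Q) z"
  shows "avg_norm p (weight_norm p W) Q v \<le> D"
proof (rule bidual_le[OF _ _ _ le])
  define I where "I x = (\<integral>\<^sup>+s\<in>Q. ennreal (weight_norm p W s x powr p) \<partial>lebesgue)" for x
  have ball: "{x. avg_norm p (weight_norm p W) Q x \<le> ennreal t} = {x. I x \<le> ennreal (t powr p) * emeasure lebesgue Q}"
    if "0 < t" for t
    using avg_norm_le_iff[OF p Q(2,3), of t "weight_norm p W"] that by (simp add: I_def)
  have [measurable]: "(\<lambda>s. weight_norm p W s x) \<in> borel_measurable lebesgue" for x
    by (rule weight_norm_measurable[OF W])
  note [measurable] = Q(1)
  show "avg_norm p (weight_norm p W) Q (c *s x) = ennreal (cmod c) * avg_norm p (weight_norm p W) Q x" for c x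
  proof -
    have "weight_norm p W s (c *s x) powr p = cmod c powr p * weight_norm p W s x powr p" for s
      by (simp add: weight_norm_def matrix_vector_cscale norm_cscale powr_mult)
    then have "I (c *s x) = ennreal (cmod c powr p) * I x"
      by (simp add: I_def ennreal_mult mult.assoc nn_integral_cmult)
    then have "I (c *s x) / emeasure lebesgue Q = ennreal (cmod c powr p) * (I x / emeasure lebesgue Q)"
      by (simp add: ennreal_times_divide)
    then show ?thesis
      using p by (simp add: avg_norm_def ennpowr_mult ennpowr_ennreal powr_powr flip: I_def)
  qed
  show "convex {x. avg_norm p (weight_norm p W) Q x \<le> ennreal t}" if "0 < t" for t
    unfolding ball[OF that]
  proof (rule convexI)
    fix x y :: "complex^'m" and u v :: real
    assume xy: "x \<in> {x. I x \<le> ennreal (t powr p) * emeasure lebesgue Q}"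
      "y \<in> {x. I x \<le> ennreal (t powr p) * emeasure lebesgue Q}" and uv: "0 \<le> u" "0 \<le> v" "u + v = 1"
    have pt: "weight_norm p W s (u *\<^sub>R x + v *\<^sub>R y) powr p \<le> u * weight_norm p W s x powr p + v * weight_norm p W s y powr p"
      for s
    proof -
      have "weight_norm p W s (u *\<^sub>R x + v *\<^sub>R y) \<le> u * weight_norm p W s x + v * weight_norm p W s y"
        unfolding weight_norm_def matrix_vector_right_distrib matrix_scaleR_left
        using uv by (intro norm_triangle_le) simp
      then have "weight_norm p W s (u *\<^sub>R x + v *\<^sub>R y) powr p \<le> (u * weight_norm p W s x + v * weight_norm p W s y) powr p"
        using p by (intro powr_mono2) (auto simp: weight_norm_def)
      also have "\<dots> \<le> u * weight_norm p W s x powr p + v * weight_norm p W s y powr p"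
        using uv p by (intro powr_convex_combination) (auto simp: weight_norm_def)
      finally show ?thesis .
    qed
    have "I (u *\<^sub>R x + v *\<^sub>R y) \<le> (\<integral>\<^sup>+s. ennreal u * (ennreal (weight_norm p W s x powr p) * indicator Q s) +
        ennreal v * (ennreal (weight_norm p W s y powr p) * indicator Q s) \<partial>lebesgue)"
      unfolding I_def using pt uv
      by (intro nn_integral_mono) (auto simp: indicator_def simp flip: ennreal_mult ennreal_plus intro!: ennreal_leI)
    also have "\<dots> = ennreal u * I x + ennreal v * I y"
      by (simp add: I_def nn_integral_add nn_integral_cmult)
    also have "\<dots> \<le> ennreal u * (ennreal (t powr p) * emeasure lebesgue Q) + ennreal v * (ennreal (t powr p) * emeasure lebesgue Q)"
      using xy by (intro add_mono mult_left_mono) auto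
    also have "\<dots> = ennreal (u + v) * (ennreal (t powr p) * emeasure lebesgue Q)"
      unfolding ennreal_plus[OF uv(1,2)] distrib_right ..
    finally show "u *\<^sub>R x + v *\<^sub>R y \<in> {x. I x \<le> ennreal (t powr p) * emeasure lebesgue Q}"
      using uv by simp
  qed
  show "closed {x. avg_norm p (weight_norm p W) Q x \<le> ennreal t}" if "0 < t" for t
    unfolding ball[OF that] closed_sequential_limits
  proof (intro allI impI, elim conjE)
    fix x l assume x: "\<forall>n. x n \<in> {x. I x \<le> ennreal (t powr p) * emeasure lebesgue Q}" and lim: "x \<longlonglongrightarrow> l"
    have "(\<lambda>n. weight_norm p W s (x n) powr p) \<longlonglongrightarrow> weight_norm p W s l powr p" for s
    proof -
      have "continuous_on UNIV (\<lambda>x. mat_powr (W s) (1 / p) *v x)"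
        by (intro continuous_on_matrix_vector_complex continuous_intros)
      then have "(\<lambda>n. mat_powr (W s) (1 / p) *v x n) \<longlonglongrightarrow> mat_powr (W s) (1 / p) *v l"
        using lim by (intro isCont_tendsto_compose[of l "\<lambda>x. mat_powr (W s) (1 / p) *v x"])
          (auto simp: continuous_on_eq_continuous_at)
      then show ?thesis unfolding weight_norm_def
        using p by (intro tendsto_powr' tendsto_norm tendsto_const) auto
    qed
    then have pt: "(\<lambda>n. ennreal (weight_norm p W s (x n) powr p) * indicator Q s) \<longlonglongrightarrow>
        ennreal (weight_norm p W s l powr p) * indicator Q s" for s
      by (auto simp: indicator_def intro!: tendsto_ennrealI)
    have "I l = (\<integral>\<^sup>+s. liminf (\<lambda>n. ennreal (weight_norm p W s (x n) powr p) * indicator Q s) \<partial>lebesgue)"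
      unfolding I_def using pt by (intro nn_integral_cong) (metis lim_imp_Liminf trivial_limit_sequentially)
    also have "\<dots> \<le> liminf (\<lambda>n. I (x n))"
      unfolding I_def by (rule nn_integral_liminf) measurable
    also have "\<dots> \<le> liminf (\<lambda>n. ennreal (t powr p) * emeasure lebesgue Q)"
      using x by (intro Liminf_mono always_eventually) auto
    also have "\<dots> = ennreal (t powr p) * emeasure lebesgue Q" by (rule Liminf_const) simp
    finally show "l \<in> {x. I x \<le> ennreal (t powr p) * emeasure lebesgue Q}" by simp
  qed
qed

lemma dual_norm_antimono:
  assumes "\<And>y. N y \<le> c * N' y" "c \<noteq> 0" "c \<noteq> top"
  shows "dual_norm N' z \<le> c * dual_norm N z"
  unfolding dual_norm_def
proof (rule SUP_least)
  fix y :: "complex^'a" assume y: "y \<in> - {0}"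
  have "ennreal (cmod (cinner z y)) / N' y \<le> c * (ennreal (cmod (cinner z y)) / N y)"
    by (rule ennreal_divide_antimono[OF assms])
  also have "\<dots> \<le> c * (SUP y\<in>-{0}. ennreal (cmod (cinner z y)) / N y)"
    by (intro mult_left_mono SUP_upper y) simp
  finally show "ennreal (cmod (cinner z y)) / N' y \<le> c * (SUP y\<in>-{0}. ennreal (cmod (cinner z y)) / N y)" .
qed

lemma avg_norm_subset:
  assumes p: "1 \<le> p" and QB: "Q \<subseteq> B"
    and Q: "emeasure lebesgue Q = ennreal a" "0 < a" and B: "emeasure lebesgue B = ennreal b" "0 < b"
  shows "avg_norm p N Q y \<le> ennreal ((b / a) powr (1 / p)) * avg_norm p N B y"
proof -
  define I where "I S = (\<integral>\<^sup>+s\<in>S. ennreal (N s y powr p) \<partial>lebesgue)" for S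
  have "I Q \<le> I B"
    unfolding I_def using QB by (intro nn_integral_mono) (auto simp: indicator_def)
  then have "I Q / ennreal a \<le> I B / ennreal a" by (rule divide_right_mono_ennreal)
  also have "\<dots> = ennreal (b / a) * (I B / ennreal b)"
  proof (cases "I B")
    case (real r)
    then show ?thesis using Q B by (simp add: divide_ennreal flip: ennreal_mult)
  next
    case top
    then show ?thesis using Q B by (simp add: ennreal_top_divide ennreal_mult_top)
  qed
  finally have "ennpowr (I Q / ennreal a) (1 / p) \<le> ennpowr (ennreal (b / a) * (I B / ennreal b)) (1 / p)"
    using p by (intro ennpowr_mono) auto
  then show ?thesis
    using p Q B by (simp add: avg_norm_def ennpowr_mult ennpowr_ennreal flip: I_def)
qed

section \<open>The Muckenhoupt condition\<close>

text \<open>Hoelder's inequality or, for \<open>p = 1\<close>, the essential supremum bounds the integral of \<open>G\<close> against the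
  dual weight by the averaged dual weight, which the Muckenhoupt condition compares with the dual of
  the averaged weight. In this form the condition enters the estimate of the coefficients.\<close>

lemma Ap_pairing:
  fixes W :: "real^'d \<Rightarrow> complex^'m^'m"
  assumes W: "W \<in> Ap_class A P p" and p: "1 \<le> p"
  obtains C where "0 < C"
    "\<And>B b G z. B \<in> dilated_balls A P \<Longrightarrow> B \<in> sets lebesgue \<Longrightarrow> emeasure lebesgue B = ennreal b \<Longrightarrow> 0 < b \<Longrightarrow>
      G \<in> borel_measurable lebesgue \<Longrightarrow> (\<And>t. 0 \<le> G t) \<Longrightarrow>
      (\<integral>\<^sup>+t\<in>B. ennreal (G t * weight_norm_dual p W t z) \<partial>lebesgue) \<le>
        ennreal (C * b powr (1 - 1 / p)) * ennpowr (\<integral>\<^sup>+t\<in>B. ennreal (G t powr p) \<partial>lebesgue) (1 / p) *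
        dual_norm (avg_norm p (weight_norm p W) B) z"
proof -
  have mw: "matrix_weight W" using W by (simp add: Ap_class_def)
  have [measurable]: "(\<lambda>t. weight_norm_dual p W t z) \<in> borel_measurable lebesgue" for z
    by (rule weight_norm_measurable[OF mw])
  have dual_nonneg: "0 \<le> weight_norm_dual p W t z" for t z by (simp add: weight_norm_dual_def)
  show thesis
  proof (cases "p = 1")
    case True
    then obtain C where C: "C > 0" "\<And>y B. B \<in> dilated_balls A P \<Longrightarrow>
        sup_norm (weight_norm_dual p W) B y \<le> ennreal C * dual_norm (avg_norm p (weight_norm p W) B) y"
      using W by (auto simp: Ap_class_def)
    show thesis
    proof (rule that[OF C(1)])
      fix B :: "(real^'d) set" and b :: real and G :: "real^'d \<Rightarrow> real" and z :: "complex^'m"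
      assume B: "B \<in> dilated_balls A P" "B \<in> sets lebesgue" "emeasure lebesgue B = ennreal b" "0 < b"
        and [measurable]: "G \<in> borel_measurable lebesgue" and G: "\<And>t. 0 \<le> (G t :: real)"
      note [measurable] = B(2)
      define S where "S = sup_norm (weight_norm_dual p W) B z"
      have "AE t in lebesgue_on B. ennreal (weight_norm_dual p W t z) \<le> S"
        unfolding S_def sup_norm_def by (rule esssup_AE)
      then have "AE t in lebesgue. t \<in> B \<longrightarrow> ennreal (weight_norm_dual p W t z) \<le> S"
        using B(2) by (subst (asm) AE_restrict_space_iff) auto
      then have "(\<integral>\<^sup>+t\<in>B. ennreal (G t * weight_norm_dual p W t z) \<partial>lebesgue) \<le>
          (\<integral>\<^sup>+t. S * (ennreal (G t powr p) * indicator B t) \<partial>lebesgue)"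
        using G True dual_nonneg
        by (intro nn_integral_mono_AE, elim AE_mp, intro AE_I2)
          (auto simp: indicator_def ennreal_mult mult.commute[of S] intro!: mult_left_mono)
      also have "\<dots> = S * (\<integral>\<^sup>+t\<in>B. ennreal (G t powr p) \<partial>lebesgue)"
        by (rule nn_integral_cmult) measurable
      also have "\<dots> \<le> (ennreal C * dual_norm (avg_norm p (weight_norm p W) B) z) * (\<integral>\<^sup>+t\<in>B. ennreal (G t powr p) \<partial>lebesgue)"
        unfolding S_def by (intro mult_right_mono C B) simp
      finally show "(\<integral>\<^sup>+t\<in>B. ennreal (G t * weight_norm_dual p W t z) \<partial>lebesgue) \<le>
        ennreal (C * b powr (1 - 1 / p)) * ennpowr (\<integral>\<^sup>+t\<in>B. ennreal (G t powr p) \<partial>lebesgue) (1 / p) *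
        dual_norm (avg_norm p (weight_norm p W) B) z"
        using True B by (simp add: mult_ac)
    qed
  next
    case False
    then have p1: "p > 1" using p by simp
    define q where "q = conj_exp p"
    have q: "q > 1" "1 / p + 1 / q = 1" "1 / q = 1 - 1 / p"
      using p1 by (auto simp: q_def conj_exp_def field_simps)
    from False obtain C where C: "C > 0" "\<And>y B. B \<in> dilated_balls A P \<Longrightarrow>
        avg_norm q (weight_norm_dual p W) B y \<le> ennreal C * dual_norm (avg_norm p (weight_norm p W) B) y"
      using W by (auto simp: Ap_class_def q_def)
    show thesis
    proof (rule that[OF C(1)])
      fix B :: "(real^'d) set" and b :: real and G :: "real^'d \<Rightarrow> real" and z :: "complex^'m"
      assume B: "B \<in> dilated_balls A P" "B \<in> sets lebesgue" "emeasure lebesgue B = ennreal b" "0 < b"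
        and [measurable]: "G \<in> borel_measurable lebesgue" and G: "\<And>t. 0 \<le> (G t :: real)"
      note [measurable] = B(2)
      define H where "H = (\<integral>\<^sup>+t\<in>B. ennreal (weight_norm_dual p W t z powr q) \<partial>lebesgue)"
      have ind: "ennreal ((x * indicator B t) powr r) = ennreal (x powr r) * indicator B t"
        for x r :: real and t by (simp add: indicator_def)
      have "(\<integral>\<^sup>+t\<in>B. ennreal (G t * weight_norm_dual p W t z) \<partial>lebesgue) =
          (\<integral>\<^sup>+t. ennreal ((G t * indicator B t) * (weight_norm_dual p W t z * indicator B t)) \<partial>lebesgue)"
        by (intro nn_integral_cong) (auto simp: indicator_def)
      also have "\<dots> \<le> ennpowr (\<integral>\<^sup>+t. ennreal ((G t * indicator B t) powr p) \<partial>lebesgue) (1 / p) *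
          ennpowr (\<integral>\<^sup>+t. ennreal ((weight_norm_dual p W t z * indicator B t) powr q) \<partial>lebesgue) (1 / q)"
        using G dual_nonneg by (intro nn_integral_Hoelder p1 q) (auto simp: indicator_def)
      also have "\<dots> = ennpowr (\<integral>\<^sup>+t\<in>B. ennreal (G t powr p) \<partial>lebesgue) (1 / p) * ennpowr H (1 / q)"
        by (simp only: ind H_def)
      also have "ennpowr H (1 / q) = ennreal (b powr (1 - 1 / p)) * avg_norm q (weight_norm_dual p W) B z"
      proof -
        have "H = ennreal b * (H / ennreal b)"
          using B(4) by (simp add: ennreal_times_divide mult.commute[of "ennreal b"] mult_divide_eq_ennreal)
        then have "ennpowr H (1 / q) = ennpowr (ennreal b * (H / ennreal b)) (1 / q)" by simp
        also have "\<dots> = ennreal (b powr (1 / q)) * ennpowr (H / ennreal b) (1 / q)"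
          using q(1) B(4) by (subst ennpowr_mult) (auto simp: ennpowr_ennreal)
        finally show ?thesis using B by (simp add: avg_norm_def H_def q(3))
      qed
      also have "ennpowr (\<integral>\<^sup>+t\<in>B. ennreal (G t powr p) \<partial>lebesgue) (1 / p) *
          (ennreal (b powr (1 - 1 / p)) * avg_norm q (weight_norm_dual p W) B z) \<le>
          ennpowr (\<integral>\<^sup>+t\<in>B. ennreal (G t powr p) \<partial>lebesgue) (1 / p) *
          (ennreal (b powr (1 - 1 / p)) * (ennreal C * dual_norm (avg_norm p (weight_norm p W) B) z))"
        by (intro mult_left_mono C B) auto
      also have "\<dots> = ennreal (C * b powr (1 - 1 / p)) * ennpowr (\<integral>\<^sup>+t\<in>B. ennreal (G t powr p) \<partial>lebesgue) (1 / p) *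
        dual_norm (avg_norm p (weight_norm p W) B) z"
        using C(1) by (simp add: ennreal_mult mult_ac)
      finally show "(\<integral>\<^sup>+t\<in>B. ennreal (G t * weight_norm_dual p W t z) \<partial>lebesgue) \<le>
        ennreal (C * b powr (1 - 1 / p)) * ennpowr (\<integral>\<^sup>+t\<in>B. ennreal (G t powr p) \<partial>lebesgue) (1 / p) *
        dual_norm (avg_norm p (weight_norm p W) B) z" .
    qed
  qed
qed

section \<open>Dilates of the ellipsoid\<close>

definition dilated_ellipsoid :: "real^'d^'d \<Rightarrow> real^'d^'d \<Rightarrow> int \<Rightarrow> (real^'d) set" where
  "dilated_ellipsoid A P k = (*v) (mat_powi A k) ` ellipsoid P"

lemma mem_dilated_ellipsoid:
  assumes "invertible A"
  shows "z \<in> dilated_ellipsoid A P k \<longleftrightarrow> norm (P *v (mat_powi A (- k) *v z)) < 1"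
proof
  assume "norm (P *v (mat_powi A (- k) *v z)) < 1"
  then show "z \<in> dilated_ellipsoid A P k"
    unfolding dilated_ellipsoid_def
    by (intro image_eqI[of _ _ "mat_powi A (- k) *v z"]) (auto simp: ellipsoid_def mat_powi_minus_cancel[OF assms])
qed (auto simp: dilated_ellipsoid_def ellipsoid_def mat_powi_minus_cancel[OF assms])

lemma matrix_vector_bounded:
  fixes M :: "real^'d^'e"
  obtains K where "0 < K" "\<And>x. norm (M *v x) \<le> K * norm x"
  using bounded_linear.pos_bounded[OF matrix_vector_mul_bounded_linear[of M]] by (metis mult.commute)

lemma ellipsoid_lmeasurable:
  assumes "adapted_ellipsoid A P"
  shows "ellipsoid P \<in> lmeasurable" "measure lebesgue (ellipsoid P) = 1"
proof -
  have "continuous_on UNIV (\<lambda>x. norm (P *v x))"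
    by (intro continuous_intros linear_continuous_on matrix_vector_mul_bounded_linear)
  then have "open (ellipsoid P)"
    unfolding ellipsoid_def by (intro open_Collect_less continuous_intros)
  moreover have "emeasure lebesgue (ellipsoid P) = 1" using assms by (simp add: adapted_ellipsoid_def)
  ultimately show "ellipsoid P \<in> lmeasurable" "measure lebesgue (ellipsoid P) = 1"
    by (auto simp: fmeasurable_def measure_def)
qed

text \<open>The volumes \<open>r ^ DIM(real^'d)\<close> and \<open>\<bar>det A\<bar>\<close> of \<open>r\<close> times the ellipsoid and of its image under \<open>A\<close>
  are compared.\<close>

lemma det_gt_1:
  fixes A P :: "real^'d^'d"
  assumes ad: "adapted_ellipsoid A P"
  shows "1 < \<bar>det A\<bar>"
proof -
  obtain r where r: "r > 1" and sub: "(*\<^sub>R) r ` ellipsoid P \<subseteq> (*v) A ` ellipsoid P"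
    using ad by (auto simp: adapted_ellipsoid_def)
  have A: "(*v) A ` ellipsoid P \<in> lmeasurable" "measure lebesgue ((*v) A ` ellipsoid P) = \<bar>det A\<bar>"
    using measure_matrix_image[OF ellipsoid_lmeasurable(1)[OF ad], of A] ellipsoid_lmeasurable(2)[OF ad] by auto
  have "1 < r ^ DIM(real^'d)" using r by (intro one_less_power) auto
  have "ennreal (r ^ DIM(real^'d)) = emeasure lebesgue ((*\<^sub>R) r ` ellipsoid P)"
    using emeasure_lebesgue_affine[of r 0 "ellipsoid P"] r ad
    by (simp add: adapted_ellipsoid_def image_def)
  also have "\<dots> \<le> emeasure lebesgue ((*v) A ` ellipsoid P)"
    using A by (intro emeasure_mono sub) auto
  also have "\<dots> = ennreal \<bar>det A\<bar>" using A by (simp add: emeasure_eq_measure2)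
  finally have "r ^ DIM(real^'d) \<le> \<bar>det A\<bar>" by (simp add: ennreal_le_iff)
  with \<open>1 < r ^ DIM(real^'d)\<close> show ?thesis by linarith
qed

lemma preimage_affine:
  fixes A :: "real^'d^'d"
  assumes A: "invertible A" and S: "S \<in> lmeasurable"
  shows "{y. mat_powi A k *v y - c \<in> S} \<in> lmeasurable"
    "emeasure lebesgue {y. mat_powi A k *v y - c \<in> S} = ennreal (\<bar>det A\<bar> powi (- k) * measure lebesgue S)"
proof -
  have eq: "{y. mat_powi A k *v y - c \<in> S} = (*v) (mat_powi A (- k)) ` (+) c ` S"
  proof safe
    fix y assume "mat_powi A k *v y - c \<in> S"
    then have "c + (mat_powi A k *v y - c) \<in> (+) c ` S" by blast
    then have "mat_powi A k *v y \<in> (+) c ` S" by simp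
    then have "mat_powi A (- k) *v (mat_powi A k *v y) \<in> (*v) (mat_powi A (- k)) ` (+) c ` S" by blast
    then show "y \<in> (*v) (mat_powi A (- k)) ` (+) c ` S" by (simp only: mat_powi_minus_cancel[OF A])
  qed (simp add: mat_powi_minus_cancel[OF A])
  have "(+) c ` S \<in> lmeasurable" "measure lebesgue ((+) c ` S) = measure lebesgue S"
    using S by (auto simp: measurable_translation measure_translation)
  with measure_matrix_image[of "(+) c ` S" "mat_powi A (- k)"]
  have *: "{y. mat_powi A k *v y - c \<in> S} \<in> lmeasurable"
    "measure lebesgue {y. mat_powi A k *v y - c \<in> S} = \<bar>det A\<bar> powi (- k) * measure lebesgue S"
    unfolding eq by (auto simp: det_mat_powi[OF A] power_int_abs)
  from *(1) show "{y. mat_powi A k *v y - c \<in> S} \<in> lmeasurable" .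
  show "emeasure lebesgue {y. mat_powi A k *v y - c \<in> S} = ennreal (\<bar>det A\<bar> powi (- k) * measure lebesgue S)"
    unfolding emeasure_eq_measure2[OF *(1)] *(2) ..
qed

lemma dilated_ellipsoid_lmeasurable:
  assumes "adapted_ellipsoid A P" "invertible A"
  shows "dilated_ellipsoid A P k \<in> lmeasurable" "measure lebesgue (dilated_ellipsoid A P k) = \<bar>det A\<bar> powi k"
  using measure_matrix_image[OF ellipsoid_lmeasurable(1)[OF assms(1)], of "mat_powi A k"]
    ellipsoid_lmeasurable(2)[OF assms(1)]
  by (auto simp: dilated_ellipsoid_def det_mat_powi[OF assms(2)] power_int_abs)

text \<open>The affine maps that carry the dilated cubes to the unit cube permute the dilated balls. All cubes
  can therefore be treated on the scale of the unit cube.\<close>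

lemma preimage_dilated_ellipsoid_ball:
  assumes A: "invertible A"
  shows "{y. mat_powi A k *v y - c \<in> dilated_ellipsoid A P m} \<in> dilated_balls A P"
proof -
  have "{y. mat_powi A k *v y - c \<in> dilated_ellipsoid A P m} =
      (\<lambda>y. mat_powi A (- k) *v c + y) ` ((*v) (mat_powi A (m - k)) ` ellipsoid P)"
  proof safe
    fix y assume "mat_powi A k *v y - c \<in> dilated_ellipsoid A P m"
    then obtain x where x: "x \<in> ellipsoid P" "mat_powi A k *v y - c = mat_powi A m *v x"
      by (auto simp: dilated_ellipsoid_def)
    have "y = mat_powi A (- k) *v (c + mat_powi A m *v x)"
      using x(2) by (simp add: mat_powi_minus_cancel[OF A] flip: x(2))
    also have "\<dots> = mat_powi A (- k) *v c + mat_powi A (m - k) *v x"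
      using mat_powi_add[OF A, of "- k" m]
      by (simp add: matrix_vector_right_distrib matrix_vector_mul_assoc)
    finally show "y \<in> (\<lambda>y. mat_powi A (- k) *v c + y) ` ((*v) (mat_powi A (m - k)) ` ellipsoid P)"
      using x(1) by blast
  next
    fix x assume "x \<in> ellipsoid P"
    moreover have "mat_powi A k *v (mat_powi A (- k) *v c + mat_powi A (m - k) *v x) - c = mat_powi A m *v x"
      using mat_powi_add[OF A, of k "m - k"]
      by (simp add: matrix_vector_right_distrib mat_powi_minus_cancel[OF A] matrix_vector_mul_assoc)
    ultimately show "mat_powi A k *v (mat_powi A (- k) *v c + mat_powi A (m - k) *v x) - c \<in> dilated_ellipsoid A P m"
      by (simp add: dilated_ellipsoid_def)
  qed
  then show ?thesis unfolding dilated_balls_def by blast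
qed

text \<open>The inverse of \<open>A\<close> contracts the gauge of the ellipsoid, so its dilates exhaust space at an
  exponential rate.\<close>

lemma dilated_ellipsoid_contains:
  fixes A P :: "real^'d^'d"
  assumes ad: "adapted_ellipsoid A P"
  obtains r L where "1 < r" "0 < L"
    "\<And>n z. L * norm z < r ^ n \<Longrightarrow> z \<in> dilated_ellipsoid A P (int n)"
proof -
  obtain r where r: "1 < r" and A: "invertible A"
    and le: "\<And>x. norm (P *v (matrix_inv A *v x)) \<le> norm (P *v x) / r"
    using adapted_ellipsoid_contraction[OF ad] by blast
  obtain L where L: "0 < L" "\<And>x. norm (P *v x) \<le> L * norm x" using matrix_vector_bounded by blast
  have "z \<in> dilated_ellipsoid A P (int n)" if "L * norm z < r ^ n" for n z
  proof -
    have "norm (P *v (mat_powi A (- int n) *v z)) \<le> norm (P *v z) / r ^ n"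
      using r by (intro contraction_powi A le) auto
    also have "\<dots> \<le> (L * norm z) / r ^ n" using r by (intro divide_right_mono L) auto
    also have "\<dots> < 1" using that r by simp
    finally show ?thesis by (simp add: mem_dilated_ellipsoid[OF A])
  qed
  with r L(1) that show thesis by blast
qed

lemma dilated_ellipsoid_contains_cube:
  fixes A P :: "real^'d^'d"
  assumes ad: "adapted_ellipsoid A P"
  obtains n0 :: nat where "\<And>n. n0 \<le> n \<Longrightarrow> cbox 0 1 \<subseteq> dilated_ellipsoid A P (int n)"
proof -
  obtain r L where rL: "1 < r" "0 < L" "\<And>n z. L * norm z < r ^ n \<Longrightarrow> z \<in> dilated_ellipsoid A P (int n)"
    using dilated_ellipsoid_contains[OF ad] by blast
  obtain B where B: "\<And>z. z \<in> cbox 0 (1::real^'d) \<Longrightarrow> norm z \<le> B"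
    using bounded_cbox[of 0 "1::real^'d"] unfolding bounded_iff by blast
  obtain n0 where n0: "L * B < r ^ n0" using real_arch_pow[OF rL(1)] by blast
  have "cbox 0 1 \<subseteq> dilated_ellipsoid A P (int n)" if "n0 \<le> n" for n
  proof
    fix z assume "z \<in> cbox 0 (1::real^'d)"
    then have "L * norm z \<le> L * B" using B rL(2) by (intro mult_left_mono) auto
    also note n0
    also have "r ^ n0 \<le> r ^ n" using that rL(1) by (intro power_increasing) auto
    finally show "z \<in> dilated_ellipsoid A P (int n)" by (rule rL(3))
  qed
  then show thesis by (rule that)
qed

text \<open>The growth is at most geometric as well; \<open>a\<close> is an operator bound of \<open>A\<close>.\<close>

lemma dilated_ellipsoid_growth:
  fixes A P :: "real^'d^'d"
  assumes ad: "adapted_ellipsoid A P"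
  obtains R a where "1 \<le> R" "1 \<le> a"
    "\<And>n z. z \<in> dilated_ellipsoid A P (int n) \<Longrightarrow> 1 + norm z \<le> R * a ^ n"
proof -
  obtain r where A: "invertible A" and P: "invertible P"
    using adapted_ellipsoid_contraction[OF ad] by metis
  obtain K where K: "0 < K" "\<And>x. norm (A *v x) \<le> K * norm x" using matrix_vector_bounded by blast
  obtain L where L: "0 < L" "\<And>x. norm (matrix_inv P *v x) \<le> L * norm x" using matrix_vector_bounded by blast
  define a where "a = max 1 K"
  have pow: "norm (mat_powi A (int n) *v x) \<le> a ^ n * norm x" for n x
  proof (induction n)
    case (Suc n)
    have "mat_powi A (int (Suc n)) *v x = A *v (mat_powi A (int n) *v x)"
      using mat_powi_succ[OF A, of "int n"] by (simp add: matrix_vector_mul_assoc add.commute)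
    also have "norm \<dots> \<le> K * norm (mat_powi A (int n) *v x)" by (rule K)
    also have "\<dots> \<le> a * (a ^ n * norm x)" using Suc K by (intro mult_mono) (auto simp: a_def)
    finally show ?case by (simp add: mult.assoc)
  qed simp
  show thesis
  proof (rule that[of "1 + L" a])
    fix n z assume "z \<in> dilated_ellipsoid A P (int n)"
    then obtain x where x: "z = mat_powi A (int n) *v x" "norm (P *v x) < 1"
      by (auto simp: dilated_ellipsoid_def ellipsoid_def)
    have "norm x = norm (matrix_inv P *v (P *v x))" by (simp add: matrix_vector_mul_assoc matrix_inv_mult[OF P])
    also have "\<dots> \<le> L * norm (P *v x)" by (rule L)
    also have "\<dots> \<le> L * 1" using x L by (intro mult_left_mono) auto
    finally have "norm z \<le> a ^ n * L"
      using pow[of n x] unfolding x(1) by (smt (verit) a_def max.cobounded1 mult_left_mono zero_le_power)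
    moreover have "1 \<le> a ^ n" by (simp add: a_def one_le_power)
    ultimately show "1 + norm z \<le> (1 + L) * a ^ n" by (simp add: algebra_simps)
  qed (use L in \<open>auto simp: a_def\<close>)
qed

text \<open>A point outside all but the large dilates of the ellipsoid has a norm of at least exponential
  size in their index, so a high power of \<open>1 + norm z\<close> exceeds the prescribed geometric rate \<open>q\<close>.\<close>

lemma rapidly_decreasing_dilated_ellipsoid:
  fixes A P :: "real^'d^'d"
  assumes ad: "adapted_ellipsoid A P" and g: "rapidly_decreasing g" and q: "0 < q"
  obtains C where "0 \<le> C"
    "\<And>z. \<exists>l. z \<in> dilated_ellipsoid A P (int (n0 + l)) \<and> cmod (g z) \<le> C / q ^ l"
proof -
  obtain r L where rL: "1 < r" "0 < L" "\<And>n z. L * norm z < r ^ n \<Longrightarrow> z \<in> dilated_ellipsoid A P (int n)"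
    using dilated_ellipsoid_contains[OF ad] by blast
  obtain M where M: "q < r ^ M" using real_arch_pow[OF rL(1)] by blast
  obtain C1 where C1: "0 \<le> C1" "\<And>z. (1 + norm z) ^ M * cmod (g z) \<le> C1"
    using rapidly_decreasingE[OF g] by metis
  obtain C0 where C0: "0 \<le> C0" "\<And>z. cmod (g z) \<le> C0" using rapidly_decreasing_bounded[OF g] by blast
  define C where "C = C0 + C1 * (L ^ M * q)"
  have "\<exists>l. z \<in> dilated_ellipsoid A P (int (n0 + l)) \<and> cmod (g z) \<le> C / q ^ l" for z
  proof -
    obtain n where "L * norm z < r ^ n" using real_arch_pow[OF rL(1)] by blast
    moreover have "r ^ n \<le> r ^ (n0 + n)" using rL(1) by (intro power_increasing) auto
    ultimately have "\<exists>l. L * norm z < r ^ (n0 + l)" by (meson less_le_trans)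
    \<comment> \<open>since \<open>l\<close> is least, \<open>norm z\<close> is at least of the order \<open>r ^ l\<close>\<close>
    then obtain l where l: "L * norm z < r ^ (n0 + l)" "\<And>k. k < l \<Longrightarrow> \<not> L * norm z < r ^ (n0 + k)"
      using exists_least_iff[of "\<lambda>l. L * norm z < r ^ (n0 + l)"] by blast
    have "cmod (g z) \<le> C / q ^ l"
    proof (cases l)
      case 0
      have "0 \<le> C1 * (L ^ M * q)" using C1 rL q by simp
      then show ?thesis using C0(2)[of z] 0 by (simp add: C_def)
    next
      case (Suc k)
      have "r ^ k \<le> r ^ (n0 + k)" using rL(1) by (intro power_increasing) auto
      also have "\<dots> \<le> L * (1 + norm z)" using l(2)[of k] Suc rL(2) by (simp add: distrib_left)
      finally have "(r ^ k) ^ M \<le> (L * (1 + norm z)) ^ M" using rL(1) by (intro power_mono) auto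
      moreover have "q ^ k \<le> (r ^ M) ^ k" using M q by (intro power_mono) auto
      moreover have "(r ^ M) ^ k = (r ^ k) ^ M" by (simp add: mult.commute flip: power_mult)
      ultimately have qk: "q ^ k \<le> (L * (1 + norm z)) ^ M" by simp
      have "q ^ k * cmod (g z) \<le> (L * (1 + norm z)) ^ M * cmod (g z)"
        by (intro mult_right_mono qk) simp
      also have "\<dots> = L ^ M * ((1 + norm z) ^ M * cmod (g z))" by (simp add: power_mult_distrib)
      also have "\<dots> \<le> L ^ M * C1" using rL by (intro mult_left_mono C1) auto
      finally have "q * (q ^ k * cmod (g z)) \<le> q * (L ^ M * C1)" using q by (intro mult_left_mono) auto
      then have "q ^ l * cmod (g z) \<le> C" using C0(1) by (simp add: C_def Suc mult_ac)
      then show ?thesis using q by (simp add: field_simps)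
    qed
    with rL(3)[OF l(1)] show ?thesis by blast
  qed
  moreover have "0 \<le> C" using C0 C1 rL q by (simp add: C_def)
  ultimately show thesis using that by blast
qed

section \<open>Lattice sums\<close>

lemma countable_int_vec: "countable (UNIV :: (int^'d) set)"
proof -
  have "inj (vec_nth :: int^'d \<Rightarrow> 'd \<Rightarrow> int)" by (auto intro: injI simp: vec_eq_iff)
  then show ?thesis using countable_image_inj_on[of vec_nth "UNIV :: (int^'d) set"]
    by (metis countableI_type inj_on_subset subset_UNIV)
qed

lemma infsum_eq_nn_integral:
  fixes f :: "'a \<Rightarrow> ennreal"
  assumes "countable A"
  shows "(\<Sum>\<^sub>\<infinity>x\<in>A. f x) = (\<integral>\<^sup>+x. f x \<partial>count_space A)"
proof (cases "finite A")
  case True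
  then show ?thesis by (simp add: nn_integral_count_space_finite)
next
  case False
  have bij: "bij_betw (from_nat_into A) UNIV A" using assms False by (rule bij_betw_from_nat_into)
  have "(\<Sum>\<^sub>\<infinity>x\<in>A. f x) = (\<Sum>\<^sub>\<infinity>n. f (from_nat_into A n))"
    by (rule infsum_reindex_bij_betw[OF bij, symmetric])
  also have "\<dots> = (\<Sum>n. f (from_nat_into A n))"
  proof -
    have "(\<lambda>n. f (from_nat_into A n)) summable_on UNIV" by (rule nonneg_summable_on_complete) simp
    then have "(\<lambda>n. f (from_nat_into A n)) sums (\<Sum>\<^sub>\<infinity>n. f (from_nat_into A n))"
      by (intro has_sum_imp_sums has_sum_infsum)
    then show ?thesis by (rule sums_unique)
  qed
  also have "\<dots> = (\<integral>\<^sup>+n. f (from_nat_into A n) \<partial>count_space UNIV)"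
    by (simp add: nn_integral_count_space_nat)
  also have "\<dots> = (\<integral>\<^sup>+x. f x \<partial>count_space A)"
    by (rule nn_integral_bij_count_space[OF bij])
  finally show ?thesis .
qed

lemma nn_integral_translate:
  fixes f :: "real^'d \<Rightarrow> ennreal"
  assumes [measurable]: "f \<in> borel_measurable borel"
  shows "(\<integral>\<^sup>+x. f (x - a) \<partial>lborel) = (\<integral>\<^sup>+x. f x \<partial>lborel)"
  by (subst (2) lborel_translate[of a, symmetric]) (simp add: nn_integral_distr)

definition lattice_kernel :: "real^'d \<Rightarrow> real" where
  "lattice_kernel z = 1 / (1 + norm z) ^ (DIM(real^'d) + 1)"

lemma lattice_kernel_borel [measurable]: "lattice_kernel \<in> borel_measurable borel"
  unfolding lattice_kernel_def[abs_def] by measurable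

lemma lattice_kernel_nonneg: "0 \<le> lattice_kernel z"
  by (simp add: lattice_kernel_def)

text \<open>Each term is comparable with the integral of the kernel over the open unit cube at the lattice
  point. These cubes are disjoint, so the sum is bounded by the integral over the whole space.\<close>

lemma lattice_sum_bounded:
  obtains M where "0 \<le> M"
    "\<And>z::real^'d. (\<integral>\<^sup>+j. ennreal (lattice_kernel (z - int_vec j)) \<partial>count_space UNIV) \<le> ennreal M"
proof -
  define m where "m = DIM(real^'d) + 1"
  obtain B where B: "\<And>z. z \<in> cbox 0 (1::real^'d) \<Longrightarrow> norm z \<le> B"
    using bounded_cbox[of 0 "1::real^'d"] unfolding bounded_iff by blast
  have "0 \<le> B" using B[of 0] by (auto simp: mem_box_cart)
  define I where "I = (LINT z::real^'d|lborel. lattice_kernel z)"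
  have I: "(\<integral>\<^sup>+(z::real^'d). ennreal (lattice_kernel z) \<partial>lborel) = ennreal I"
    unfolding I_def using integrable_inverse_power_norm[where 'a = "real^'d"]
    by (intro nn_integral_eq_integral) (auto simp: lattice_kernel_def[abs_def])
  define K where "K = (1 + B) ^ m"
  define D where "D j = box (int_vec j) (int_vec j + 1 :: real^'d)" for j
  have [measurable]: "D j \<in> sets borel" for j by (simp add: D_def)
  have D1: "emeasure lborel (D j) = 1" for j
  proof -
    have one: "(1::real^'d) \<bullet> b = 1" if "b \<in> Basis" for b
      using that by (auto simp: Basis_vec_def inner_axis)
    then have "emeasure lborel (D j) = ennreal (\<Prod>b\<in>Basis. (int_vec j + 1 - int_vec j :: real^'d) \<bullet> b)"
      unfolding D_def by (intro emeasure_lborel_box) (simp add: inner_add_left)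
    also have "(\<Prod>b\<in>Basis. (int_vec j + 1 - int_vec j :: real^'d) \<bullet> b) = 1"
      using one by (intro prod.neutral) (simp add: inner_add_left)
    finally show ?thesis by simp
  qed
  have pt: "lattice_kernel (z - int_vec j) \<le> K * lattice_kernel (t - z)" if "t \<in> D j" for z t :: "real^'d" and j
  proof -
    have "t - int_vec j \<in> cbox 0 1" using that by (auto simp: D_def mem_box_cart int_vec_def less_imp_le algebra_simps)
    then have "norm (t - int_vec j) \<le> B" by (rule B)
    have "1 + norm (t - z) \<le> (1 + norm (int_vec j - z)) * (1 + norm (t - int_vec j))"
      using one_plus_norm_triangle[of "int_vec j - z" "t - int_vec j"] by simp
    also have "\<dots> \<le> (1 + norm (z - int_vec j)) * (1 + B)"
      using \<open>norm (t - int_vec j) \<le> B\<close> by (intro mult_mono) (auto simp: norm_minus_commute)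
    finally have "(1 + norm (t - z)) ^ m \<le> ((1 + norm (z - int_vec j)) * (1 + B)) ^ m"
      by (intro power_mono) auto
    then have "(1 + norm (t - z)) ^ m \<le> (1 + norm (z - int_vec j)) ^ m * K"
      by (simp add: K_def power_mult_distrib)
    moreover have "0 < (1 + norm (t - z)) ^ m" "0 < (1 + norm (z - int_vec j)) ^ m"
      by (auto intro!: zero_less_power add_pos_nonneg)
    moreover have "lattice_kernel w = 1 / (1 + norm w) ^ m" for w :: "real^'d"
      by (simp only: lattice_kernel_def m_def)
    ultimately show ?thesis by (simp add: field_simps)
  qed
  have "(\<integral>\<^sup>+j. ennreal (lattice_kernel (z - int_vec j)) \<partial>count_space UNIV) \<le> ennreal (K * I)" for z :: "real^'d"
  proof -
    have "ennreal (lattice_kernel (z - int_vec j)) \<le> (\<integral>\<^sup>+t. ennreal (K * lattice_kernel (t - z)) * indicator (D j) t \<partial>lborel)" for j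
    proof -
      have "ennreal (lattice_kernel (z - int_vec j)) = (\<integral>\<^sup>+t. ennreal (lattice_kernel (z - int_vec j)) * indicator (D j) t \<partial>lborel)"
        by (simp add: nn_integral_cmult_indicator D1)
      also have "\<dots> \<le> (\<integral>\<^sup>+t. ennreal (K * lattice_kernel (t - z)) * indicator (D j) t \<partial>lborel)"
        using pt by (intro nn_integral_mono) (auto simp: indicator_def intro!: ennreal_leI)
      finally show ?thesis .
    qed
    then have "(\<integral>\<^sup>+j. ennreal (lattice_kernel (z - int_vec j)) \<partial>count_space UNIV) \<le>
        (\<integral>\<^sup>+j. (\<integral>\<^sup>+t. ennreal (K * lattice_kernel (t - z)) * indicator (D j) t \<partial>lborel) \<partial>count_space UNIV)"
      by (intro nn_integral_mono)
    also have "\<dots> = (\<integral>\<^sup>+t. (\<integral>\<^sup>+j. ennreal (K * lattice_kernel (t - z)) * indicator (D j) t \<partial>count_space UNIV) \<partial>lborel)"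
      by (rule nn_integral_count_space_nn_integral[symmetric, OF countable_int_vec]) measurable
    also have "\<dots> \<le> (\<integral>\<^sup>+t. ennreal (K * lattice_kernel (t - z)) \<partial>lborel)"
    proof (rule nn_integral_mono)
      fix t :: "real^'d"
      have eq: "(\<integral>\<^sup>+j. ennreal (K * lattice_kernel (t - z)) * indicator (D j) t \<partial>count_space UNIV) =
          ennreal (K * lattice_kernel (t - z)) * (\<integral>\<^sup>+j. indicator {j. t \<in> D j} j \<partial>count_space UNIV)"
        by (subst nn_integral_cmult[symmetric]) (auto simp: indicator_def intro!: nn_integral_cong)
      have "(\<integral>\<^sup>+j. indicator {j. t \<in> D j} j \<partial>count_space UNIV) = emeasure (count_space UNIV) {j. t \<in> D j}"
        by (rule nn_integral_indicator) simp
      also have "\<dots> \<le> emeasure (count_space UNIV) {\<chi> i. \<lfloor>t $ i\<rfloor>}"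
      proof (rule emeasure_mono)
        show "{j. t \<in> D j} \<subseteq> {\<chi> i. \<lfloor>t $ i\<rfloor>}"
        proof
          fix j assume "j \<in> {j. t \<in> D j}"
          then have "t \<in> D j" by simp
          then have ti: "real_of_int (j $ i) < t $ i \<and> t $ i < real_of_int (j $ i) + 1" for i
            unfolding D_def mem_box_cart int_vec_def by simp
          have "\<lfloor>t $ i\<rfloor> = j $ i" for i
            using ti[of i] by (intro floor_unique) auto
          then show "j \<in> {\<chi> i. \<lfloor>t $ i\<rfloor>}" by (simp add: vec_eq_iff)
        qed
      qed simp
      also have "\<dots> = 1" by simp
      finally show "(\<integral>\<^sup>+j. ennreal (K * lattice_kernel (t - z)) * indicator (D j) t \<partial>count_space UNIV) \<le>
          ennreal (K * lattice_kernel (t - z))"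
        unfolding eq using mult_left_mono[of _ 1 "ennreal (K * lattice_kernel (t - z))"] by simp
    qed
    also have "\<dots> = ennreal K * (\<integral>\<^sup>+t. ennreal (lattice_kernel (t - z)) \<partial>lborel)"
      using \<open>0 \<le> B\<close> by (subst nn_integral_cmult[symmetric]) (auto simp: K_def ennreal_mult lattice_kernel_nonneg)
    also have "\<dots> = ennreal K * ennreal I"
      using nn_integral_translate[of "\<lambda>t. ennreal (lattice_kernel t)" z] by (simp add: I)
    finally show ?thesis using \<open>0 \<le> B\<close> by (simp add: K_def ennreal_mult I_def lattice_kernel_nonneg)
  qed
  moreover have "0 \<le> K * I" using \<open>0 \<le> B\<close> by (simp add: K_def I_def lattice_kernel_nonneg)
  ultimately show thesis using that by blast
qed

section \<open>Shifted sums\<close>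

text \<open>A shift of the index by \<open>i\<close> multiplies the weights by the constant \<open>b powr (- (of_int i * \<alpha>))\<close>. As
  there are finitely many shifts, comparison of a sum with its largest term takes the place of the
  triangle inequality and covers \<open>q < 1\<close> too.\<close>

lemma weighted_lq_norm_shift:
  fixes a c :: "int \<Rightarrow> ennreal"
  assumes b: "0 < b" and q: "0 < q" and C: "0 \<le> C" and I: "finite I"
    and le: "\<And>k. a k \<le> ennreal C * (\<Sum>i\<in>I. c (k + i))"
  shows "weighted_lq_norm b \<alpha> q a \<le>
    ennreal (if q = \<infinity> then C * (\<Sum>i\<in>I. b powr (- (of_int i * \<alpha>)))
      else (C powr enn2real q * real (card I) powr enn2real q *
        (\<Sum>i\<in>I. b powr (- (of_int i * \<alpha> * enn2real q)))) powr (1 / enn2real q)) * weighted_lq_norm b \<alpha> q c"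
proof (cases "q = \<infinity>")
  case True
  define S where "S = (SUP k. ennreal (b powr (of_int k * \<alpha>)) * c k)"
  have "ennreal (b powr (of_int k * \<alpha>)) * a k \<le> ennreal (C * (\<Sum>i\<in>I. b powr (- (of_int i * \<alpha>)))) * S" for k
  proof -
    have "ennreal (b powr (of_int k * \<alpha>)) * a k \<le> ennreal (b powr (of_int k * \<alpha>)) * (ennreal C * (\<Sum>i\<in>I. c (k + i)))"
      by (intro mult_left_mono le) simp
    also have "\<dots> = ennreal C * (\<Sum>i\<in>I. ennreal (b powr (- (of_int i * \<alpha>))) * (ennreal (b powr (of_int (k + i) * \<alpha>)) * c (k + i)))"
    proof -
      have "ennreal (b powr (of_int k * \<alpha>)) = ennreal (b powr (- (of_int i * \<alpha>))) * ennreal (b powr (of_int (k + i) * \<alpha>))" for i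
        by (simp add: algebra_simps flip: ennreal_mult powr_add)
      then have "ennreal (b powr (of_int k * \<alpha>)) * c (k + i) =
          ennreal (b powr (- (of_int i * \<alpha>))) * (ennreal (b powr (of_int (k + i) * \<alpha>)) * c (k + i))" for i
        by (metis mult.assoc)
      then show ?thesis by (simp add: mult.left_commute[of _ "ennreal C"] sum_distrib_left)
    qed
    also have "\<dots> \<le> ennreal C * (\<Sum>i\<in>I. ennreal (b powr (- (of_int i * \<alpha>))) * S)"
      unfolding S_def by (intro mult_left_mono sum_mono SUP_upper) auto
    also have "\<dots> = ennreal (C * (\<Sum>i\<in>I. b powr (- (of_int i * \<alpha>)))) * S"
      using C by (simp add: ennreal_mult sum_nonneg mult.assoc flip: sum_distrib_right)
    finally show ?thesis .
  qed
  then show ?thesis using True by (auto simp: weighted_lq_norm_def S_def intro!: SUP_least)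
next
  case False
  define r where "r = enn2real q"
  have r: "0 < r" using q False by (simp add: r_def enn2real_positive_iff less_top)
  define w where "w k = ennreal (b powr (of_int k * \<alpha> * r))" for k :: int
  define S where "S = (\<integral>\<^sup>+k. w k * ennpowr (c k) r \<partial>count_space UNIV)"
  define K where "K = C powr r * real (card I) powr r"
  have "(\<integral>\<^sup>+k. w k * ennpowr (a k) r \<partial>count_space UNIV) \<le>
      (\<integral>\<^sup>+k. ennreal K * (\<Sum>i\<in>I. ennreal (b powr (- (of_int i * \<alpha> * r))) * (w (k + i) * ennpowr (c (k + i)) r)) \<partial>count_space UNIV)"
  proof (rule nn_integral_mono)
    fix k :: int
    have "ennpowr (a k) r \<le> ennpowr (ennreal C * (\<Sum>i\<in>I. c (k + i))) r"
      using r by (intro ennpowr_mono le) auto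
    also have "\<dots> \<le> ennreal (C powr r) * (ennreal (real (card I) powr r) * (\<Sum>i\<in>I. ennpowr (c (k + i)) r))"
      unfolding ennpowr_mult[OF r] ennpowr_ennreal[OF C] by (intro mult_left_mono ennpowr_sum_le I r) simp
    also have "\<dots> = ennreal K * (\<Sum>i\<in>I. ennpowr (c (k + i)) r)"
      by (simp add: K_def ennreal_mult mult.assoc)
    finally have "w k * ennpowr (a k) r \<le> w k * (ennreal K * (\<Sum>i\<in>I. ennpowr (c (k + i)) r))"
      by (rule mult_left_mono) simp
    also have "\<dots> = ennreal K * (\<Sum>i\<in>I. w k * ennpowr (c (k + i)) r)"
      by (simp add: mult.left_commute[of _ "ennreal K"] sum_distrib_left)
    also have "\<dots> = ennreal K * (\<Sum>i\<in>I. ennreal (b powr (- (of_int i * \<alpha> * r))) * (w (k + i) * ennpowr (c (k + i)) r))"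
    proof -
      have "w k = ennreal (b powr (- (of_int i * \<alpha> * r))) * w (k + i)" for i
        unfolding w_def by (simp add: algebra_simps flip: ennreal_mult powr_add)
      then have "w k * x = ennreal (b powr (- (of_int i * \<alpha> * r))) * (w (k + i) * x)" for i x
        by (metis mult.assoc)
      then show ?thesis by metis
    qed
    finally show "w k * ennpowr (a k) r \<le>
      ennreal K * (\<Sum>i\<in>I. ennreal (b powr (- (of_int i * \<alpha> * r))) * (w (k + i) * ennpowr (c (k + i)) r))" .
  qed
  also have "\<dots> = ennreal K * (\<Sum>i\<in>I. ennreal (b powr (- (of_int i * \<alpha> * r))) *
      (\<integral>\<^sup>+k. w (k + i) * ennpowr (c (k + i)) r \<partial>count_space UNIV))"
    by (simp add: nn_integral_cmult nn_integral_sum)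
  also have "\<dots> = ennreal K * (\<Sum>i\<in>I. ennreal (b powr (- (of_int i * \<alpha> * r))) * S)"
  proof -
    have "(\<integral>\<^sup>+k. w (k + i) * ennpowr (c (k + i)) r \<partial>count_space UNIV) = S" for i :: int
      unfolding S_def
      by (rule nn_integral_bij_count_space[of "\<lambda>k. k + i" UNIV UNIV "\<lambda>k. w k * ennpowr (c k) r"])
        (auto intro!: bij_betw_byWitness[of _ "\<lambda>k. k - i"])
    then show ?thesis by simp
  qed
  also have "\<dots> = ennreal (K * (\<Sum>i\<in>I. b powr (- (of_int i * \<alpha> * r)))) * S"
    by (simp add: K_def ennreal_mult sum_nonneg mult.assoc flip: sum_distrib_right)
  finally have "ennpowr (\<integral>\<^sup>+k. w k * ennpowr (a k) r \<partial>count_space UNIV) (1 / r) \<le>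
      ennpowr (ennreal (K * (\<Sum>i\<in>I. b powr (- (of_int i * \<alpha> * r)))) * S) (1 / r)"
    using r by (intro ennpowr_mono) auto
  also have "\<dots> = ennreal ((K * (\<Sum>i\<in>I. b powr (- (of_int i * \<alpha> * r)))) powr (1 / r)) * ennpowr S (1 / r)"
    using r by (subst ennpowr_mult) (auto simp: ennpowr_ennreal K_def sum_nonneg)
  finally show ?thesis
    using False by (simp add: weighted_lq_norm_def infsum_eq_nn_integral w_def S_def K_def r_def)
qed

section \<open>The estimate on a single cube\<close>

text \<open>The pairing on a ball \<open>B\<close>, as estimated in the assumption \<open>ap\<close>, is compared with quantities in which
  \<open>B\<close> no longer occurs: the dual of the average norm over \<open>B\<close> with the one over \<open>Q\<close>, and the integral over
  \<open>B\<close> with an integral against the weight \<open>\<kappa>\<close>. The price is the ratio \<open>\<beta>\<close> of the volumes and the bound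
  \<open>e\<close> of \<open>1 / \<kappa>\<close> on \<open>B\<close>.\<close>

lemma ball_pairing:
  fixes W :: "real^'d \<Rightarrow> complex^'m^'m"
  assumes mw: "matrix_weight W" and p: "1 \<le> p"
    and ap: "(\<integral>\<^sup>+t\<in>B. ennreal (G t * weight_norm_dual p W t z) \<partial>lebesgue) \<le>
        ennreal (C * (\<delta> * \<beta>) powr (1 - 1 / p)) * ennpowr (\<integral>\<^sup>+t\<in>B. ennreal (G t powr p) \<partial>lebesgue) (1 / p) *
        dual_norm (avg_norm p (weight_norm p W) B) z"
    and C: "0 < C" and QB: "Q \<subseteq> B"
    and Q: "emeasure lebesgue Q = ennreal \<delta>" "0 < \<delta>" and B: "emeasure lebesgue B = ennreal (\<delta> * \<beta>)" "0 < \<beta>"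
    and e: "1 \<le> e" and \<kappa>: "\<And>y. 0 \<le> \<kappa> y" "\<And>y. y \<in> B \<Longrightarrow> 1 \<le> e * \<kappa> y"
    and [measurable]: "G \<in> borel_measurable lebesgue" "\<kappa> \<in> borel_measurable lebesgue"
  shows "(\<integral>\<^sup>+t\<in>B. ennreal (G t * weight_norm_dual p W t z) \<partial>lebesgue) \<le>
    ennreal (C * \<beta> * e * \<delta> powr (1 - 1 / p)) * ennpowr (\<integral>\<^sup>+t. ennreal (G t powr p * \<kappa> t) \<partial>lebesgue) (1 / p) *
    dual_norm (avg_norm p (weight_norm p W) Q) z"
proof -
  define T where "T = (\<integral>\<^sup>+t. ennreal (G t powr p * \<kappa> t) \<partial>lebesgue)"
  have "(\<integral>\<^sup>+t\<in>B. ennreal (G t powr p) \<partial>lebesgue) \<le> (\<integral>\<^sup>+t. ennreal e * ennreal (G t powr p * \<kappa> t) \<partial>lebesgue)"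
  proof (rule nn_integral_mono)
    fix t
    show "ennreal (G t powr p) * indicator B t \<le> ennreal e * ennreal (G t powr p * \<kappa> t)"
    proof (cases "t \<in> B")
      case True
      have "G t powr p * 1 \<le> G t powr p * (e * \<kappa> t)" using \<kappa>(2)[OF True] by (intro mult_left_mono) auto
      then have "G t powr p \<le> e * (G t powr p * \<kappa> t)" by (simp add: mult_ac)
      then show ?thesis using True e \<kappa>(1) by (simp add: ennreal_leI flip: ennreal_mult)
    qed simp
  qed
  also have "\<dots> = ennreal e * T" unfolding T_def by (rule nn_integral_cmult) measurable
  finally have "ennpowr (\<integral>\<^sup>+t\<in>B. ennreal (G t powr p) \<partial>lebesgue) (1 / p) \<le> ennpowr (ennreal e * T) (1 / p)"
    using p by (intro ennpowr_mono) auto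
  also have "\<dots> = ennreal (e powr (1 / p)) * ennpowr T (1 / p)"
    using p e by (subst ennpowr_mult) (auto simp: ennpowr_ennreal)
  also have "\<dots> \<le> ennreal e * ennpowr T (1 / p)"
  proof -
    have "e powr (1 / p) \<le> e powr 1" using e p by (intro powr_mono) auto
    then show ?thesis using e by (intro mult_right_mono ennreal_leI) auto
  qed
  finally have 1: "ennpowr (\<integral>\<^sup>+t\<in>B. ennreal (G t powr p) \<partial>lebesgue) (1 / p) \<le> ennreal e * ennpowr T (1 / p)" .
  have 2: "dual_norm (avg_norm p (weight_norm p W) B) z \<le> ennreal (\<beta> powr (1 / p)) * dual_norm (avg_norm p (weight_norm p W) Q) z"
  proof (rule dual_norm_antimono)
    show "avg_norm p (weight_norm p W) Q y \<le> ennreal (\<beta> powr (1 / p)) * avg_norm p (weight_norm p W) B y" for y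
      using avg_norm_subset[OF p QB Q B(1)] Q B(2) by simp
  qed (use B in auto)
  have "(\<integral>\<^sup>+t\<in>B. ennreal (G t * weight_norm_dual p W t z) \<partial>lebesgue) \<le>
      ennreal (C * (\<delta> * \<beta>) powr (1 - 1 / p)) * (ennreal e * ennpowr T (1 / p)) *
      (ennreal (\<beta> powr (1 / p)) * dual_norm (avg_norm p (weight_norm p W) Q) z)"
    by (rule order_trans[OF ap], intro mult_mono 1 2 order_refl) auto
  also have "\<dots> = (ennreal (C * (\<delta> * \<beta>) powr (1 - 1 / p)) * ennreal e * ennreal (\<beta> powr (1 / p))) *
      ennpowr T (1 / p) * dual_norm (avg_norm p (weight_norm p W) Q) z"
    by (simp only: mult_ac)
  also have "ennreal (C * (\<delta> * \<beta>) powr (1 - 1 / p)) * ennreal e * ennreal (\<beta> powr (1 / p)) =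
      ennreal (C * \<beta> * e * \<delta> powr (1 - 1 / p))"
  proof -
    have "\<beta> powr (1 - 1 / p) * \<beta> powr (1 / p) = \<beta>"
      using B by (simp flip: powr_add)
    moreover have "C * (\<delta> * \<beta>) powr (1 - 1 / p) * e * \<beta> powr (1 / p) =
        C * (\<beta> powr (1 - 1 / p) * \<beta> powr (1 / p)) * e * \<delta> powr (1 - 1 / p)"
      using Q B by (simp add: powr_mult mult_ac)
    ultimately have "C * (\<delta> * \<beta>) powr (1 - 1 / p) * e * \<beta> powr (1 / p) = C * \<beta> * e * \<delta> powr (1 - 1 / p)"
      by simp
    moreover have "ennreal (C * (\<delta> * \<beta>) powr (1 - 1 / p)) * ennreal e * ennreal (\<beta> powr (1 / p)) =
        ennreal (C * (\<delta> * \<beta>) powr (1 - 1 / p) * e * \<beta> powr (1 / p))"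
      using C e by (simp flip: ennreal_mult)
    ultimately show ?thesis by (simp only:)
  qed
  finally show ?thesis by (simp add: T_def)
qed

lemma borel_measurable_lebesgueI:
  "f \<in> borel_measurable borel \<Longrightarrow> f \<in> borel_measurable lebesgue"
  by (simp add: measurable_completion)

lemma dcube_eq_preimage:
  assumes "invertible A"
  shows "dcube A j k = {y. mat_powi A k *v y - int_vec j \<in> cbox 0 1}"
proof safe
  fix y assume "y \<in> dcube A j k"
  then show "mat_powi A k *v y - int_vec j \<in> cbox 0 1"
    by (auto simp: dcube_def mat_powi_minus_cancel[OF assms])
next
  fix y assume "mat_powi A k *v y - int_vec j \<in> cbox 0 1"
  then have "(\<lambda>x. mat_powi A (- k) *v (x + int_vec j)) (mat_powi A k *v y - int_vec j) \<in> dcube A j k"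
    unfolding dcube_def by (rule imageI)
  then show "y \<in> dcube A j k" by (simp add: mat_powi_minus_cancel[OF assms])
qed

lemma dcube_measure:
  fixes A :: "real^'d^'d"
  assumes "invertible A"
  shows "dcube A j k \<in> lmeasurable" "emeasure lebesgue (dcube A j k) = ennreal (\<bar>det A\<bar> powi (- k))"
proof -
  have "measure lebesgue (cbox 0 (1::real^'d)) = 1"
  proof -
    have "0 \<in> cbox 0 (1::real^'d)" by (simp add: mem_box_cart)
    then have "cbox 0 (1::real^'d) \<noteq> {}" by blast
    then show ?thesis by (simp add: content_cbox_cart)
  qed
  with preimage_affine[OF assms, of "cbox 0 1" k "int_vec j"]
  show "dcube A j k \<in> lmeasurable" "emeasure lebesgue (dcube A j k) = ennreal (\<bar>det A\<bar> powi (- k))"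
    by (auto simp: dcube_eq_preimage[OF assms])
qed

lemma cinner_mult: "cinner x z * h = (\<Sum>c\<in>UNIV. (x $ c * h) * cnj (z $ c))"
  unfolding cinner_def sum_distrib_right by (rule sum.cong) (auto simp: mult_ac)

lemma cinner_integral:
  fixes F :: "'a \<Rightarrow> complex^'m" and h :: "'a \<Rightarrow> complex"
  assumes "\<And>c. integrable M (\<lambda>y. F y $ c * h y)"
  shows "cinner (\<chi> c. LINT y|M. F y $ c * h y) z = (LINT y|M. cinner (F y) z * h y)"
proof -
  have "(LINT y|M. cinner (F y) z * h y) = (\<Sum>c\<in>UNIV. LINT y|M. (F y $ c * h y) * cnj (z $ c))"
    unfolding cinner_mult by (rule Bochner_Integration.integral_sum) (intro integrable_mult_left assms)
  also have "\<dots> = cinner (\<chi> c. LINT y|M. F y $ c * h y) z"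
    by (simp add: cinner_def)
  finally show ?thesis ..
qed

text \<open>For \<open>\<theta> i\<close> from the reproducing formula and \<open>F i\<close> the convolution of a distribution with the
  \<open>k + i\<close>-th dilate of \<open>\<phi>\<close>, the vector \<open>v\<close> is, up to normalisation, the coefficient at the cube with
  indices \<open>j\<close> and \<open>k\<close>.\<close>

definition sampled_at :: "real^'d^'d \<Rightarrow> ('i \<Rightarrow> real^'d \<Rightarrow> complex) \<Rightarrow> 'i set \<Rightarrow>
    ('i \<Rightarrow> real^'d \<Rightarrow> complex^'m) \<Rightarrow> int \<Rightarrow> int^'d \<Rightarrow> complex^'m \<Rightarrow> bool" where
  "sampled_at A \<theta> I F k j v \<longleftrightarrow>
     (\<forall>i\<in>I. F i \<in> borel_measurable borel) \<and>
     (\<forall>i\<in>I. \<forall>c. integrable lborel (\<lambda>y. F i y $ c * \<theta> i (mat_powi A k *v y - int_vec j))) \<and>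
     (\<forall>c. v $ c = complex_of_real (\<bar>det A\<bar> powi k) *
        (\<Sum>i\<in>I. (LINT y|lborel. F i y $ c * \<theta> i (mat_powi A k *v y - int_vec j))))"

text \<open>By biduality it suffices to pair the vector with an arbitrary \<open>z\<close>. The kernel is dominated by a sum
  over the dilated balls around the cube, and on each of them the Muckenhoupt condition applies; the
  geometric decay of the kernel absorbs the growth of the balls.\<close>

theorem cube_estimate:
  fixes A P :: "real^'d^'d" and W :: "real^'d \<Rightarrow> complex^'m^'m" and \<theta> :: "'i \<Rightarrow> real^'d \<Rightarrow> complex"
  assumes ad: "adapted_ellipsoid A P" and W: "W \<in> Ap_class A P p" and p: "1 \<le> p" and I: "finite I"
    and \<theta>: "\<And>i. i \<in> I \<Longrightarrow> rapidly_decreasing (\<theta> i)" "\<And>i. i \<in> I \<Longrightarrow> \<theta> i \<in> borel_measurable borel"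
  obtains K where "0 \<le> K"
    "\<And>k j F v. sampled_at A \<theta> I F k j v \<Longrightarrow>
      (\<integral>\<^sup>+x\<in>dcube A j k. ennreal (weight_norm p W x v powr p) \<partial>lebesgue) \<le>
        ennreal K * (\<Sum>i\<in>I. (\<integral>\<^sup>+y. ennreal (weight_norm p W y (F i y) powr p *
          lattice_kernel (mat_powi A k *v y - int_vec j)) \<partial>lebesgue))"
proof -
  obtain r where A: "invertible A" using adapted_ellipsoid_contraction[OF ad] by metis
  have mw: "matrix_weight W" using W by (simp add: Ap_class_def)
  define b where "b = \<bar>det A\<bar>"
  have b: "1 < b" unfolding b_def by (rule det_gt_1[OF ad])
  obtain n0 :: nat where n0: "\<And>n. n0 \<le> n \<Longrightarrow> cbox 0 1 \<subseteq> dilated_ellipsoid A P (int n)"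
    using dilated_ellipsoid_contains_cube[OF ad] by blast
  obtain R a where Ra: "1 \<le> R" "1 \<le> a"
    "\<And>n z. z \<in> dilated_ellipsoid A P (int n) \<Longrightarrow> 1 + norm z \<le> R * a ^ n"
    using dilated_ellipsoid_growth[OF ad] by blast
  define m where "m = DIM(real^'d) + 1"
  \<comment> \<open>in passing to the next ball the volume grows by the factor \<open>b\<close> and the bound of the inverse of the
      lattice kernel by \<open>a ^ m\<close>; the further factor \<open>2\<close> leaves a geometric series\<close>
  define q where "q = 2 * b * a ^ m"
  have q: "0 < q" using b Ra by (simp add: q_def)
  have "\<exists>C\<ge>0. \<forall>z. \<exists>l. z \<in> dilated_ellipsoid A P (int (n0 + l)) \<and> cmod (\<theta> i z) \<le> C / q ^ l" if "i \<in> I" for i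
    by (rule rapidly_decreasing_dilated_ellipsoid[OF ad \<theta>(1)[OF that] q, of n0]) blast
  then obtain C where C: "\<And>i. i \<in> I \<Longrightarrow> 0 \<le> C i"
    "\<And>i z. i \<in> I \<Longrightarrow> \<exists>l. z \<in> dilated_ellipsoid A P (int (n0 + l)) \<and> cmod (\<theta> i z) \<le> C i / q ^ l"
    by metis
  obtain CA where CA: "0 < CA" and pairing:
    "\<And>B b G z. B \<in> dilated_balls A P \<Longrightarrow> B \<in> sets lebesgue \<Longrightarrow> emeasure lebesgue B = ennreal b \<Longrightarrow> 0 < b \<Longrightarrow>
      G \<in> borel_measurable lebesgue \<Longrightarrow> (\<And>t. 0 \<le> G t) \<Longrightarrow>
      (\<integral>\<^sup>+t\<in>B. ennreal (G t * weight_norm_dual p W t z) \<partial>lebesgue) \<le>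
        ennreal (CA * b powr (1 - 1 / p)) * ennpowr (\<integral>\<^sup>+t\<in>B. ennreal (G t powr p) \<partial>lebesgue) (1 / p) *
        dual_norm (avg_norm p (weight_norm p W) B) z"
    by (rule Ap_pairing[OF W p]) blast
  define H where "H = CA * b ^ n0 * (R * a ^ n0) ^ m"
  have H: "0 \<le> H" using CA b Ra by (simp add: H_def)
  define K0 where "K0 = (\<Sum>i\<in>I. 2 * H * C i)"
  have K0: "0 \<le> K0" unfolding K0_def using H C(1) by (intro sum_nonneg) auto
  show thesis
  proof (rule that[of "K0 powr p * real (card I) powr p"])
    fix k :: int and j :: "int^'d" and F :: "'i \<Rightarrow> real^'d \<Rightarrow> complex^'m" and v :: "complex^'m"
    \<comment> \<open>maps the cube to the unit cube\<close>
    define \<tau> where "\<tau> y = mat_powi A k *v y - int_vec j" for y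
    assume "sampled_at A \<theta> I F k j v"
    then have Fm: "\<And>i. i \<in> I \<Longrightarrow> F i \<in> borel_measurable borel"
      and Fint: "\<And>i c. i \<in> I \<Longrightarrow> integrable lborel (\<lambda>y. F i y $ c * \<theta> i (\<tau> y))"
      and v: "\<And>c. v $ c = complex_of_real (b powi k) * (\<Sum>i\<in>I. (LINT y|lborel. F i y $ c * \<theta> i (\<tau> y)))"
      unfolding sampled_at_def \<tau>_def b_def by blast+
    have [measurable]: "\<tau> \<in> borel_measurable borel" unfolding \<tau>_def[abs_def] by measurable
    define \<delta> where "\<delta> = b powi (- k)"
    have \<delta>: "0 < \<delta>" using b by (simp add: \<delta>_def)
    have bk: "b powi k = 1 / \<delta>" using b by (simp add: \<delta>_def power_int_minus field_simps)
    define Q where "Q = dcube A j k"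
    have Q: "Q \<in> sets lebesgue" "emeasure lebesgue Q = ennreal \<delta>"
      using dcube_measure[OF A, of j k] by (auto simp: Q_def \<delta>_def b_def)
    define dualQ where "dualQ = dual_norm (avg_norm p (weight_norm p W) Q)"
    define B where "B l = {y. \<tau> y \<in> dilated_ellipsoid A P (int (n0 + l))}" for l
    have B: "B l \<in> dilated_balls A P" "B l \<in> sets lebesgue" "emeasure lebesgue (B l) = ennreal (\<delta> * b ^ (n0 + l))" for l
    proof -
      note E = dilated_ellipsoid_lmeasurable[OF ad A, of "int (n0 + l)"]
      show "B l \<in> dilated_balls A P" unfolding B_def \<tau>_def by (rule preimage_dilated_ellipsoid_ball[OF A])
      show "B l \<in> sets lebesgue" using preimage_affine(1)[OF A E(1), of k "int_vec j"] by (auto simp: B_def \<tau>_def)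
      have "\<bar>det A\<bar> powi int (n0 + l) = b ^ (n0 + l)" unfolding b_def by (rule power_int_of_nat)
      then show "emeasure lebesgue (B l) = ennreal (\<delta> * b ^ (n0 + l))"
        using preimage_affine(2)[OF A E(1), of k "int_vec j"] unfolding B_def \<tau>_def E(2) \<delta>_def b_def by simp
    qed
    have QB: "Q \<subseteq> B l" for l
      using n0[of "n0 + l"] by (auto simp: Q_def B_def \<tau>_def dcube_eq_preimage[OF A])
    define \<kappa> where "\<kappa> y = lattice_kernel (\<tau> y)" for y
    have \<kappa>m[measurable]: "\<kappa> \<in> borel_measurable borel" unfolding \<kappa>_def[abs_def] by measurable
    have \<kappa>: "0 \<le> \<kappa> y" for y by (simp add: \<kappa>_def lattice_kernel_nonneg)
    \<comment> \<open>a bound of \<open>1 / \<kappa>\<close> on the ball \<open>B l\<close>\<close>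
    define e where "e l = (R * a ^ (n0 + l)) ^ m" for l
    have Ra1: "1 \<le> R * a ^ l" for l
      using mult_mono[of 1 R 1 "a ^ l"] Ra one_le_power[of a l] by simp
    have e: "1 \<le> e l" for l unfolding e_def by (intro one_le_power Ra1)
    have e\<kappa>: "1 \<le> e l * \<kappa> y" if "y \<in> B l" for l y
    proof -
      have "(1 + norm (\<tau> y)) ^ m \<le> e l"
        unfolding e_def using that Ra(3)[of "\<tau> y" "n0 + l"] by (intro power_mono) (auto simp: B_def)
      moreover have "0 < (1 + norm (\<tau> y)) ^ m" by (intro zero_less_power add_pos_nonneg) auto
      moreover have "\<kappa> y = 1 / (1 + norm (\<tau> y)) ^ m" by (simp only: \<kappa>_def lattice_kernel_def m_def)
      ultimately show ?thesis by (simp add: field_simps)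
    qed
    define G where "G i y = weight_norm p W y (F i y)" for i y
    have Gm: "G i \<in> borel_measurable lebesgue" if "i \<in> I" for i
    proof -
      have "F i \<in> borel_measurable lebesgue" using Fm[OF that] by (rule borel_measurable_lebesgueI)
      then show ?thesis unfolding G_def[abs_def] weight_norm_def
        by (intro measurable_compose[OF borel_measurable_matrix_vector_complex[OF matrix_weight_measurable[OF mw]] borel_measurable_norm])
    qed
    have G0: "0 \<le> G i y" for i y by (simp add: G_def weight_norm_def)
    define T where "T i = (\<integral>\<^sup>+y. ennreal (G i y powr p * \<kappa> y) \<partial>lebesgue)" for i
    have ball: "(\<integral>\<^sup>+t\<in>B l. ennreal (G i t * weight_norm_dual p W t z) \<partial>lebesgue) \<le>
        ennreal (CA * b ^ (n0 + l) * e l * \<delta> powr (1 - 1 / p)) * ennpowr (T i) (1 / p) *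
        dualQ z" if "i \<in> I" for i l z
      unfolding T_def dualQ_def
    proof (rule ball_pairing[OF mw p pairing CA QB Q(2) \<delta> B(3)])
      show "0 < \<delta> * b ^ (n0 + l)" "0 < b ^ (n0 + l)" using \<delta> b by auto
      show "\<kappa> \<in> borel_measurable lebesgue" by (rule borel_measurable_lebesgueI[OF \<kappa>m])
    qed (use B e e\<kappa> \<kappa> Gm[OF that] G0 in auto)
    \<comment> \<open>each point lies in some ball \<open>B l\<close> such that \<open>\<theta> i\<close> is at most \<open>C i / q ^ l\<close> at the point; the bounds
        of the integrals over the balls form a geometric series\<close>
    have one: "ennreal (cmod (LINT y|lborel. cinner (F i y) z * \<theta> i (\<tau> y))) \<le>
        ennreal (2 * H * C i * \<delta> powr (1 - 1 / p)) * (ennpowr (T i) (1 / p) * dualQ z)"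
      if i: "i \<in> I" for i z
    proof -
      note [measurable] = Fm[OF i] \<theta>(2)[OF i]
      have [measurable]: "(\<lambda>y. cinner (F i y) z) \<in> borel_measurable borel"
      proof (rule measurable_compose[OF Fm[OF i]])
        show "(\<lambda>v. cinner v z) \<in> borel_measurable borel"
          unfolding cinner_def by (intro borel_measurable_continuous_onI continuous_intros)
      qed
      have [measurable]: "(\<lambda>t. G i t * weight_norm_dual p W t z) \<in> borel_measurable lebesgue"
        using Gm[OF i] weight_norm_measurable(2)[OF mw, of p z] by measurable
      have "integrable lborel (\<lambda>y. \<Sum>c\<in>UNIV. (F i y $ c * \<theta> i (\<tau> y)) * cnj (z $ c))"
        by (intro Bochner_Integration.integrable_sum integrable_mult_left Fint i)
      then have "integrable lborel (\<lambda>y. cinner (F i y) z * \<theta> i (\<tau> y))"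
        by (simp only: cinner_mult)
      then have "ennreal (cmod (LINT y|lborel. cinner (F i y) z * \<theta> i (\<tau> y))) \<le>
          (\<integral>\<^sup>+y. ennreal (cmod (cinner (F i y) z * \<theta> i (\<tau> y))) \<partial>lborel)"
        by (rule integral_norm_bound_ennreal)
      also have "\<dots> = (\<integral>\<^sup>+y. ennreal (cmod (cinner (F i y) z * \<theta> i (\<tau> y))) \<partial>lebesgue)"
        by (rule nn_integral_completion[symmetric])
      also have "\<dots> \<le> (\<integral>\<^sup>+y. (\<Sum>l. ennreal (C i / q ^ l) * (ennreal (G i y * weight_norm_dual p W y z) * indicator (B l) y)) \<partial>lebesgue)"
      proof (rule nn_integral_mono_AE)
        have "AE y in lebesgue. invertible (W y)" using mw by (simp add: matrix_weight_def)
        then show "AE y in lebesgue. ennreal (cmod (cinner (F i y) z * \<theta> i (\<tau> y))) \<le>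
          (\<Sum>l. ennreal (C i / q ^ l) * (ennreal (G i y * weight_norm_dual p W y z) * indicator (B l) y))"
        proof eventually_elim
          case (elim y)
          have pos: "0 \<le> G i y * weight_norm_dual p W y z" using G0 by (simp add: weight_norm_dual_def)
          have "nonneg_definite (W y)" using mw by (simp add: matrix_weight_def)
          from cinner_le_mat_powr[OF this elim, of "F i y" z "1 / p"]
          have 1: "cmod (cinner (F i y) z) \<le> G i y * weight_norm_dual p W y z"
            by (simp add: G_def weight_norm_def weight_norm_dual_def)
          obtain l where l: "y \<in> B l" "cmod (\<theta> i (\<tau> y)) \<le> C i / q ^ l"
            using C(2)[OF i, of "\<tau> y"] by (auto simp: B_def)
          have "cmod (cinner (F i y) z * \<theta> i (\<tau> y)) \<le> (G i y * weight_norm_dual p W y z) * (C i / q ^ l)"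
            unfolding norm_mult using 1 l(2) pos by (intro mult_mono) auto
          then have "ennreal (cmod (cinner (F i y) z * \<theta> i (\<tau> y))) \<le>
              ennreal (C i / q ^ l) * (ennreal (G i y * weight_norm_dual p W y z) * indicator (B l) y)"
            using l(1) C(1)[OF i] q pos by (simp add: ennreal_leI mult.commute flip: ennreal_mult)
          also have "\<dots> \<le> (\<Sum>l. ennreal (C i / q ^ l) * (ennreal (G i y * weight_norm_dual p W y z) * indicator (B l) y))"
          proof -
            have "f l \<le> (\<Sum>l. f l)" for f :: "nat \<Rightarrow> ennreal"
              using sum_le_suminf[of f "{l}"] by simp
            then show ?thesis .
          qed
          finally show ?case .
        qed
      qed
      also have "\<dots> = (\<Sum>l. ennreal (C i / q ^ l) * (\<integral>\<^sup>+y\<in>B l. ennreal (G i y * weight_norm_dual p W y z) \<partial>lebesgue))"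
        using B(2) by (subst nn_integral_suminf) (auto simp: nn_integral_cmult)
      also have "\<dots> \<le> (\<Sum>l. ennreal (C i / q ^ l) * (ennreal (CA * b ^ (n0 + l) * e l * \<delta> powr (1 - 1 / p)) * ennpowr (T i) (1 / p) *
          dualQ z))"
        by (intro suminf_le mult_left_mono ball i) auto
      also have "\<dots> = (\<Sum>l. ennreal (H * C i * \<delta> powr (1 - 1 / p) * (1 / 2) ^ l) *
          (ennpowr (T i) (1 / p) * dualQ z))"
      proof (rule suminf_cong)
        fix l
        have "b ^ l * (a ^ l) ^ m / q ^ l = (1 / 2) ^ l"
        proof -
          have "b ^ l * (a ^ l) ^ m = (b * a ^ m) ^ l"
            by (simp add: power_mult_distrib mult.commute flip: power_mult)
          moreover have "q ^ l = 2 ^ l * (b * a ^ m) ^ l"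
            by (simp only: q_def mult.assoc power_mult_distrib)
          moreover have "b * a ^ m \<noteq> 0" using b Ra by simp
          ultimately show ?thesis by (simp add: power_one_over)
        qed
        moreover have "C i / q ^ l * (CA * b ^ (n0 + l) * e l * \<delta> powr (1 - 1 / p)) =
            H * C i * \<delta> powr (1 - 1 / p) * (b ^ l * (a ^ l) ^ m / q ^ l)"
        proof -
          have "R * a ^ (n0 + l) = (R * a ^ n0) * a ^ l" by (simp add: power_add)
          then have "e l = (R * a ^ n0) ^ m * (a ^ l) ^ m" by (simp only: e_def power_mult_distrib)
          then show ?thesis by (simp add: H_def power_add mult_ac)
        qed
        ultimately have "C i / q ^ l * (CA * b ^ (n0 + l) * e l * \<delta> powr (1 - 1 / p)) = H * C i * \<delta> powr (1 - 1 / p) * (1 / 2) ^ l"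
          by (simp only:)
        then have "ennreal (C i / q ^ l) * ennreal (CA * b ^ (n0 + l) * e l * \<delta> powr (1 - 1 / p)) =
            ennreal (H * C i * \<delta> powr (1 - 1 / p) * (1 / 2) ^ l)"
          using C(1)[OF i] q CA b e[of l] by (simp flip: ennreal_mult)
        then show "ennreal (C i / q ^ l) * (ennreal (CA * b ^ (n0 + l) * e l * \<delta> powr (1 - 1 / p)) * ennpowr (T i) (1 / p) *
          dualQ z) = ennreal (H * C i * \<delta> powr (1 - 1 / p) * (1 / 2) ^ l) *
          (ennpowr (T i) (1 / p) * dualQ z)"
          by (metis mult.assoc)
      qed
      also have "\<dots> = (\<Sum>l. ennreal (H * C i * \<delta> powr (1 - 1 / p) * (1 / 2) ^ l)) *
          (ennpowr (T i) (1 / p) * dualQ z)"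
        by simp
      also have "(\<Sum>l. ennreal (H * C i * \<delta> powr (1 - 1 / p) * (1 / 2) ^ l)) = ennreal (2 * H * C i * \<delta> powr (1 - 1 / p))"
      proof -
        have "(\<lambda>l. H * C i * \<delta> powr (1 - 1 / p) * (1 / 2 :: real) ^ l) sums (H * C i * \<delta> powr (1 - 1 / p) * 2)"
          using sums_mult[OF geometric_sums[of "1 / 2 :: real"]] by simp
        then have "(\<Sum>l. ennreal (H * C i * \<delta> powr (1 - 1 / p) * (1 / 2) ^ l)) = ennreal (H * C i * \<delta> powr (1 - 1 / p) * 2)"
          using H C(1)[OF i] by (intro suminf_ennreal_eq) auto
        then show ?thesis by (simp add: mult_ac)
      qed
      finally show ?thesis .
    qed
    define D where "D = ennreal (K0 * \<delta> powr (- (1 / p))) * (\<Sum>i\<in>I. ennpowr (T i) (1 / p))"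
    have "avg_norm p (weight_norm p W) Q v \<le> D"
    proof (rule avg_norm_bidual_le[OF mw p Q(1)])
      show "0 < emeasure lebesgue Q" "emeasure lebesgue Q < top" unfolding Q(2) using \<delta> by auto
      fix z
      define X where "X = dualQ z"
      have "cinner v z = complex_of_real (b powi k) * (\<Sum>i\<in>I. cinner (\<chi> c. LINT y|lborel. F i y $ c * \<theta> i (\<tau> y)) z)"
        unfolding cinner_def v
        by (simp add: sum_distrib_left sum_distrib_right sum.swap[of _ I] mult.assoc)
      also have "\<dots> = complex_of_real (b powi k) * (\<Sum>i\<in>I. (LINT y|lborel. cinner (F i y) z * \<theta> i (\<tau> y)))"
        using cinner_integral[OF Fint] by simp
      finally have eq: "cinner v z = complex_of_real (1 / \<delta>) * (\<Sum>i\<in>I. (LINT y|lborel. cinner (F i y) z * \<theta> i (\<tau> y)))"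
        by (simp only: bk)
      have "cmod (cinner v z) \<le> 1 / \<delta> * (\<Sum>i\<in>I. cmod (LINT y|lborel. cinner (F i y) z * \<theta> i (\<tau> y)))"
        unfolding eq norm_mult norm_of_real using \<delta> by (intro mult_mono norm_sum) auto
      then have "ennreal (cmod (cinner v z)) \<le> ennreal (1 / \<delta> * (\<Sum>i\<in>I. cmod (LINT y|lborel. cinner (F i y) z * \<theta> i (\<tau> y))))"
        by (rule ennreal_leI)
      also have "\<dots> = ennreal (1 / \<delta>) * (\<Sum>i\<in>I. ennreal (cmod (LINT y|lborel. cinner (F i y) z * \<theta> i (\<tau> y))))"
        using \<delta> by (subst ennreal_mult) (auto intro: sum_nonneg)
      also have "\<dots> \<le> ennreal (1 / \<delta>) * (\<Sum>i\<in>I. ennreal (K0 * \<delta> powr (1 - 1 / p)) * (ennpowr (T i) (1 / p) * X))"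
      proof (intro mult_left_mono sum_mono)
        fix i assume i: "i \<in> I"
        have "2 * H * C i \<le> K0"
          unfolding K0_def using I i H C(1) by (intro member_le_sum) auto
        then have "ennreal (2 * H * C i * \<delta> powr (1 - 1 / p)) \<le> ennreal (K0 * \<delta> powr (1 - 1 / p))"
          by (intro ennreal_leI mult_right_mono) auto
        then show "ennreal (cmod (LINT y|lborel. cinner (F i y) z * \<theta> i (\<tau> y))) \<le>
            ennreal (K0 * \<delta> powr (1 - 1 / p)) * (ennpowr (T i) (1 / p) * X)"
          using one[OF i, of z] mult_right_mono unfolding X_def by (meson order_trans zero_le)
      qed simp
      also have "\<dots> = (ennreal (1 / \<delta>) * ennreal (K0 * \<delta> powr (1 - 1 / p))) * (\<Sum>i\<in>I. ennpowr (T i) (1 / p)) * X"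
        by (simp add: mult.assoc flip: sum_distrib_left sum_distrib_right)
      also have "ennreal (1 / \<delta>) * ennreal (K0 * \<delta> powr (1 - 1 / p)) = ennreal (K0 * \<delta> powr (- (1 / p)))"
      proof -
        have "\<delta> powr (1 - 1 / p) = \<delta> * \<delta> powr (- (1 / p))"
          using \<delta> powr_add[of \<delta> 1 "- (1 / p)"] by simp
        then have "1 / \<delta> * (K0 * \<delta> powr (1 - 1 / p)) = K0 * \<delta> powr (- (1 / p))"
          using \<delta> by simp
        then show ?thesis using \<delta> K0 by (simp flip: ennreal_mult del: times_divide_eq_left)
      qed
      finally show "ennreal (cmod (cinner v z)) \<le> D * dual_norm (avg_norm p (weight_norm p W) Q) z"
        by (simp add: D_def X_def dualQ_def)
    qed
    \<comment> \<open>it remains to raise the inequality to the power \<open>p\<close>\<close>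
    define J where "J = (\<integral>\<^sup>+x\<in>Q. ennreal (weight_norm p W x v powr p) \<partial>lebesgue)"
    have "ennpowr (J / ennreal \<delta>) (1 / p) \<le> D"
      using \<open>avg_norm p (weight_norm p W) Q v \<le> D\<close> by (simp add: avg_norm_def Q J_def del: emeasure_completion)
    then have "ennpowr (ennpowr (J / ennreal \<delta>) (1 / p)) p \<le> ennpowr D p"
      using p by (intro ennpowr_mono) auto
    then have "J / ennreal \<delta> \<le> ennpowr D p" using p by (simp add: ennpowr_ennpowr)
    also have "\<dots> = ennreal (K0 powr p / \<delta>) * ennpowr (\<Sum>i\<in>I. ennpowr (T i) (1 / p)) p"
    proof -
      have "(K0 * \<delta> powr (- (1 / p))) powr p = K0 powr p / \<delta>"
      proof -
        have "(\<delta> powr (- (1 / p))) powr p = \<delta> powr (- 1)" using p by (simp add: powr_powr)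
        also have "\<dots> = 1 / \<delta>" using \<delta> by (simp add: powr_minus_divide)
        finally have "(\<delta> powr (- (1 / p))) powr p = 1 / \<delta>" .
        then have "K0 powr p * (\<delta> powr (- (1 / p))) powr p = K0 powr p / \<delta>" by (simp only: times_divide_eq_right mult_1_right)
        then show ?thesis using K0 by (subst powr_mult) auto
      qed
      then show ?thesis
        unfolding D_def using p K0 by (subst ennpowr_mult) (auto simp: ennpowr_ennreal)
    qed
    also have "\<dots> \<le> ennreal (K0 powr p / \<delta>) * (ennreal (real (card I) powr p) * (\<Sum>i\<in>I. ennpowr (ennpowr (T i) (1 / p)) p))"
      using p by (intro mult_left_mono ennpowr_sum_le I) auto
    also have "\<dots> = ennreal (K0 powr p / \<delta>) * (ennreal (real (card I) powr p) * (\<Sum>i\<in>I. T i))"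
      using p by (simp add: ennpowr_ennpowr)
    finally have "J \<le> ennreal (K0 powr p / \<delta>) * (ennreal (real (card I) powr p) * (\<Sum>i\<in>I. T i)) * ennreal \<delta>"
      using \<delta> by (subst (asm) ennreal_divide_le_iff) auto
    also have "\<dots> = ennreal (K0 powr p / \<delta>) * ennreal (real (card I) powr p) * ennreal \<delta> * (\<Sum>i\<in>I. T i)"
      by (simp only: mult_ac)
    also have "ennreal (K0 powr p / \<delta>) * ennreal (real (card I) powr p) * ennreal \<delta> = ennreal (K0 powr p * real (card I) powr p)"
      using \<delta> by (simp flip: ennreal_mult)
    finally show "(\<integral>\<^sup>+x\<in>dcube A j k. ennreal (weight_norm p W x v powr p) \<partial>lebesgue) \<le>
        ennreal (K0 powr p * real (card I) powr p) * (\<Sum>i\<in>I. (\<integral>\<^sup>+y. ennreal (weight_norm p W y (F i y) powr p *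
          lattice_kernel (mat_powi A k *v y - int_vec j)) \<partial>lebesgue))"
      by (simp add: J_def Q_def T_def G_def \<kappa>_def \<tau>_def)
  qed simp
qed

section \<open>Summation over the cubes of a level\<close>

lemma dcube_mem_iff:
  assumes "invertible A"
  shows "y \<in> dcube A j k \<longleftrightarrow>
    (\<forall>i. real_of_int (j $ i) \<le> (mat_powi A k *v y) $ i \<and> (mat_powi A k *v y) $ i \<le> real_of_int (j $ i) + 1)"
  by (simp add: dcube_eq_preimage[OF assms] mem_box_cart int_vec_def) (simp add: algebra_simps)

lemma inj_dcube:
  fixes A :: "real^'d^'d"
  assumes "invertible A"
  shows "inj (\<lambda>j. dcube A j k)"
proof (rule injI)
  fix j j' assume eq: "dcube A j k = dcube A j' k"
  have "j $ i = j' $ i" for i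
  proof -
    have mem: "mat_powi A (- k) *v int_vec j \<in> dcube A j k" for j
      by (simp add: dcube_mem_iff[OF assms] mat_powi_minus_cancel[OF assms]) (simp add: int_vec_def)
    have "j' $ i \<le> j $ i" if "dcube A j k = dcube A j' k" for j j'
      using mem[of j] unfolding that
      by (simp add: dcube_mem_iff[OF assms] mat_powi_minus_cancel[OF assms]) (simp add: int_vec_def)
    from this[OF eq] this[OF eq[symmetric]] show ?thesis by simp
  qed
  then show "j = j'" by (simp add: vec_eq_iff)
qed

lemma powi_eq_powr: "1 < b \<Longrightarrow> b powi k = b powr real_of_int k"
  using powr_real_of_int'[of b k] by simp

lemma dcube_level_eq:
  fixes A :: "real^'d^'d"
  assumes A: "invertible A" "1 < \<bar>det A\<bar>" and eq: "measure lebesgue (dcube A j k) = \<bar>det A\<bar> powi (- k')"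
  shows "k = k'"
proof -
  have "measure lebesgue (dcube A j k) = \<bar>det A\<bar> powi (- k)"
    using dcube_measure(2)[OF A(1), of j k] by (simp add: measure_def zero_le_power_int)
  with eq have "\<bar>det A\<bar> powr (- real_of_int k) = \<bar>det A\<bar> powr (- real_of_int k')"
    using powi_eq_powr[OF A(2), of "- k"] powi_eq_powr[OF A(2), of "- k'"] by simp
  then show ?thesis using A(2) by (simp add: powr_inj)
qed

text \<open>The volume of a cube determines its level and, on a given level, its corner determines its position.\<close>

lemma dcube_index_dcube:
  fixes A :: "real^'d^'d"
  assumes A: "invertible A" "1 < \<bar>det A\<bar>"
  shows "dcube_index A (dcube A j k) = (j, k)"
  unfolding dcube_index_def
proof (rule the_equality)
  fix jk assume eq: "dcube A j k = dcube A (fst jk) (snd jk)"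
  have "measure lebesgue (dcube A j k) = \<bar>det A\<bar> powi (- snd jk)"
    unfolding eq using dcube_measure(2)[OF A(1), of "fst jk" "snd jk"] by (simp add: measure_def zero_le_power_int)
  then have "k = snd jk" by (rule dcube_level_eq[OF A])
  with eq inj_dcube[OF A(1), of k] show "jk = (j, k)" by (auto simp: inj_def prod_eq_iff)
qed simp

lemma dcubes_level:
  fixes A :: "real^'d^'d"
  assumes A: "invertible A" "1 < \<bar>det A\<bar>"
  shows "{Q \<in> dcubes A. measure lebesgue Q = \<bar>det A\<bar> powi (- k)} = range (\<lambda>j. dcube A j k)"
proof safe
  fix Q assume "Q \<in> dcubes A" "measure lebesgue Q = \<bar>det A\<bar> powi (- k)"
  then show "Q \<in> range (\<lambda>j. dcube A j k)"
    using dcube_level_eq[OF A] by (auto simp: dcubes_def)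
next
  fix j
  show "dcube A j k \<in> dcubes A" by (auto simp: dcubes_def)
  show "measure lebesgue (dcube A j k) = \<bar>det A\<bar> powi (- k)"
    using dcube_measure(2)[OF A(1), of j k] by (simp add: measure_def zero_le_power_int)
qed

text \<open>Away from the null set on which a coordinate of \<open>mat_powi A k *v x\<close> is an integer, \<open>j\<close> is the vector
  of the floors of these coordinates.\<close>

lemma dcubes_almost_disjoint:
  fixes A :: "real^'d^'d"
  assumes A: "invertible A"
  shows "AE x in lebesgue. \<forall>j j'. x \<in> dcube A j k \<longrightarrow> x \<in> dcube A j' k \<longrightarrow> j = j'"
proof -
  define M where "M = mat_powi A k"
  \<comment> \<open>the rows are nonzero, so that each of the exceptional sets is a hyperplane\<close>
  have row: "M $ i \<noteq> 0" for i
  proof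
    assume "M $ i = 0"
    then have "(M *v (mat_powi A (- k) *v axis i 1)) $ i = 0"
      by (simp add: matrix_vector_mul_component)
    then show False by (simp add: M_def mat_powi_minus_cancel[OF A])
  qed
  have "AE x in lebesgue. (M *v x) $ i \<noteq> real_of_int n" for i n
  proof -
    have "negligible {x. M $ i \<bullet> x = real_of_int n}"
      using row by (intro negligible_hyperplane) auto
    then have "{x. M $ i \<bullet> x = real_of_int n} \<in> null_sets lebesgue" by (simp add: negligible_iff_null_sets)
    from AE_not_in[OF this] show ?thesis by (simp add: matrix_vector_mul_component)
  qed
  then have "AE x in lebesgue. \<forall>i n. (M *v x) $ i \<noteq> real_of_int n"
    by (simp add: AE_all_countable)
  then show ?thesis
  proof eventually_elim
    case (elim x)
    show ?case
    proof (intro allI impI)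
      fix j j' assume x: "x \<in> dcube A j k" "x \<in> dcube A j' k"
      have floor: "\<lfloor>(M *v x) $ i\<rfloor> = j $ i" if "x \<in> dcube A j k" for i j
      proof (rule floor_unique)
        show "real_of_int (j $ i) \<le> (M *v x) $ i" using that by (simp add: dcube_mem_iff[OF A] M_def)
        have "(M *v x) $ i \<le> real_of_int (j $ i) + 1" using that by (simp add: dcube_mem_iff[OF A] M_def)
        moreover have "(M *v x) $ i \<noteq> real_of_int (j $ i + 1)" using elim by blast
        ultimately show "(M *v x) $ i < real_of_int (j $ i) + 1" by simp
      qed
      show "j = j'" using floor[OF x(1)] floor[OF x(2)] by (simp add: vec_eq_iff)
    qed
  qed
qed

lemma ennpowr_lattice_sum_single:
  fixes f :: "'a \<Rightarrow> ennreal"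
  assumes "\<And>j j'. f j \<noteq> 0 \<Longrightarrow> f j' \<noteq> 0 \<Longrightarrow> j = j'"
  shows "ennpowr (\<integral>\<^sup>+j. f j \<partial>count_space UNIV) p = (\<integral>\<^sup>+j. ennpowr (f j) p \<partial>count_space UNIV)"
proof (cases "\<exists>j. f j \<noteq> 0")
  case True
  then obtain j0 where "f j0 \<noteq> 0" by blast
  with assms have z: "f j = 0" if "j \<noteq> j0" for j using that by blast
  have "(\<integral>\<^sup>+j. f j \<partial>count_space UNIV) = (\<Sum>j\<in>{j0}. f j)"
    using z by (intro nn_integral_count_space') auto
  moreover have "(\<integral>\<^sup>+j. ennpowr (f j) p \<partial>count_space UNIV) = (\<Sum>j\<in>{j0}. ennpowr (f j) p)"
    using z by (intro nn_integral_count_space') auto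
  ultimately show ?thesis by simp
qed simp

definition level_norm ::
  "real^'d^'d \<Rightarrow> (real^'d \<Rightarrow> complex^'m^'m) \<Rightarrow> real \<Rightarrow> ((real^'d) set \<Rightarrow> complex^'m) \<Rightarrow> int \<Rightarrow> ennreal" where
  "level_norm A W p s k = Lp_norm p (\<lambda>x.
     \<Sum>\<^sub>\<infinity>Q\<in>{Q \<in> dcubes A. measure lebesgue Q = \<bar>det A\<bar> powi (- k)}.
       ennreal (measure lebesgue Q powr (- (1 / 2)) * norm (mat_powr (W x) (1 / p) *v s Q)) * indicator Q x)"

lemma seq_besov_norm_eq:
  "seq_besov_norm A W \<alpha> p q s = weighted_lq_norm \<bar>det A\<bar> \<alpha> q (level_norm A W p s)"
  by (simp add: seq_besov_norm_def level_norm_def[abs_def])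

text \<open>The cubes of a level overlap in null sets only, so the norm on a level is a sum over cubes; after
  the single-cube estimate the kernel sums over the lattice to a bounded function.\<close>

theorem level_estimate:
  fixes A P :: "real^'d^'d" and W :: "real^'d \<Rightarrow> complex^'m^'m" and \<theta> :: "'i \<Rightarrow> real^'d \<Rightarrow> complex"
  assumes ad: "adapted_ellipsoid A P" and W: "W \<in> Ap_class A P p" and p: "1 \<le> p" and I: "finite I"
    and \<theta>: "\<And>i. i \<in> I \<Longrightarrow> rapidly_decreasing (\<theta> i)" "\<And>i. i \<in> I \<Longrightarrow> \<theta> i \<in> borel_measurable borel"
  obtains C where "0 \<le> C"
    "\<And>k F v s. (\<And>j. sampled_at A \<theta> I F k j (v j)) \<Longrightarrow>
      (\<And>j. s (dcube A j k) = complex_of_real (\<bar>det A\<bar> powr (- (of_int k / 2))) *s v j) \<Longrightarrow>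
      level_norm A W p s k \<le> ennreal C * (\<Sum>i\<in>I. weighted_Lp_norm p W (F i))"
proof -
  obtain r where A: "invertible A" using adapted_ellipsoid_contraction[OF ad] by metis
  have det: "1 < \<bar>det A\<bar>" by (rule det_gt_1[OF ad])
  have mw: "matrix_weight W" using W by (simp add: Ap_class_def)
  obtain K where K: "0 \<le> K" and cube:
    "\<And>k j F v. sampled_at A \<theta> I F k j v \<Longrightarrow>
      (\<integral>\<^sup>+x\<in>dcube A j k. ennreal (weight_norm p W x v powr p) \<partial>lebesgue) \<le>
        ennreal K * (\<Sum>i\<in>I. (\<integral>\<^sup>+y. ennreal (weight_norm p W y (F i y) powr p *
          lattice_kernel (mat_powi A k *v y - int_vec j)) \<partial>lebesgue))"
    by (rule cube_estimate[where \<theta> = \<theta>, OF ad W p I \<theta>]) blast+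
  obtain M where M: "0 \<le> M"
    "\<And>z::real^'d. (\<integral>\<^sup>+j. ennreal (lattice_kernel (z - int_vec j)) \<partial>count_space UNIV) \<le> ennreal M"
    using lattice_sum_bounded by blast
  show thesis
  proof (rule that[of "(K * M) powr (1 / p) * real (card I) powr (1 / p)"])
    fix k :: int and F :: "'i \<Rightarrow> real^'d \<Rightarrow> complex^'m" and v :: "int^'d \<Rightarrow> complex^'m"
      and s :: "(real^'d) set \<Rightarrow> complex^'m"
    assume v: "\<And>j. sampled_at A \<theta> I F k j (v j)"
      and s: "\<And>j. s (dcube A j k) = complex_of_real (\<bar>det A\<bar> powr (- (of_int k / 2))) *s v j"
    define Q where "Q j = dcube A j k" for j
    have Qm[measurable]: "Q j \<in> sets lebesgue" for j using dcube_measure(1)[OF A] by (auto simp: Q_def)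
    define f where "f x j = ennreal (weight_norm p W x (v j)) * indicator (Q j) x" for x j
    define g where "g i y = weight_norm p W y (F i y) powr p" for i y
    have gm: "g i \<in> borel_measurable lebesgue" if "i \<in> I" for i
    proof -
      have "F i \<in> borel_measurable lebesgue" using v that by (intro borel_measurable_lebesgueI) (auto simp: sampled_at_def)
      then have "(\<lambda>y. weight_norm p W y (F i y)) \<in> borel_measurable lebesgue" unfolding weight_norm_def
        by (intro measurable_compose[OF borel_measurable_matrix_vector_complex[OF matrix_weight_measurable[OF mw]] borel_measurable_norm])
      then show ?thesis unfolding g_def[abs_def] by measurable
    qed
    have inner: "(\<Sum>\<^sub>\<infinity>Q\<in>{Q \<in> dcubes A. measure lebesgue Q = \<bar>det A\<bar> powi (- k)}.
            ennreal (measure lebesgue Q powr (- (1 / 2)) * norm (mat_powr (W x) (1 / p) *v s Q))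
              * indicator Q x) = (\<integral>\<^sup>+j. f x j \<partial>count_space UNIV)" for x
    proof -
      have m: "measure lebesgue (Q j) powr (- (1 / 2)) * norm (mat_powr (W x) (1 / p) *v s (Q j)) = weight_norm p W x (v j)" for j
      proof -
        have "measure lebesgue (Q j) = \<bar>det A\<bar> powr (- real_of_int k)"
          using dcube_measure(2)[OF A, of j k] powi_eq_powr[OF det, of "- k"]
          by (simp add: measure_def zero_le_power_int Q_def)
        then have "measure lebesgue (Q j) powr (- (1 / 2)) = \<bar>det A\<bar> powr (of_int k / 2)"
          by (simp add: powr_powr)
        moreover have "\<bar>det A\<bar> powr (of_int k / 2) * \<bar>det A\<bar> powr (- (of_int k / 2)) = 1"
          using det by (simp flip: powr_add)
        ultimately show ?thesis
          unfolding Q_def s matrix_vector_cscale norm_cscale weight_norm_def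
          by (simp add: norm_of_real mult.assoc[symmetric])
      qed
      have "(\<Sum>\<^sub>\<infinity>Q\<in>range Q. ennreal (measure lebesgue Q powr (- (1 / 2)) * norm (mat_powr (W x) (1 / p) *v s Q))
              * indicator Q x) = (\<Sum>\<^sub>\<infinity>j. f x j)"
        using inj_dcube[OF A, of k] by (subst infsum_reindex) (auto simp: Q_def[abs_def] f_def[abs_def] o_def m[unfolded Q_def])
      also have "\<dots> = (\<integral>\<^sup>+j. f x j \<partial>count_space UNIV)"
        by (rule infsum_eq_nn_integral[OF countable_int_vec])
      finally show ?thesis unfolding dcubes_level[OF A det] Q_def .
    qed
    have "(\<integral>\<^sup>+x. ennpowr (\<integral>\<^sup>+j. f x j \<partial>count_space UNIV) p \<partial>lebesgue) =
        (\<integral>\<^sup>+x. (\<integral>\<^sup>+j. ennreal (weight_norm p W x (v j) powr p) * indicator (Q j) x \<partial>count_space UNIV) \<partial>lebesgue)"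
    proof (rule nn_integral_cong_AE)
      show "AE x in lebesgue. ennpowr (\<integral>\<^sup>+j. f x j \<partial>count_space UNIV) p =
          (\<integral>\<^sup>+j. ennreal (weight_norm p W x (v j) powr p) * indicator (Q j) x \<partial>count_space UNIV)"
        using dcubes_almost_disjoint[OF A, of k]
      proof eventually_elim
        case (elim x)
        have "ennpowr (\<integral>\<^sup>+j. f x j \<partial>count_space UNIV) p = (\<integral>\<^sup>+j. ennpowr (f x j) p \<partial>count_space UNIV)"
        proof (rule ennpowr_lattice_sum_single)
          fix j j' assume "f x j \<noteq> 0" "f x j' \<noteq> 0"
          then have "x \<in> dcube A j k" "x \<in> dcube A j' k" by (auto simp: f_def Q_def indicator_def split: if_splits)
          then show "j = j'" using elim by blast
        qed
        also have "\<dots> = (\<integral>\<^sup>+j. ennreal (weight_norm p W x (v j) powr p) * indicator (Q j) x \<partial>count_space UNIV)"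
          by (intro nn_integral_cong) (auto simp: f_def indicator_def ennpowr_ennreal weight_norm_def)
        finally show ?case .
      qed
    qed
    also have "\<dots> = (\<integral>\<^sup>+j. (\<integral>\<^sup>+x. ennreal (weight_norm p W x (v j) powr p) * indicator (Q j) x \<partial>lebesgue) \<partial>count_space UNIV)"
    proof (rule nn_integral_count_space_nn_integral[OF countable_int_vec])
      fix j
      have [measurable]: "(\<lambda>x. weight_norm p W x (v j)) \<in> borel_measurable lebesgue"
        by (rule weight_norm_measurable[OF mw])
      show "(\<lambda>x. ennreal (weight_norm p W x (v j) powr p) * indicator (Q j) x) \<in> borel_measurable lebesgue"
        by measurable
    qed
    also have "\<dots> \<le> (\<integral>\<^sup>+j. ennreal K * (\<Sum>i\<in>I. (\<integral>\<^sup>+y. ennreal (g i y * lattice_kernel (mat_powi A k *v y - int_vec j)) \<partial>lebesgue)) \<partial>count_space UNIV)"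
      unfolding Q_def g_def by (intro nn_integral_mono cube v)
    also have "\<dots> = ennreal K * (\<Sum>i\<in>I. (\<integral>\<^sup>+j. (\<integral>\<^sup>+y. ennreal (g i y * lattice_kernel (mat_powi A k *v y - int_vec j)) \<partial>lebesgue) \<partial>count_space UNIV))"
      by (simp add: nn_integral_cmult nn_integral_sum)
    also have "\<dots> \<le> ennreal K * (\<Sum>i\<in>I. ennreal M * (\<integral>\<^sup>+y. ennreal (g i y) \<partial>lebesgue))"
    proof (intro mult_left_mono sum_mono)
      fix i assume i: "i \<in> I"
      note [measurable] = gm[OF i]
      have km: "(\<lambda>y. lattice_kernel (mat_powi A k *v y - int_vec j)) \<in> borel_measurable lebesgue" for j
        by (rule borel_measurable_lebesgueI) measurable
      have g0: "0 \<le> g i y" for y by (simp add: g_def)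
      have "(\<integral>\<^sup>+j. (\<integral>\<^sup>+y. ennreal (g i y * lattice_kernel (mat_powi A k *v y - int_vec j)) \<partial>lebesgue) \<partial>count_space UNIV) =
          (\<integral>\<^sup>+y. (\<integral>\<^sup>+j. ennreal (g i y * lattice_kernel (mat_powi A k *v y - int_vec j)) \<partial>count_space UNIV) \<partial>lebesgue)"
        by (rule nn_integral_count_space_nn_integral[symmetric, OF countable_int_vec])
          (rule measurable_compose[OF borel_measurable_times[OF gm[OF i] km] measurable_ennreal])
      also have "\<dots> = (\<integral>\<^sup>+y. ennreal (g i y) * (\<integral>\<^sup>+j. ennreal (lattice_kernel (mat_powi A k *v y - int_vec j)) \<partial>count_space UNIV) \<partial>lebesgue)"
        using g0 by (intro nn_integral_cong) (simp add: ennreal_mult lattice_kernel_nonneg nn_integral_cmult)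
      also have "\<dots> \<le> (\<integral>\<^sup>+y. ennreal (g i y) * ennreal M \<partial>lebesgue)"
        by (intro nn_integral_mono mult_left_mono M) simp
      also have "\<dots> = ennreal M * (\<integral>\<^sup>+y. ennreal (g i y) \<partial>lebesgue)"
        unfolding mult.commute[of _ "ennreal M"] by (rule nn_integral_cmult) measurable
      finally show "(\<integral>\<^sup>+j. (\<integral>\<^sup>+y. ennreal (g i y * lattice_kernel (mat_powi A k *v y - int_vec j)) \<partial>lebesgue) \<partial>count_space UNIV) \<le>
          ennreal M * (\<integral>\<^sup>+y. ennreal (g i y) \<partial>lebesgue)" .
    qed simp
    also have "\<dots> = ennreal (K * M) * (\<Sum>i\<in>I. (\<integral>\<^sup>+y. ennreal (g i y) \<partial>lebesgue))"
      using K M by (simp add: ennreal_mult mult.assoc flip: sum_distrib_left)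
    finally have "ennpowr (\<integral>\<^sup>+x. ennpowr (\<integral>\<^sup>+j. f x j \<partial>count_space UNIV) p \<partial>lebesgue) (1 / p) \<le>
        ennpowr (ennreal (K * M) * (\<Sum>i\<in>I. (\<integral>\<^sup>+y. ennreal (g i y) \<partial>lebesgue))) (1 / p)"
      using p by (intro ennpowr_mono) auto
    also have "\<dots> = ennreal ((K * M) powr (1 / p)) * ennpowr (\<Sum>i\<in>I. (\<integral>\<^sup>+y. ennreal (g i y) \<partial>lebesgue)) (1 / p)"
      using p K M by (subst ennpowr_mult) (auto simp: ennpowr_ennreal)
    also have "\<dots> \<le> ennreal ((K * M) powr (1 / p)) * (ennreal (real (card I) powr (1 / p)) *
        (\<Sum>i\<in>I. ennpowr (\<integral>\<^sup>+y. ennreal (g i y) \<partial>lebesgue) (1 / p)))"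
      using p by (intro mult_left_mono ennpowr_sum_le I) auto
    also have "\<dots> = ennreal ((K * M) powr (1 / p) * real (card I) powr (1 / p)) * (\<Sum>i\<in>I. weighted_Lp_norm p W (F i))"
      by (simp add: ennreal_mult mult.assoc weighted_Lp_norm_def Lp_norm_def g_def weight_norm_def ennpowr_ennreal)
    finally show "level_norm A W p s k \<le>
        ennreal ((K * M) powr (1 / p) * real (card I) powr (1 / p)) * (\<Sum>i\<in>I. weighted_Lp_norm p W (F i))"
      unfolding level_norm_def Lp_norm_def inner .
  qed simp
qed

section \<open>The \<open>\<phi>\<close>-transform\<close>

lemma class_representative_tempered:
  assumes "F \<in> tempered_mod_poly"
  shows "(SOME u. u \<in> F) \<in> tempered"
proof -
  from assms obtain u where u: "u \<in> tempered" "F = mod_poly `` {u}"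
    by (auto simp: tempered_mod_poly_def elim: quotientE)
  have "(u, u) \<in> mod_poly"
    using u(1) polynomial_function_const[of 0] by (auto simp: mod_poly_def intro!: exI[of _ "\<lambda>x. 0"])
  then have "u \<in> F" using u(2) by blast
  then have "(SOME u. u \<in> F) \<in> F" by (rule someI[of "\<lambda>u. u \<in> F"])
  then show ?thesis using u(2) by (auto simp: mod_poly_def)
qed

text \<open>Substitution of \<open>mat_powi A k *v w - c\<close> for the variable of integration. The normalisation of \<open>dilate\<close>
  absorbs the Jacobian and raises the level of \<open>\<phi>\<close> from \<open>i\<close> to \<open>k + i\<close>.\<close>

lemma convolve_dilate:
  fixes A :: "real^'d^'d"
  assumes A: "invertible A" and \<phi>: "\<phi> \<in> schwartz" and [measurable]: "\<theta> \<in> borel_measurable borel"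
  shows "convolve (\<lambda>x. dilate A \<phi> i (- x)) \<theta> (mat_powi A k *v x - c) =
    convolve (\<lambda>x. dilate A \<phi> (k + i) (- x)) (\<lambda>w. \<theta> (mat_powi A k *v w - c)) x"
proof -
  define M where "M = mat_powi A k"
  have M: "invertible M" unfolding M_def by (rule invertible_mat_powi[OF A])
  have det: "det A \<noteq> 0" using A by (simp add: invertible_det_nz)
  define f where "f y = dilate A \<phi> i (- (M *v x - c - y)) * \<theta> y" for y
  have [measurable]: "dilate A \<phi> i \<in> borel_measurable borel" by (intro schwartz_borel schwartz_dilate \<phi> A)
  have fm[measurable]: "f \<in> borel_measurable borel" unfolding f_def[abs_def] by measurable
  have fM: "(\<lambda>w. f (M *v w)) \<in> borel_measurable borel" by measurable
  have pt: "f (M *v (w - mat_powi A (- k) *v c)) = complex_of_real (\<bar>det A\<bar> powi (- k)) *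
      (dilate A \<phi> (k + i) (- (x - w)) * \<theta> (M *v w - c))" for w
  proof -
    have Mw: "M *v (w - mat_powi A (- k) *v c) = M *v w - c"
      by (simp add: matrix_vector_mult_diff_distrib M_def mat_powi_minus_cancel[OF A])
    have "mat_powi A i *v (- (M *v x - c - (M *v w - c))) = mat_powi A i *v (M *v (- (x - w)))"
      by (simp add: matrix_vector_mult_diff_distrib)
    also have "\<dots> = mat_powi A (k + i) *v (- (x - w))"
      using mat_powi_add[OF A, of i k] by (simp add: M_def matrix_vector_mul_assoc add.commute)
    finally have "dilate A \<phi> i (- (M *v x - c - (M *v w - c))) =
        complex_of_real (\<bar>det A\<bar> powi (- k)) * dilate A \<phi> (k + i) (- (x - w))"
      using det by (simp add: dilate_def power_int_add power_int_minus field_simps)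
    then show ?thesis by (simp add: f_def Mw)
  qed
  have "convolve (\<lambda>x. dilate A \<phi> i (- x)) \<theta> (mat_powi A k *v x - c) = (LINT y|lborel. f y)"
    by (simp add: convolve_def f_def M_def)
  also have "\<dots> = complex_of_real (\<bar>det A\<bar> powi k) * (LINT w|lborel. f (M *v w))"
    unfolding integral_linear[OF M fm] by (simp add: M_def det_mat_powi[OF A] power_int_abs)
  also have "(LINT w|lborel. f (M *v w)) = (LINT w|lborel. f (M *v (w - mat_powi A (- k) *v c)))"
    by (rule integral_translate[OF fM, symmetric])
  also have "\<dots> = complex_of_real (\<bar>det A\<bar> powi (- k)) *
      convolve (\<lambda>x. dilate A \<phi> (k + i) (- x)) (\<lambda>w. \<theta> (mat_powi A k *v w - c)) x"
    unfolding pt by (simp add: convolve_def M_def)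
  also have "complex_of_real (\<bar>det A\<bar> powi k) * (complex_of_real (\<bar>det A\<bar> powi (- k)) * z) = z" for z
    using det by (simp add: power_int_minus)
  finally show ?thesis .
qed

text \<open>The reproducing formula is rescaled to level \<open>k\<close>, and the distribution is moved inside the
  convolution integrals.\<close>

lemma tempered_reproducing:
  fixes A :: "real^'d^'d"
  assumes A: "invertible A" and \<phi>: "\<phi> \<in> schwartz" and u: "u \<in> tempered" and I: "finite I"
    and \<theta>: "\<And>i. i \<in> I \<Longrightarrow> rapidly_decreasing (\<theta> i)" "\<And>i. i \<in> I \<Longrightarrow> \<theta> i \<in> borel_measurable borel"
    and rep: "\<And>x. cnj (\<phi> x) = (\<Sum>i\<in>I. convolve (\<lambda>x. dilate A \<phi> i (- x)) (\<theta> i) x)"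
  shows "u (\<lambda>x. cnj (\<phi> (mat_powi A k *v x - c))) =
      (\<Sum>i\<in>I. (LINT y|lborel. u (\<lambda>t. dilate A \<phi> (k + i) (y - t)) * \<theta> i (mat_powi A k *v y - c)))"
    and "i \<in> I \<Longrightarrow> integrable lborel (\<lambda>y. u (\<lambda>t. dilate A \<phi> (k + i) (y - t)) * \<theta> i (mat_powi A k *v y - c))"
    and "continuous_on UNIV (\<lambda>y. u (\<lambda>t. dilate A \<phi> l (y - t)))"
proof -
  define \<Phi> where "\<Phi> l = (\<lambda>x. dilate A \<phi> l (- x))" for l
  have \<Phi>: "\<Phi> l \<in> schwartz" for l unfolding \<Phi>_def by (intro schwartz_reflect schwartz_dilate \<phi> A)
  have shift: "(\<lambda>t. \<Phi> l (t - y)) = (\<lambda>t. dilate A \<phi> l (y - t))" for l y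
    by (simp add: \<Phi>_def)
  define h where "h i = (\<lambda>w. \<theta> i (mat_powi A k *v w - c))" for i
  have h: "rapidly_decreasing (h i)" if "i \<in> I" for i
    using rapidly_decreasing_affine[OF \<theta>(1)[OF that] invertible_mat_powi[OF A, of k], of "- c"] by (simp add: h_def)
  have hm: "h i \<in> borel_measurable borel" if "i \<in> I" for i
    unfolding h_def using \<theta>(2)[OF that] by measurable
  show "continuous_on UNIV (\<lambda>y. u (\<lambda>t. dilate A \<phi> l (y - t)))"
  proof -
    have "rapidly_decreasing (\<lambda>x::real^'d. 0)" by (rule schwartz_rapidly_decreasing[OF schwartz_zero])
    from tempered_convolve(1)[OF u \<Phi>[of l] this] show ?thesis by (simp add: shift)
  qed
  show "integrable lborel (\<lambda>y. u (\<lambda>t. dilate A \<phi> (k + i) (y - t)) * \<theta> i (mat_powi A k *v y - c))" if "i \<in> I"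
    using tempered_convolve(2)[OF u \<Phi>[of "k + i"] h[OF that] hm[OF that]] unfolding shift h_def .
  have "(\<lambda>x. cnj (\<phi> (mat_powi A k *v x - c))) = (\<lambda>x. \<Sum>i\<in>I. 1 * convolve (\<Phi> (k + i)) (h i) x)"
    unfolding rep using \<theta>(2) by (auto simp: fun_eq_iff \<Phi>_def h_def convolve_dilate[OF A \<phi>] intro!: sum.cong)
  then have "u (\<lambda>x. cnj (\<phi> (mat_powi A k *v x - c))) = u (\<lambda>x. \<Sum>i\<in>I. 1 * convolve (\<Phi> (k + i)) (h i) x)"
    by (rule arg_cong)
  also have "\<dots> = (\<Sum>i\<in>I. 1 * u (convolve (\<Phi> (k + i)) (h i)))"
    by (intro tempered_sum u I convolve_schwartz(1) \<Phi> h hm)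
  also have "\<dots> = (\<Sum>i\<in>I. (LINT y|lborel. u (\<lambda>t. dilate A \<phi> (k + i) (y - t)) * \<theta> i (mat_powi A k *v y - c)))"
  proof (rule sum.cong)
    fix i assume "i \<in> I"
    from tempered_convolve(3)[OF u \<Phi>[of "k + i"] h[OF this] hm[OF this]]
    show "1 * u (convolve (\<Phi> (k + i)) (h i)) = (LINT y|lborel. u (\<lambda>t. dilate A \<phi> (k + i) (y - t)) * \<theta> i (mat_powi A k *v y - c))"
      unfolding shift h_def by simp
  qed simp
  finally show "u (\<lambda>x. cnj (\<phi> (mat_powi A k *v x - c))) =
      (\<Sum>i\<in>I. (LINT y|lborel. u (\<lambda>t. dilate A \<phi> (k + i) (y - t)) * \<theta> i (mat_powi A k *v y - c)))" .
qed

theorem theorem3p2: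
  fixes A P :: "real^'d^'d"
    and W :: "real^'d \<Rightarrow> complex^'m^'m"
    and \<phi> \<psi> :: "real^'d \<Rightarrow> complex"
    and \<alpha> p :: real
    and q :: ennreal
  assumes "expansive A"
    and "adapted_ellipsoid A P"
    and "1 \<le> p"
    and "0 < q"
    and "W \<in> Ap_class A P p"
    and "admissible_pair A \<phi> \<psi>"
  shows "\<exists>C>0. \<forall>f\<in>besov_space A \<phi> W \<alpha> p q.
           seq_besov_norm A W \<alpha> p q (phi_transform A \<phi> f)
             \<le> ennreal C * besov_norm A \<phi> W \<alpha> p q f"
proof -
  note ad = assms(2) and p = assms(3) and q = assms(4) and W = assms(5) and adm = assms(6)
  obtain r where A: "invertible A" using adapted_ellipsoid_contraction[OF ad] by metis
  define b where "b = \<bar>det A\<bar>"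
  have b: "1 < b" unfolding b_def by (rule det_gt_1[OF ad])
  have \<phi>: "\<phi> \<in> schwartz" and \<psi>: "\<psi> \<in> schwartz" using adm by (auto simp: admissible_pair_def)
  define \<theta> where "\<theta> i = convolve (\<lambda>x. cnj (dilate A \<psi> i x)) (\<lambda>x. cnj (\<phi> x))" for i
  obtain N :: nat where rep:
    "\<And>x. cnj (\<phi> x) = (\<Sum>i\<in>{- int N..int N}. convolve (\<lambda>x. dilate A \<phi> i (- x)) (\<theta> i) x)"
    using reproducing_formula[OF ad adm] unfolding \<theta>_def by blast
  define I where "I = {- int N..int N}"
  have I: "finite I" by (simp add: I_def)
  have \<theta>: "\<theta> i \<in> schwartz" for i unfolding \<theta>_def
    by (intro convolve_schwartz(1) schwartz_cnj schwartz_dilate schwartz_rapidly_decreasing schwartz_borel \<phi> \<psi> A)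
  note \<theta>' = schwartz_rapidly_decreasing[OF \<theta>] schwartz_borel[OF \<theta>]
  obtain C where C: "0 \<le> C" and level:
    "\<And>k F v s. (\<And>j. sampled_at A \<theta> I F k j (v j)) \<Longrightarrow>
      (\<And>j. s (dcube A j k) = complex_of_real (\<bar>det A\<bar> powr (- (of_int k / 2))) *s v j) \<Longrightarrow>
      level_norm A W p s k \<le> ennreal C * (\<Sum>i\<in>I. weighted_Lp_norm p W (F i))"
    by (rule level_estimate[where \<theta> = \<theta>, OF ad W p I \<theta>']) blast+
  \<comment> \<open>the constant of \<open>weighted_lq_norm_shift\<close>; it may vanish, whence \<open>\<bar>D\<bar> + 1\<close> below\<close>
  define D where "D = (if q = \<infinity> then C * (\<Sum>i\<in>I. b powr (- (of_int i * \<alpha>)))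
      else (C powr enn2real q * real (card I) powr enn2real q *
        (\<Sum>i\<in>I. b powr (- (of_int i * \<alpha> * enn2real q)))) powr (1 / enn2real q))"
  have "seq_besov_norm A W \<alpha> p q (phi_transform A \<phi> f) \<le> ennreal (\<bar>D\<bar> + 1) * besov_norm A \<phi> W \<alpha> p q f"
    if f: "f \<in> besov_space A \<phi> W \<alpha> p q" for f
  proof -
    define u where "u c = (SOME u. u \<in> f $ c)" for c
    have u: "u c \<in> tempered" for c
      using f unfolding u_def by (intro class_representative_tempered) (auto simp: besov_space_def)
    have act: "class_act (f $ c) g = u c g" for c g by (simp add: class_act_def u_def)
    define F where "F l y = (\<chi> c. convol (f $ c) (dilate A \<phi> l) y)" for l y
    have F: "F l y $ c = u c (\<lambda>t. dilate A \<phi> l (y - t))" for l y c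
      by (simp add: F_def convol_def act)
    note repr = tempered_reproducing[OF A \<phi> u I \<theta>' rep[folded I_def]]
    have "seq_besov_norm A W \<alpha> p q (phi_transform A \<phi> f) \<le> ennreal D * besov_norm A \<phi> W \<alpha> p q f"
      unfolding seq_besov_norm_eq besov_norm_def b_def[symmetric] D_def
    proof (rule weighted_lq_norm_shift[OF _ q C I])
      show "0 < b" using b by simp
      fix k
      \<comment> \<open>the coefficients of level \<open>k\<close>, multiplied by \<open>b powr (k / 2)\<close>\<close>
      define v where "v j = (\<chi> c. complex_of_real (b powi k) * u c (\<lambda>x. cnj (\<phi> (mat_powi A k *v x - int_vec j))))"
        for j :: "int^'d"
      show "level_norm A W p (phi_transform A \<phi> f) k \<le> ennreal C * (\<Sum>i\<in>I. weighted_Lp_norm p W (\<lambda>x. \<chi> c. convol (f $ c) (dilate A \<phi> (k + i)) x))"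
        unfolding F_def[symmetric]
      proof (rule level)
        have "F l \<in> borel_measurable borel" for l
        proof -
          have "continuous_on UNIV (\<lambda>y. \<chi> c. F l y $ c)"
            unfolding F by (intro continuous_on_vec_lambda repr)
          then show ?thesis by (simp add: borel_measurable_continuous_onI)
        qed
        then show "sampled_at A \<theta> I (\<lambda>i. F (k + i)) k j (v j)" for j
          unfolding sampled_at_def F v_def vec_lambda_beta b_def[symmetric] repr(1)
          using repr(2) by blast
        show "phi_transform A \<phi> f (dcube A j k) = complex_of_real (\<bar>det A\<bar> powr (- (of_int k / 2))) *s v j" for j
        proof -
          let ?g = "\<lambda>x. cnj (\<phi> (mat_powi A k *v x - int_vec j))"
          have g: "?g \<in> schwartz"
            using schwartz_cnj[OF schwartz_affine[OF \<phi> invertible_mat_powi[OF A, of k], of "- int_vec j"]] by simp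
          have "phi_transform A \<phi> f (dcube A j k) $ c = complex_of_real (b powr (of_int k / 2)) * u c ?g" for c
            using tempered_cmult[OF u g, of c "complex_of_real (b powr (of_int k / 2))"]
            by (simp add: phi_transform_def pairing_def act wavelet_def dcube_index_dcube[OF A b[unfolded b_def]] b_def)
          moreover have "b powr (- (of_int k / 2)) * b powi k = b powr (of_int k / 2)"
            using b by (simp add: powi_eq_powr flip: powr_add)
          then have "complex_of_real (b powr (- (of_int k / 2))) * (complex_of_real (b powi k) * z) =
              complex_of_real (b powr (of_int k / 2)) * z" for z
            by (metis mult.assoc of_real_mult)
          ultimately show ?thesis
            unfolding vec_eq_iff b_def[symmetric] vector_smult_component v_def vec_lambda_beta by (simp only:) simp
        qed
      qed
    qed
    also have "\<dots> \<le> ennreal (\<bar>D\<bar> + 1) * besov_norm A \<phi> W \<alpha> p q f"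
      by (intro mult_right_mono ennreal_leI) auto
    finally show ?thesis .
  qed
  then show ?thesis by (intro exI[of _ "\<bar>D\<bar> + 1"]) auto
qed

end
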